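(* Let $A\in\mathbb{R}_+^{n\times n}$ be irreducible with degree of cyclicity $h$, and let $b\in\mathbb{R}_+^n$ be such that $\operatorname{rank}(\mathrm{conmat}_n(A,b))=n$. Let $S\in\mathbb{R}^{n\times n}$ be nonsingular with $$S^{-1}AS=\begin{bmatrix} A_1 & 0 \\ 0 & A_2 \end{bmatrix},$$ where $A_1\in\mathbb{R}^{h\times h}$ has $\mathrm{spec}(A_1)=\sigma^\rho(A)$ and $A_2\in\mathbb{R}^{(n-h)\times(n-h)}$ has $\mathrm{spec}(A_2)=\sigma^-(A)$. Then the following statements are equivalent: (a) The infinite controllable subset $\mathrm{Conset}_\infty(A,b)$ is polyhedral, and hence there exists an integer $k^*\in\mathbb{Z}_+$ such that $$\mathrm{Conset}_\infty(A,b)=\mathrm{cone}(b,Ab,\dots,A^{k^*-1}b,A_{f,0}b,\dots,A_{f,h-1}b).$$ (b) The matrix $A_2$ has a nonnegative recursion. (c) If there is a positive real $\lambda_r\in\mathrm{spec}(A_2)$, then all of the following hold: (c1) $\lambda_r=\rho(A_2)$; (c2) every $\lambda\in\sigma^\rho(A_2)$ has the form $\lambda=\rho(A_2)\exp(\phi_\lambda 2\pi i)$ with $\phi_\lambda\in\mathbb{Q}$; (c3) all eigenvalues in $\sigma^\rho(A_2)$ are simple eigenvalues of $A_2$; (c4) no nonzero $\lambda^-\in\sigma^-(A_2)$ has a polar angle which is an integer multiple of $2\pi/(Mh)$, where $M$ is the minimal positive integer such that $\sigma^\rho(A_2)\subseteq\{\rho(A_2)\exp(2k\pi i/(Mh)):k=0,\dots,Mh-1\}$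 (such an $M$ exists when (c2) holds).
   Context: $\mathbb{R}_+=[0,\infty)$, $\mathbb{Z}_+=\{1,2,\dots\}$. $\mathrm{cone}(\cdot)$ is the set of all finite nonnegative linear combinations of the given vectors; a cone is polyhedral if it is generated by finitely many vectors. $\mathrm{spec}$ is the set of eigenvalues and $\rho$ the spectral radius. For a square matrix $B$, $\sigma^\rho(B)=\{\lambda\in\mathrm{spec}(B):|\lambda|=\rho(B)\}$ and $\sigma^-(B)=\{\lambda\in\mathrm{spec}(B):|\lambda|<\rho(B)\}$. (If $h=n$, $A_2$ is the empty matrix and (b) and (c) hold vacuously.) A matrix $A\in\mathbb{R}_+^{n\times n}$ is reducible if for some permutation matrix $P$, $P^TAP=\begin{bmatrix} A_{11} & 0 \\ A_{21} & A_{22} \end{bmatrix}$ with square nonempty diagonal blocks; otherwise it is irreducible (a $1\times1$ matrix is regarded as irreducible exactly when its entry is strictly positive). An irreducible $A$ has degree of cyclicity $h$ ($1\le h\le n$) if its eigenvalues of modulus $\rho(A)$ are simple and are exactly $\rho(A)e^{2\pi i k/h}$, $k=0,\dots,h-1$. By Perron–Frobenius the decomposition into $A_1,A_2$ exists. A real square matrix $B$ has a nonnegative recursion if there exist $m\in\mathbb{N}$ and $c_0,\dots,c_{m-1}\ge 0$ with $B^{m}=\sum_{i=0}^{m-1}c_iB^i$. For the system $x(t+1)=Ax(t)+bu(t)$, $x(0)=0$, with scalar inputs $u(t)\ge0$: $\mathrm{conmat}_k(A,b)=[b\ Ab\ \dots\ A^{k-1}b]$; $\mathrm{Conset}_k(A,b)=\{\sum_{i=1}^{k}A^{i-1}b\,u(k-i):u(0),\dots,u(k-1)\ge0\}$;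 $\mathrm{Conset}_{\mathrm f}(A,b)=\bigcup_{k\ge1}\mathrm{Conset}_k(A,b)$; $\mathrm{Conset}_\infty(A,b)=\overline{\mathrm{Conset}_{\mathrm f}(A,b)}$ (Euclidean closure). $A_{f,i}=\lim_{k\to\infty}\frac{A^{kh}}{\rho(A)^{kh}}A^i$, $i=0,\dots,h-1$ (these limits exist). *)

theory Defs
  imports
    "Jordan_Normal_Form.DL_Rank"
    "Jordan_Normal_Form.Spectral_Radius"
begin

section \<open>Spectra of real matrices\<close>

text \<open>Eigenvalues of a real matrix are complex. On the empty matrix \<open>spec\<close> is empty
  and \<open>rho\<close> is a maximum over the empty set, hence unspecified; \<open>sigma_rho\<close> and
  \<open>sigma_minus\<close> are then empty regardless.\<close>

abbreviation cmat :: "real mat \<Rightarrow> complex mat" where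
  "cmat B \<equiv> map_mat complex_of_real B"

definition spec :: "real mat \<Rightarrow> complex set" where
  "spec B = spectrum (cmat B)"

definition rho :: "real mat \<Rightarrow> real" where
  "rho B = spectral_radius (cmat B)"

definition sigma_rho :: "real mat \<Rightarrow> complex set" where
  "sigma_rho B = {z \<in> spec B. cmod z = rho B}"

definition sigma_minus :: "real mat \<Rightarrow> complex set" where
  "sigma_minus B = {z \<in> spec B. cmod z < rho B}"

definition simple_eigenvalue :: "real mat \<Rightarrow> complex \<Rightarrow> bool" where
  "simple_eigenvalue B z \<longleftrightarrow> z \<in> spec B \<and> order z (char_poly (cmat B)) = 1"

section \<open>Irreducible nonnegative matrices\<close>

definition nonneg_mat :: "real mat \<Rightarrow> bool" where
  "nonneg_mat A \<longleftrightarrow> (\<forall>a \<in> elements_mat A. 0 \<le> a)"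

definition permutation_matrix :: "nat \<Rightarrow> real mat \<Rightarrow> bool" where
  "permutation_matrix n P \<longleftrightarrow>
     (\<exists>p. p permutes {..<n} \<and> P = mat n n (\<lambda>(i, j). if i = p j then 1 else 0))"

definition reducible_mat :: "real mat \<Rightarrow> bool" where
  "reducible_mat A \<longleftrightarrow>
     (\<exists>P A11 A21 A22 r s.
        permutation_matrix (dim_row A) P \<and> 0 < r \<and> 0 < s \<and> r + s = dim_row A \<and>
        A11 \<in> carrier_mat r r \<and> A21 \<in> carrier_mat s r \<and> A22 \<in> carrier_mat s s \<and>
        transpose_mat P * A * P = four_block_mat A11 (0\<^sub>m r s) A21 A22)"

text \<open>No \<open>1 \<times> 1\<close> matrix is reducible in the block sense, so the convention that it
  counts as irreducible only if its entry is positive has to be added.\<close>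

definition irreducible_mat :: "real mat \<Rightarrow> bool" where
  "irreducible_mat A \<longleftrightarrow>
     \<not> reducible_mat A \<and> (dim_row A = 1 \<longrightarrow> 0 < A $$ (0, 0))"

definition degree_of_cyclicity :: "real mat \<Rightarrow> nat \<Rightarrow> bool" where
  "degree_of_cyclicity A h \<longleftrightarrow>
     1 \<le> h \<and> h \<le> dim_row A \<and>
     sigma_rho A =
       {complex_of_real (rho A) * exp (2 * of_real pi * \<i> * of_nat k / of_nat h) | k. k < h} \<and>
     (\<forall>z \<in> sigma_rho A. simple_eigenvalue A z)"

section \<open>Cones and closures in \<open>\<real>\<^sup>n\<close>\<close>

definition cone :: "nat \<Rightarrow> real vec set \<Rightarrow> real vec set" where
  "cone n G = {finsum_vec TYPE(real) n (\<lambda>v. c v \<cdot>\<^sub>v v) F | F c.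
     finite F \<and> F \<subseteq> G \<and> (\<forall>v \<in> F. 0 \<le> c v)}"

definition polyhedral :: "nat \<Rightarrow> real vec set \<Rightarrow> bool" where
  "polyhedral n C \<longleftrightarrow> (\<exists>G. finite G \<and> G \<subseteq> carrier_vec n \<and> C = cone n G)"

text \<open>The type \<^typ>\<open>real vec\<close> contains vectors of every dimension and carries no topology.\<close>

definition euclidean_closure :: "nat \<Rightarrow> real vec set \<Rightarrow> real vec set" where
  "euclidean_closure n X =
     {x \<in> carrier_vec n. \<forall>e > 0. \<exists>y \<in> X. sqrt ((x - y) \<bullet> (x - y)) < e}"

section \<open>Controllable subsets\<close>

definition conmat :: "nat \<Rightarrow> real mat \<Rightarrow> real vec \<Rightarrow> real mat" where
  "conmat k A b = mat_of_cols (dim_row A) (map (\<lambda>i. (A ^\<^sub>m i) *\<^sub>v b) [0..<k])"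

definition Conset :: "nat \<Rightarrow> real mat \<Rightarrow> real vec \<Rightarrow> real vec set" where
  "Conset k A b =
     {finsum_vec TYPE(real) (dim_row A) (\<lambda>i. u (k - i) \<cdot>\<^sub>v ((A ^\<^sub>m (i - 1)) *\<^sub>v b)) {1..k}
      | u :: nat \<Rightarrow> real. \<forall>j < k. 0 \<le> u j}"

definition Conset_fin :: "real mat \<Rightarrow> real vec \<Rightarrow> real vec set" where
  "Conset_fin A b = (\<Union>k \<in> {1..}. Conset k A b)"

definition Conset_inf :: "real mat \<Rightarrow> real vec \<Rightarrow> real vec set" where
  "Conset_inf A b = euclidean_closure (dim_row A) (Conset_fin A b)"

text \<open>Matrix limits are taken entrywise.\<close>

definition mat_lim :: "nat \<Rightarrow> (nat \<Rightarrow> real mat) \<Rightarrow> real mat" where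
  "mat_lim n X = mat n n (\<lambda>(r, c). lim (\<lambda>k. X k $$ (r, c)))"

definition Af :: "real mat \<Rightarrow> nat \<Rightarrow> nat \<Rightarrow> real mat" where
  "Af A h i =
     mat_lim (dim_row A) (\<lambda>k. (1 / rho A ^ (k * h)) \<cdot>\<^sub>m (A ^\<^sub>m (k * h)) * (A ^\<^sub>m i))"

section \<open>Nonnegative recursions and the minimal period\<close>

text \<open>The case \<open>m = 0\<close> reads \<open>1\<^sub>m n = 0\<^sub>m n n\<close>; it occurs only for the empty
  matrix, which has a nonnegative recursion of every length.\<close>

definition nonneg_recursion :: "real mat \<Rightarrow> bool" where
  "nonneg_recursion B \<longleftrightarrow>
     (\<exists>m (c :: nat \<Rightarrow> real). (\<forall>i < m. 0 \<le> c i) \<and>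
        B ^\<^sub>m m =
          finsum (module_mat TYPE(real) (dim_row B) (dim_row B)) (\<lambda>i. c i \<cdot>\<^sub>m (B ^\<^sub>m i)) {..<m})"

text \<open>The least \<open>M\<close> exists as soon as every element of \<^term>\<open>sigma_rho B\<close> is
  \<^term>\<open>rho B\<close> times a root of unity and \<open>h > 0\<close>.\<close>

definition min_period :: "nat \<Rightarrow> real mat \<Rightarrow> nat" where
  "min_period h B = (LEAST M. 0 < M \<and>
     sigma_rho B \<subseteq>
       {complex_of_real (rho B) * exp (2 * of_nat k * of_real pi * \<i> / of_nat (M * h))
        | k. k < M * h})"

end

theory Submission
  imports Defs
begin

text \<open>Scale \<open>A\<close> to spectral radius \<open>1\<close> and let \<open>\<Pi>\<close> be the projection onto its peripheral spectrum. By
  controllability a polynomial annihilates \<open>A2\<close> as soon as it annihilates the \<open>A2\<close>-component of \<open>b\<close>,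
  and then it is a multiple of the characteristic polynomial of \<open>A2\<close>. So a nonnegative recursion is a
  multiple of that polynomial of the form \<open>x\<^sup>m - \<Sum> c\<^sub>i x\<^sup>i\<close> with \<open>c\<^sub>i \<ge> 0\<close>.

  The triangle inequality restricts the roots of such a multiple to those allowed by (c); the
  rotational symmetry of the spectrum (Perron--Frobenius) accounts for the factor \<open>h\<close> in (c4). Conversely
  (c) yields a recursion of the form \<open>F(x\<^sup>d)\<close> with \<open>h\<close> dividing \<open>d\<close> and \<open>F(1) \<ge> 0\<close>. Applied to \<open>b\<close> it leaves
  only \<open>F(1) \<Pi> b\<close>, so \<open>A\<^sup>m b\<close> lies in the cone spanned by lower iterates and \<open>\<Pi> b\<close>; the cone of all
  \<open>A\<^sup>i b\<close> (\<open>i < m\<close>) and \<open>\<Pi> A\<^sup>j b\<close> (\<open>j < h\<close>) is therefore invariant, and it is closed.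

  If the controllable set is polyhedral, each of its extreme rays is spanned by some \<open>A\<^sup>k b\<close> or, as a
  limit of such rays, by some \<open>\<Pi> A\<^sup>j b\<close>. Hence some \<open>A\<^sup>k b\<close> is a nonnegative combination of lower
  iterates and vectors in the range of \<open>\<Pi>\<close>, and applying \<open>1 - \<Pi>\<close> gives a recursion for \<open>A2\<close>.\<close>

section \<open>Nonnegative multiples of real polynomials\<close>

text \<open>A recursion of \<open>A2\<close> alone does not control the peripheral component of
  \<open>b\<close>: there it acts as some polynomial in \<open>A1\<close>, possibly with the wrong
  sign. The recursion used for the cone is therefore rebuilt from (c). Being a polynomial in x^d
  with h dividing d, it acts on that component as a single scalar, which is
  \<open>poly F (rho A ^ d)\<close> since the code carries \<open>rho A\<close> along instead of
  scaling. The scalar is nonnegative because a recursion polynomial stays nonnegative beyond its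
  positive root r^d, and r is kept at or below \<open>rho A\<close>. If \<open>A2\<close> has a
  positive eigenvalue, r is that eigenvalue; otherwise r is inserted artificially between the moduli
  of the eigenvalues of \<open>A2\<close> and \<open>rho A\<close>.

  Nonnegative coefficients originate in one fact: a number off the positive axis has a power in the
  closed left half-plane. Growth of matrix powers is estimated through the remainder of x^k modulo
  the characteristic polynomial, so that no normal form is involved.\<close>

text \<open>Adding a factor x - z to q gives p, and x^(k+1) = (x - z) x^k + z x^k turns into a
  first-order recurrence for the remainders modulo p, driven by the remainders modulo q. Since |z| <
  r strictly, the resulting geometric sum stays of order r^k, and repeated roots cost no polynomial
  factor.\<close>

lemma power_mod_linear_factors_bound:
  fixes zs :: "complex list"
  assumes "\<forall>z \<in> set zs. cmod z < r" and "0 < r"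
  shows "\<exists>C. \<forall>k j. cmod (coeff (monom 1 k mod (\<Prod>z\<leftarrow>zs. [:- z, 1:])) j) \<le> C * r ^ k"
  using assms(1)
proof (induction zs)
  case Nil
  then show ?case using assms(2) by (intro exI[of _ 0]) simp
next
  case (Cons z zs)
  define q where "q = (\<Prod>z\<leftarrow>zs. [:- z, 1:])"
  define p where "p = [:- z, 1:] * q"
  define T where "T k = (monom 1 k :: complex poly) mod p" for k
  from Cons obtain C where C: "\<And>k j. cmod (coeff (monom 1 k mod q) j) \<le> C * r ^ k"
    unfolding q_def by auto
  have C0: "0 \<le> C" using order_trans[OF norm_ge_zero C[of 0 0]] by simp
  have zr: "cmod z < r" using Cons by simp
  have q0: "q \<noteq> 0" unfolding q_def by auto
  have step: "T (Suc k) = [:- z, 1:] * (monom 1 k mod q) + smult z (T k)" for k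
  proof -
    have "monom 1 (Suc k) = [:- z, 1:] * monom (1::complex) k + smult z (monom 1 k)"
      by (simp add: monom_Suc)
    then have "T (Suc k) = ([:- z, 1:] * monom 1 k) mod p + smult z (monom 1 k) mod p"
      unfolding T_def by (simp only: poly_mod_add_left)
    also have "([:- z, 1:] * monom 1 k) mod p = [:- z, 1:] * (monom 1 k mod q)"
      unfolding p_def by (rule mod_mult_mult1)
    also have "smult z (monom 1 k) mod p = smult z (T k)"
      unfolding T_def by (rule mod_smult_left)
    finally show ?thesis .
  qed
  \<comment> \<open>Chosen so that (1 + |z|) C + |z| D <= r D, which lets the bound D r^k reproduce
    itself under the recurrence; the maximum with 1 covers k = 0.\<close>
  define D where "D = max 1 ((1 + cmod z) * C / (r - cmod z))"
  have "cmod (coeff (T k) j) \<le> D * r ^ k" for k j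
  proof (induction k arbitrary: j)
    case 0
    have "0 < degree p" using q0 unfolding p_def by (subst degree_mult_eq) auto
    then have "T 0 = 1" unfolding T_def by (simp add: mod_poly_less)
    then show ?case by (auto simp: D_def coeff_1)
  next
    case (Suc k)
    have "(1 + cmod z) * C / (r - cmod z) \<le> D" by (simp add: D_def)
    then have D1: "(1 + cmod z) * C \<le> D * (r - cmod z)"
      using zr by (simp add: field_simps)
    have c: "coeff ([:- z, 1:] * u) j = (if j = 0 then 0 else coeff u (j - 1)) - z * coeff u j" for u
      by (cases j) auto
    have "cmod (coeff (T (Suc k)) j) \<le> (C * r ^ k + cmod z * (C * r ^ k)) + cmod z * (D * r ^ k)"
      unfolding step coeff_add coeff_smult c
    proof (intro order_trans[OF norm_triangle_ineq] add_mono order_trans[OF norm_triangle_ineq4])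
      show "cmod (if j = 0 then 0 else coeff (monom 1 k mod q) (j - 1)) \<le> C * r ^ k"
        using C C0 assms(2) by auto
    qed (auto simp: norm_mult intro!: mult_left_mono C Suc)
    also have "\<dots> = ((1 + cmod z) * C + cmod z * D) * r ^ k" by (simp add: algebra_simps)
    also have "\<dots> \<le> (D * r) * r ^ k"
      using D1 assms(2) by (intro mult_right_mono) (auto simp: algebra_simps)
    finally show ?case by (simp add: algebra_simps)
  qed
  then show ?case unfolding T_def p_def q_def by auto
qed

abbreviation cpoly :: "real poly \<Rightarrow> complex poly" where
  "cpoly \<equiv> map_poly complex_of_real"

interpretation of_real_poly_hom: map_poly_inj_idom_hom complex_of_real ..

lemma power_mod_bound:
  fixes q :: "real poly"
  assumes "q \<noteq> 0" and "0 < r" and "\<And>z. poly (cpoly q) z = 0 \<Longrightarrow> cmod z < r"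
  shows "\<exists>C. \<forall>k j. \<bar>coeff (monom 1 k mod q) j\<bar> \<le> C * r ^ k"
proof -
  obtain zs where zs: "smult (lead_coeff (cpoly q)) (\<Prod>z\<leftarrow>zs. [:- z, 1:]) = cpoly q"
    using fundamental_theorem_algebra_factorized[of "cpoly q"] by auto
  have l: "lead_coeff (cpoly q) \<noteq> 0" using assms(1) by simp
  have "\<forall>z\<in>set zs. cmod z < r"
  proof
    fix z assume "z \<in> set zs"
    then have "poly (\<Prod>z\<leftarrow>zs. [:- z, 1:]) z = 0" by (induction zs) auto
    then have "poly (cpoly q) z = 0" by (metis zs poly_smult mult_zero_right)
    then show "cmod z < r" by (rule assms(3))
  qed
  from power_mod_linear_factors_bound[OF this assms(2)] obtain C where
    C: "\<And>k j. cmod (coeff (monom 1 k mod (\<Prod>z\<leftarrow>zs. [:- z, 1:])) j) \<le> C * r ^ k" by auto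
  have "\<bar>coeff (monom 1 k mod q) j\<bar> \<le> C * r ^ k" for k j
  proof -
    have "cpoly (monom 1 k mod q) = monom 1 k mod cpoly q"
      by (simp add: of_real_hom.map_poly_mod map_poly_monom)
    also have "\<dots> = monom 1 k mod (\<Prod>z\<leftarrow>zs. [:- z, 1:])"
      by (subst zs[symmetric]) (simp only: mod_smult_right l if_False)
    finally have "complex_of_real (coeff (monom 1 k mod q) j)
        = coeff (monom 1 k mod (\<Prod>z\<leftarrow>zs. [:- z, 1:])) j"
      by (metis coeff_map_poly of_real_0)
    then have "\<bar>coeff (monom 1 k mod q) j\<bar> = cmod (coeff (monom 1 k mod (\<Prod>z\<leftarrow>zs. [:- z, 1:])) j)"
      by (metis norm_of_real)
    then show ?thesis using C by simp
  qed
  then show ?thesis by blast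
qed

text \<open>Normalise z to u on the unit circle. For |w| = 1 one has 1 - Re (w^2) = 2 (1 - Re w) (1
  + Re w), so as long as all real parts are positive, each squaring at least doubles the distance 1
  - Re. This distance would stay below 1, hence it is 0 and u = 1.\<close>

lemma power_Re_nonpos:
  fixes z :: complex
  assumes "\<not> (z \<in> \<real> \<and> 0 < Re z)"
  shows "\<exists>m>0. Re (z ^ m) \<le> 0"
proof (rule ccontr)
  assume neg: "\<not> ?thesis"
  then have pos: "0 < Re (z ^ m)" if "0 < m" for m using that by (meson not_le)
  then have z0: "z \<noteq> 0" using pos[of 1] by auto
  define u where "u = z / of_real (cmod z)"
  have nu: "cmod u = 1" using z0 by (simp add: u_def norm_divide)
  have posu: "0 < Re (u ^ m)" if "0 < m" for m
    using pos[OF that] z0 by (simp add: u_def power_divide flip: of_real_power)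
  have bound: "2 ^ j * (1 - Re u) \<le> 1 - Re (u ^ (2 ^ j))" for j
  proof (induction j)
    case (Suc j)
    define w where "w = u ^ (2 ^ j)"
    have nw: "cmod w = 1" using nu by (simp add: w_def norm_power)
    have wR: "0 < Re w" unfolding w_def by (rule posu) simp
    have le1: "Re w \<le> 1" using complex_Re_le_cmod[of w] nw by simp
    have w2: "u ^ (2 ^ Suc j) = w * w" by (simp add: w_def power_mult power2_eq_square mult.commute[of 2])
    have w2': "Re (w * w) = 2 * (Re w)\<^sup>2 - 1"
      using nw by (simp add: cmod_def power2_eq_square real_sqrt_eq_1_iff)
    then have "1 - Re (w * w) = 2 * (1 - Re w) * (1 + Re w)" by (simp add: power2_eq_square algebra_simps)
    also have "\<dots> \<ge> 2 * (1 - Re w) * 1" using wR le1 by (intro mult_left_mono) auto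
    finally have "2 * (1 - Re w) \<le> 1 - Re (w * w)" by simp
    moreover have "2 ^ j * (1 - Re u) \<le> 1 - Re w" using Suc by (simp only: w_def)
    ultimately have "2 * (2 ^ j * (1 - Re u)) \<le> 1 - Re (w * w)" by argo
    then show ?case by (simp only: w2 power_Suc[of "2::real"] mult.assoc)
  qed simp
  have "Re u = 1"
  proof (rule ccontr)
    assume "Re u \<noteq> 1"
    moreover have "Re u \<le> 1" using complex_Re_le_cmod[of u] nu by simp
    ultimately have p: "0 < 1 - Re u" by simp
    obtain j where "1 / (1 - Re u) < 2 ^ j" using real_arch_pow[of 2 "1 / (1 - Re u)"] by auto
    then have "1 < 2 ^ j * (1 - Re u)" using p by (simp add: field_simps)
    then have "Re (u ^ (2 ^ j)) < 0" using bound[of j] by linarith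
    then show False using posu[of "2 ^ j"] by simp
  qed
  moreover have "Im u = 0" using nu \<open>Re u = 1\<close> by (simp add: cmod_def)
  ultimately have "u = 1" by (simp add: complex_eq_iff)
  then have "z = of_real (cmod z)" using z0 by (simp add: u_def)
  then show False using assms z0 by (metis Re_complex_of_real Reals_of_real zero_less_norm_iff)
qed

text \<open>The witness is \<open>x\<^bsup>2m\<^esup> - 2 Re(w) x\<^sup>m + |w|\<^sup>2\<close> for \<open>w = z\<^sup>m\<close> in the left half-plane.\<close>

lemma nonneg_multiple_of_root:
  fixes z :: complex
  assumes "\<not> (z \<in> \<real> \<and> 0 < Re z)" and "z \<noteq> 0"
  shows "\<exists>Q :: real poly. (\<forall>i. 0 \<le> coeff Q i) \<and> 0 < coeff Q 0 \<and> lead_coeff Q = 1 \<and>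
    [:- z, 1:] dvd cpoly Q \<and> (\<forall>x. poly (cpoly Q) x = 0 \<longrightarrow> cmod x = cmod z)"
proof -
  obtain m where m: "0 < m" "Re (z ^ m) \<le> 0" using power_Re_nonpos[OF assms(1)] by auto
  define w where "w = z ^ m"
  have w0: "w \<noteq> 0" using assms(2) by (simp add: w_def)
  define Q :: "real poly" where "Q = monom 1 (2 * m) + (monom (- 2 * Re w) m + [: (cmod w)\<^sup>2 :])"
  have c: "coeff Q i = (if i = 2 * m then 1 else 0) + ((if i = m then - 2 * Re w else 0)
      + (if i = 0 then (cmod w)\<^sup>2 else 0))" for i
    by (simp add: Q_def coeff_pCons split: nat.split)
  have deg: "degree Q = 2 * m"
  proof -
    have "degree (monom (- 2 * Re w) m + [: (cmod w)\<^sup>2 :]) \<le> m"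
      by (intro degree_add_le degree_monom_le) simp
    then show ?thesis unfolding Q_def using m(1)
      by (subst degree_add_eq_left) (auto simp: degree_monom_eq)
  qed
  have ev: "poly (cpoly Q) x = (x ^ m - w) * (x ^ m - cnj w)" for x
  proof -
    have "cpoly Q = monom 1 (2 * m) + (monom (of_real (- 2 * Re w)) m + [: of_real ((cmod w)\<^sup>2) :])"
      unfolding Q_def by (simp add: of_real_poly_hom.hom_add map_poly_monom of_real_hom.map_poly_pCons_hom)
    moreover have "of_real ((cmod w)\<^sup>2) = w * cnj w" by (rule complex_norm_square)
    moreover have "complex_of_real (- 2 * Re w) = - (w + cnj w)" using complex_add_cnj[of w] by simp
    ultimately have "poly (cpoly Q) x = x ^ (2 * m) + (- (w + cnj w) * x ^ m + w * cnj w)"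
      by (simp only: poly_add poly_monom poly_pCons poly_0 mult_zero_right add_0_right mult_1_left)
    moreover have "X * X + (- (u + v) * X + u * v) = (X - u) * (X - v)" for X u v :: complex
      by (simp add: algebra_simps)
    ultimately show ?thesis by (simp only: mult_2 power_add)
  qed
  show ?thesis
  proof (intro exI[of _ Q] conjI allI impI)
    show "0 \<le> coeff Q i" for i using m w_def by (auto simp: c)
    show "0 < coeff Q 0" using m w0 by (simp add: c)
    show "lead_coeff Q = 1" unfolding deg using m by (simp add: c)
    show "[:- z, 1:] dvd cpoly Q" using ev[of z] by (subst poly_eq_0_iff_dvd[symmetric]) (simp add: w_def)
    fix x assume "poly (cpoly Q) x = 0"
    then have "x ^ m = w \<or> x ^ m = cnj w" using ev by simp
    then have "cmod x ^ m = cmod z ^ m" by (metis complex_mod_cnj norm_power w_def)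
    then show "cmod x = cmod z" using m by (simp add: power_eq_iff_eq_base)
  qed
qed

text \<open>The multiples for the single roots are multiplied together, which preserves nonnegative
  coefficients, a positive constant term and the bound on the moduli of the roots. A zero root would
  destroy the constant term, so zero roots are collected in the separate factor x^s.\<close>

lemma nonneg_multiple_of_roots:
  fixes zs :: "complex list"
  assumes "\<forall>z \<in> set zs. \<not> (z \<in> \<real> \<and> 0 < Re z) \<and> cmod z < r" and "0 < r"
  shows "\<exists>(Q :: real poly) s. (\<forall>i. 0 \<le> coeff Q i) \<and> 0 < coeff Q 0 \<and> lead_coeff Q = 1 \<and>
    (\<Prod>z\<leftarrow>zs. [:- z, 1:]) dvd cpoly (monom 1 s * Q) \<and> (\<forall>x. poly (cpoly Q) x = 0 \<longrightarrow> cmod x < r)"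
  using assms(1)
proof (induction zs)
  case Nil
  show ?case by (intro exI[of _ 1] exI[of _ 0] conjI allI impI) (simp_all add: coeff_1)
next
  case (Cons z zs)
  then obtain Q s where Q: "\<And>i. 0 \<le> coeff Q i" "0 < coeff (Q :: real poly) 0" "lead_coeff Q = 1"
    "(\<Prod>z\<leftarrow>zs. [:- z, 1:]) dvd cpoly (monom 1 s * Q)" "\<And>x. poly (cpoly Q) x = 0 \<Longrightarrow> cmod x < r"
    by auto
  show ?case
  proof (cases "z = 0")
    case True
    have "[:- z, 1:] * (\<Prod>z\<leftarrow>zs. [:- z, 1:]) dvd [:0, 1:] * cpoly (monom 1 s * Q)"
      using Q(4) True by (intro mult_dvd_mono) auto
    also have "[:0, 1:] * cpoly (monom 1 s * Q) = cpoly (monom 1 (Suc s) * Q)"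
      by (simp add: monom_Suc of_real_hom.map_poly_pCons_hom)
    finally show ?thesis using Q by (intro exI[of _ Q] exI[of _ "Suc s"]) auto
  next
    case False
    then obtain Z where Z: "\<And>i. 0 \<le> coeff Z i" "0 < coeff (Z :: real poly) 0" "lead_coeff Z = 1"
      "[:- z, 1:] dvd cpoly Z" "\<And>x. poly (cpoly Z) x = 0 \<Longrightarrow> cmod x = cmod z"
      using nonneg_multiple_of_root[of z] Cons.prems by auto
    have "[:- z, 1:] * (\<Prod>z\<leftarrow>zs. [:- z, 1:]) dvd cpoly Z * cpoly (monom 1 s * Q)"
      using Z Q by (intro mult_dvd_mono)
    also have "\<dots> = cpoly (monom 1 s * (Z * Q))" by (simp add: of_real_poly_hom.hom_mult algebra_simps)
    finally have dvd: "(\<Prod>z\<leftarrow>z # zs. [:- z, 1:]) dvd cpoly (monom 1 s * (Z * Q))" by simp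
    have "0 \<le> coeff (Z * Q) i" for i
      unfolding coeff_mult using Q(1) Z(1) by (intro sum_nonneg) auto
    moreover have "0 < coeff (Z * Q) 0" using Q(2) Z(2) by (simp add: coeff_mult)
    moreover have "lead_coeff (Z * Q) = 1" using Q(3) Z(3) by (simp add: lead_coeff_mult)
    moreover have "cmod x < r" if "poly (cpoly (Z * Q)) x = 0" for x
    proof -
      have "poly (cpoly Z) x = 0 \<or> poly (cpoly Q) x = 0"
        using that by (simp add: of_real_poly_hom.hom_mult)
      then show ?thesis using Q(5) Z(5) Cons.prems by fastforce
    qed
    ultimately show ?thesis using dvd by blast
  qed
qed

section \<open>Recursion polynomials with prescribed roots\<close>

definition recursion_poly :: "real poly \<Rightarrow> bool" where
  "recursion_poly p \<longleftrightarrow> lead_coeff p = 1 \<and> (\<forall>i<degree p. coeff p i \<le> 0)"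

text \<open>After division by x^N the polynomial becomes 1 plus nonpositive multiples of negative
  powers of x, which is nondecreasing on the positive axis.\<close>

lemma recursion_poly_ge_0:
  assumes "recursion_poly F" and "0 < R" and "poly F R = 0" and "R \<le> y"
  shows "0 \<le> poly F y"
proof -
  define N where "N = degree F"
  have e: "poly F x = x ^ N * (1 + (\<Sum>i<N. coeff F i * (1 / x) ^ (N - i)))" if "0 < x" for x
  proof -
    have "poly F x = x ^ N + (\<Sum>i<N. coeff F i * x ^ i)"
      using assms(1) unfolding poly_altdef N_def recursion_poly_def
      by (simp add: lessThan_Suc_atMost[symmetric])
    also have "(\<Sum>i<N. coeff F i * x ^ i) = (\<Sum>i<N. x ^ N * (coeff F i * (1 / x) ^ (N - i)))"
    proof (rule sum.cong)
      fix i assume "i \<in> {..<N}"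
      then have "x ^ N = x ^ i * x ^ (N - i)" by (simp flip: power_add)
      then show "coeff F i * x ^ i = x ^ N * (coeff F i * (1 / x) ^ (N - i))"
        using that by (simp add: power_divide)
    qed simp
    finally show ?thesis by (simp add: sum_distrib_left distrib_left)
  qed
  have y: "0 < y" using assms by linarith
  have "0 = 1 + (\<Sum>i<N. coeff F i * (1 / R) ^ (N - i))"
    using e[OF assms(2)] assms(2,3) by simp
  also have "\<dots> \<le> 1 + (\<Sum>i<N. coeff F i * (1 / y) ^ (N - i))"
    using assms y by (intro add_left_mono sum_mono mult_left_mono_neg power_mono)
      (auto simp: recursion_poly_def N_def frac_le)
  finally show ?thesis using e[OF y] y by simp
qed

lemma recursion_poly_monom_mult:
  assumes "recursion_poly F" shows "recursion_poly (monom 1 s * F)"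
proof -
  have F0: "F \<noteq> 0" using assms by (auto simp: recursion_poly_def)
  have "degree (monom 1 s * F) = s + degree F"
    using F0 by (subst degree_mult_eq) (auto simp: degree_monom_eq monom_eq_0_iff)
  then show ?thesis using assms by (auto simp: recursion_poly_def coeff_monom_mult)
qed

lemma poly_nonneg_pos:
  fixes Q :: "real poly"
  assumes "\<And>i. 0 \<le> coeff Q i" "0 < coeff Q 0" "0 < x"
  shows "0 < poly Q x"
proof -
  have "0 < coeff Q 0 * x ^ 0" using assms by simp
  also have "\<dots> \<le> (\<Sum>i\<le>degree Q. coeff Q i * x ^ i)"
    using assms by (intro member_le_sum) auto
  finally show ?thesis by (simp add: poly_altdef)
qed

text \<open>If \<open>P\<close> is a multiple of \<open>Q\<close> with positive coefficients, then \<open>x\<^sup>k\<close> is congruent to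
  \<open>R\<^sup>k / P(R) \<cdot> P\<close> modulo \<open>(x - R) Q\<close> up to an error of smaller order than \<open>R\<^sup>k\<close>, so for
  large \<open>k\<close> the power is congruent to a polynomial with nonnegative coefficients.\<close>

lemma recursion_multiple_of_roots:
  fixes zs :: "complex list"
  assumes zs: "\<forall>z \<in> set zs. \<not> (z \<in> \<real> \<and> 0 < Re z) \<and> cmod z < R" and R: "0 < R"
  shows "\<exists>F. recursion_poly F \<and> 0 < degree F \<and> poly F R = 0 \<and>
    [:- complex_of_real R, 1:] * (\<Prod>z\<leftarrow>zs. [:- z, 1:]) dvd cpoly F"
proof -
  obtain Q :: "real poly" and s where Q: "\<And>i. 0 \<le> coeff Q i" "0 < coeff Q 0" "lead_coeff Q = 1"
    "(\<Prod>z\<leftarrow>zs. [:- z, 1:]) dvd cpoly (monom 1 s * Q)" "\<And>x. poly (cpoly Q) x = 0 \<Longrightarrow> cmod x < R"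
    using nonneg_multiple_of_roots[OF zs R] by auto
  have Q0: "Q \<noteq> 0" using Q(2) by auto
  define L where "L = degree Q"
  \<comment> \<open>The factor 1 + x + ... + x^L spreads the positive constant term of Q: every
    coefficient of P up to degree L is positive, and these are exactly the places where the error
    term may be negative.\<close>
  define P where "P = Q * (\<Sum>j\<le>L. monom 1 j)"
  have coeffG: "coeff (\<Sum>j\<le>L. monom (1::real) j) i = (if i \<le> L then 1 else 0)" for i
    by (simp add: coeff_sum)
  have Pnn: "0 \<le> coeff P i" for i
    unfolding P_def coeff_mult coeffG using Q(1) by (intro sum_nonneg) auto
  have Ppos: "0 < coeff P i" if "i \<le> L" for i
  proof -
    have "0 < coeff Q 0 * coeff (\<Sum>j\<le>L. monom (1::real) j) (i - 0)" using Q(2) that coeffG by simp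
    also have "\<dots> \<le> coeff P i" unfolding P_def coeff_mult
      using Q(1) coeffG by (intro member_le_sum[of 0]) auto
    finally show ?thesis .
  qed
  have degG: "degree (\<Sum>j\<le>L. monom (1::real) j) \<le> L"
    by (intro degree_sum_le order_trans[OF degree_monom_le]) auto
  have degP: "degree P \<le> 2 * L"
    using degree_mult_le[of Q "\<Sum>j\<le>L. monom 1 j"] degG unfolding P_def L_def by linarith
  have PR: "0 < poly P R" using poly_nonneg_pos[OF Pnn Ppos R] by simp
  have QR: "0 < poly Q R" using poly_nonneg_pos[OF Q(1,2) R] by simp
  define rt where "rt = {x. poly (cpoly Q) x = 0}"
  have frt: "finite rt" unfolding rt_def using Q0 by (intro poly_roots_finite) simp
  define t0 where "t0 = Max (insert 0 (cmod ` rt))"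
  have t0: "0 \<le> t0" "t0 < R" using frt Q(5) R by (auto simp: t0_def rt_def)
  \<comment> \<open>Strictly between the largest modulus of a root of Q and R, so that remainders
    modulo Q grow at most like t^k, which is negligible against R^k.\<close>
  define t where "t = (t0 + R) / 2"
  have t: "0 < t" "t < R" using t0 R by (auto simp: t_def)
  have "cmod x < t" if "poly (cpoly Q) x = 0" for x
  proof -
    have "cmod x \<le> t0" unfolding t0_def using that frt by (intro Max_ge) (auto simp: rt_def)
    then show ?thesis using t0 by (simp add: t_def)
  qed
  from power_mod_bound[OF Q0 t(1) this] obtain C where
    C: "\<And>k j. \<bar>coeff (monom 1 k mod Q) j\<bar> \<le> C * t ^ k" by blast
  define rk where "rk k = monom 1 k mod Q" for k
  \<comment> \<open>Subtracting this multiple of Q makes E k vanish at R while it stays congruent to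
    x^k modulo Q. As P is a multiple of Q, adding \<open>R ^ k / poly P R\<close> times P gives a
    polynomial that still represents x^k modulo Q and also has the value R^k at R.\<close>
  define E where "E k = rk k - smult (poly (rk k) R / poly Q R) Q" for k
  have degrk: "degree (rk k) \<le> L" for k
    unfolding rk_def L_def using degree_mod_less[OF Q0, of "monom 1 k"] by auto
  define S where "S = (\<Sum>j\<le>L. R ^ j)"
  have rkR: "\<bar>poly (rk k) R\<bar> \<le> C * t ^ k * S" for k
  proof -
    have "poly (rk k) R = (\<Sum>j\<le>L. coeff (rk k) j * R ^ j)"
      by (rule poly_as_sum_of_monoms'[OF degrk, THEN arg_cong[where f = "\<lambda>p. poly p R"],
            symmetric, unfolded poly_sum poly_monom])
    also have "\<bar>\<dots>\<bar> \<le> (\<Sum>j\<le>L. \<bar>coeff (rk k) j * R ^ j\<bar>)" by (rule sum_abs)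
    also have "\<dots> \<le> (\<Sum>j\<le>L. C * t ^ k * R ^ j)"
      using C R by (intro sum_mono) (auto simp: abs_mult rk_def intro!: mult_right_mono)
    finally show ?thesis by (simp add: S_def sum_distrib_left)
  qed
  define K where "K = C + C * S / poly Q R * (\<Sum>j\<le>L. coeff Q j)"
  have C0: "0 \<le> C" using order_trans[OF abs_ge_zero C[of 0 0]] by simp
  have S0: "0 \<le> S" unfolding S_def using R by (intro sum_nonneg) auto
  have Eb: "\<bar>coeff (E k) j\<bar> \<le> K * t ^ k" if "j \<le> L" for k j
  proof -
    have "\<bar>coeff (E k) j\<bar> \<le> \<bar>coeff (rk k) j\<bar> + \<bar>poly (rk k) R\<bar> / poly Q R * coeff Q j"
      unfolding E_def using abs_triangle_ineq4[of "coeff (rk k) j" "poly (rk k) R / poly Q R * coeff Q j"]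
        Q(1)[of j] QR by (simp add: abs_mult)
    also have "\<dots> \<le> C * t ^ k + (C * t ^ k * S) / poly Q R * (\<Sum>j\<le>L. coeff Q j)"
      using that QR Q(1) C rkR C0 S0 t
      by (intro add_mono mult_mono divide_right_mono member_le_sum) (auto simp: rk_def)
    finally show ?thesis by (simp add: K_def algebra_simps)
  qed
  define c where "c = Min (coeff P ` {..L})"
  have c: "0 < c" "\<And>i. i \<le> L \<Longrightarrow> c \<le> coeff P i" using Ppos by (auto simp: c_def)
  have "(\<lambda>k. \<bar>K\<bar> * (t / R) ^ k) \<longlonglongrightarrow> \<bar>K\<bar> * 0"
    using t by (intro tendsto_mult_left LIMSEQ_power_zero) auto
  then have "eventually (\<lambda>k. \<bar>K\<bar> * (t / R) ^ k < c / poly P R) sequentially"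
    using c(1) PR by (intro order_tendstoD) auto
  then obtain k0 where k0: "\<And>k. k \<ge> k0 \<Longrightarrow> \<bar>K\<bar> * (t / R) ^ k < c / poly P R"
    by (auto simp: eventually_sequentially)
  \<comment> \<open>Beyond k0 the smallest of the first coefficients of P outweighs the error;
    exceeding 2 L, the bound for the degree of P, makes x^k the leading term of F.\<close>
  define k where "k = max k0 (Suc (2 * L))"
  have kL: "2 * L < k" by (simp add: k_def)
  have kb: "K * t ^ k \<le> R ^ k / poly P R * c"
  proof -
    have "K * t ^ k \<le> R ^ k * (\<bar>K\<bar> * (t / R) ^ k)"
      using R t abs_ge_self[of K] by (simp add: power_divide mult_right_mono)
    also have "\<dots> \<le> R ^ k * (c / poly P R)"
      using k0[of k] R by (intro mult_left_mono) (auto simp: k_def)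
    finally show ?thesis by simp
  qed
  define V where "V = smult (R ^ k / poly P R) P + E k"
  define F where "F = monom 1 k - V"
  have degE: "degree (E k) \<le> L"
    unfolding E_def using degrk by (intro degree_diff_le order_trans[OF degree_smult_le]) (auto simp: L_def)
  have "degree V \<le> 2 * L"
    unfolding V_def using degE degP by (intro degree_add_le order_trans[OF degree_smult_le]) auto
  then have degV: "degree V < k" using kL by simp
  have coV: "0 \<le> coeff V i" for i
  proof (cases "i \<le> L")
    case True
    have "- (K * t ^ k) \<le> coeff (E k) i" using Eb[OF True, of k] by (simp add: abs_le_iff)
    moreover have "R ^ k / poly P R * c \<le> R ^ k / poly P R * coeff P i"
      using c(2)[OF True] PR R by (intro mult_left_mono) auto
    ultimately show ?thesis using kb by (simp add: V_def)
  next
    case False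
    then have "coeff (E k) i = 0" using degE by (intro coeff_eq_0) auto
    then show ?thesis using Pnn[of i] PR R by (simp add: V_def)
  qed
  have degF: "degree F = k" unfolding F_def using degV
    by (subst diff_conv_add_uminus, subst degree_add_eq_left) (auto simp: degree_monom_eq)
  have rF: "recursion_poly F"
    unfolding recursion_poly_def degF using coV degV by (auto simp: F_def coeff_eq_0)
  have FR: "poly F R = 0"
    unfolding F_def V_def E_def using PR QR by (simp add: poly_monom)
  have "Q dvd monom 1 k - rk k" unfolding rk_def by (simp add: minus_mod_eq_mult_div)
  moreover have "F = monom 1 k - rk k - Q * (smult (R ^ k / poly P R) (\<Sum>j\<le>L. monom 1 j) - [:poly (rk k) R / poly Q R:])"
    unfolding F_def V_def E_def P_def by (simp add: algebra_simps)
  ultimately have "Q dvd F" by simp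
  then obtain u where u: "F = Q * u" by blast
  \<comment> \<open>Q is positive at R, so the root R of F must come from the cofactor, and x - R
    and Q divide F jointly.\<close>
  have "poly u R = 0" using FR QR by (simp add: u)
  then have "[:- R, 1:] dvd u" by (simp add: poly_eq_0_iff_dvd)
  then have dv: "[:- R, 1:] * Q dvd F" unfolding u by (subst mult.commute) (rule mult_dvd_mono[OF dvd_refl])
  have "[:- complex_of_real R, 1:] * (\<Prod>z\<leftarrow>zs. [:- z, 1:]) dvd cpoly [:- R, 1:] * cpoly (monom 1 s * Q)"
    using Q(4) by (intro mult_dvd_mono) auto
  also have "\<dots> = cpoly (monom 1 s * ([:- R, 1:] * Q))"
    unfolding of_real_poly_hom.hom_mult by (rule mult.left_commute)
  also have "\<dots> dvd cpoly (monom 1 s * F)"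
    using dv by (intro of_real_poly_hom.hom_dvd mult_dvd_mono) auto
  finally have dvd: "[:- complex_of_real R, 1:] * (\<Prod>z\<leftarrow>zs. [:- z, 1:]) dvd cpoly (monom 1 s * F)" .
  have "F \<noteq> 0" using degF kL by auto
  then have "degree (monom 1 s * F) = s + k"
    using degF by (subst degree_mult_eq) (auto simp: degree_monom_eq monom_eq_0_iff)
  then have "0 < degree (monom 1 s * F)" using kL by simp
  moreover have "poly (monom 1 s * F) R = 0" using FR by simp
  ultimately show ?thesis using recursion_poly_monom_mult[OF rF, of s] dvd by blast
qed

section \<open>Substitution of x^d into recursion polynomials\<close>

lemma distinct_roots_dvd:
  fixes p :: "complex poly"
  assumes "distinct zs" and "\<forall>z \<in> set zs. poly p z = 0"
  shows "(\<Prod>z\<leftarrow>zs. [:- z, 1:]) dvd p"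
  using assms
proof (induction zs arbitrary: p)
  case (Cons z zs)
  from Cons.prems have "[:- z, 1:] dvd p" by (simp add: poly_eq_0_iff_dvd)
  then obtain q where q: "p = [:- z, 1:] * q" by blast
  have "\<forall>x \<in> set zs. poly q x = 0" using Cons.prems by (auto simp: q)
  then have "(\<Prod>z\<leftarrow>zs. [:- z, 1:]) dvd q" using Cons by simp
  then show ?case unfolding q by (simp only: list.map prod_list.Cons mult_dvd_mono dvd_refl)
qed simp

lemma coeff_pcompose_monom:
  fixes F :: "'a::comm_ring_1 poly"
  assumes "0 < d"
  shows "coeff (pcompose F (monom 1 d)) i = (if d dvd i then coeff F (i div d) else 0)"
proof (induction F arbitrary: i)
  case (pCons a F)
  show ?case
  proof (cases "i < d")
    case True
    then show ?thesis using assms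
      by (cases "i = 0") (auto simp: pcompose_pCons coeff_monom_mult coeff_pCons dvd_imp_le split: nat.split)
  next
    case False
    then obtain k where k: "i = d + k" using le_Suc_ex not_less by blast
    then show ?thesis using assms pCons.IH[of k]
      by (auto simp: pcompose_pCons coeff_monom_mult coeff_pCons split: nat.split)
  qed
qed simp

lemma degree_pcompose_monom:
  fixes F :: "'a::idom poly"
  assumes "0 < d" shows "degree (pcompose F (monom 1 d)) = d * degree F"
  by (simp add: degree_pcompose degree_monom_eq)

lemma recursion_poly_pcompose_monom:
  assumes "recursion_poly F" and "0 < d"
  shows "recursion_poly (pcompose F (monom 1 d))"
  unfolding recursion_poly_def degree_pcompose_monom[OF assms(2)] coeff_pcompose_monom[OF assms(2)]
proof (intro conjI allI impI)
  show "(if d dvd d * degree F then coeff F (d * degree F div d) else 0) = 1"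
    using assms by (auto simp: recursion_poly_def)
  fix i assume "i < d * degree F"
  then have "i div d < degree F" using assms(2) by (simp add: div_less_iff_less_mult mult.commute)
  then show "(if d dvd i then coeff F (i div d) else 0) \<le> 0"
    using assms(1) by (auto simp: recursion_poly_def)
qed

text \<open>In the variable y = x^d all peripheral roots collapse to the single root r^d. They are
  simple, so the product of their linear factors divides x^d - r^d, whose roots are distinct. The
  remaining roots have d-th powers off the positive axis and of modulus below r^d, which is the
  situation of \<open>recursion_multiple_of_roots\<close>; multiplicities among them do no
  harm.\<close>

lemma recursion_multiple:
  fixes xs :: "complex list"
  assumes r: "0 < r" and d: "0 < d"
    and xs: "\<And>x. x \<in> set xs \<Longrightarrow> x ^ d = of_real (r ^ d) \<and> count_list xs x = 1 \<or>
      cmod x < r \<and> \<not> (x ^ d \<in> \<real> \<and> 0 < Re (x ^ d))"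
  shows "\<exists>F. recursion_poly F \<and> 0 < degree F \<and> poly F (r ^ d) = 0 \<and>
    (\<Prod>x\<leftarrow>xs. [:- x, 1:]) dvd cpoly (pcompose F (monom 1 d))"
proof -
  define ps where "ps = filter (\<lambda>x. x ^ d = of_real (r ^ d)) xs"
  define zs where "zs = filter (\<lambda>x. x ^ d \<noteq> of_real (r ^ d)) xs"
  have R: "0 < r ^ d" using r by simp
  have split: "(\<Prod>x\<leftarrow>xs. [:- x, 1:]) = (\<Prod>x\<leftarrow>ps. [:- x, 1:]) * (\<Prod>x\<leftarrow>zs. [:- x, 1:])"
  proof -
    have "(\<Prod>x\<leftarrow>xs. f x) = (\<Prod>x\<leftarrow>filter P xs. f x) * (\<Prod>x\<leftarrow>filter (\<lambda>x. \<not> P x) xs. f x)"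
      for f :: "complex \<Rightarrow> complex poly" and P
      by (induction xs) (simp_all add: ac_simps)
    then show ?thesis unfolding ps_def zs_def .
  qed
  have "count_list ps x \<le> 1" for x
  proof (cases "x \<in> set ps")
    case True
    then have x: "x \<in> set xs" "x ^ d = of_real (r ^ d)" by (auto simp: ps_def)
    then have "count_list xs x = 1" using xs[OF x(1)] R by auto
    moreover have "count_list (filter P ys) y \<le> count_list ys y" for P and ys :: "complex list" and y
      by (induction ys) auto
    ultimately show ?thesis unfolding ps_def by metis
  qed (simp add: count_list_0_iff)
  then have dps: "distinct ps"
  proof (induction ps)
    case (Cons a ps)
    then have "count_list ps a = 0" using Cons.prems[of a] by simp
    moreover have "count_list ps x \<le> 1" for x using Cons.prems[of x] by (auto split: if_splits)
    ultimately show ?case using Cons.IH by (simp add: count_list_0_iff)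
  qed simp
  have zs: "\<forall>z \<in> set (map (\<lambda>x. x ^ d) zs). \<not> (z \<in> \<real> \<and> 0 < Re z) \<and> cmod z < r ^ d"
    using xs d r by (auto simp: zs_def norm_power intro!: power_strict_mono)
  obtain F where F: "recursion_poly F" "0 < degree F" "poly F (r ^ d) = 0"
    "[:- complex_of_real (r ^ d), 1:] * (\<Prod>z\<leftarrow>map (\<lambda>x. x ^ d) zs. [:- z, 1:]) dvd cpoly F"
    using recursion_multiple_of_roots[OF zs R] by blast
  let ?c = "\<lambda>p. pcompose p (monom (1::complex) d)"
  have lin: "?c [:- a, 1:] = monom 1 d - [:a:]" for a
    by (simp add: pcompose_pCons)
  have "(\<Prod>x\<leftarrow>ps. [:- x, 1:]) dvd ?c [:- complex_of_real (r ^ d), 1:]"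
    unfolding lin by (rule distinct_roots_dvd[OF dps]) (auto simp: ps_def poly_monom)
  moreover have "(\<Prod>x\<leftarrow>zs. [:- x, 1:]) dvd ?c (\<Prod>z\<leftarrow>map (\<lambda>x. x ^ d) zs. [:- z, 1:])"
  proof (induction zs)
    case (Cons z zs)
    have "[:- z, 1:] dvd ?c [:- (z ^ d), 1:]"
      unfolding lin by (simp add: poly_eq_0_iff_dvd[symmetric] poly_monom)
    from mult_dvd_mono[OF this Cons.IH] show ?case
      by (simp only: list.map prod_list.Cons pcompose_mult)
  qed (simp add: pcompose_1)
  ultimately have "(\<Prod>x\<leftarrow>xs. [:- x, 1:]) dvd
      ?c ([:- complex_of_real (r ^ d), 1:] * (\<Prod>z\<leftarrow>map (\<lambda>x. x ^ d) zs. [:- z, 1:]))"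
    unfolding split pcompose_mult by (rule mult_dvd_mono)
  also have "\<dots> dvd ?c (cpoly F)"
    using F(4) by (metis dvdE dvdI pcompose_mult)
  also have "\<dots> = cpoly (pcompose F (monom 1 d))"
    by (simp add: of_real_hom.map_poly_pcompose map_poly_monom)
  finally show ?thesis using F by blast
qed

section \<open>Polynomials acting on vectors\<close>

text \<open>The vector p(B) v. It is written coordinatewise in terms of the iterates of v, so no
  sums of matrices occur.\<close>

definition pact :: "'a::comm_ring_1 mat \<Rightarrow> 'a poly \<Rightarrow> 'a vec \<Rightarrow> 'a vec" where
  "pact B p v = vec (dim_row B) (\<lambda>i. \<Sum>k\<le>degree p. coeff p k * ((B ^\<^sub>m k) *\<^sub>v v) $ i)"

lemma pact_carrier [simp]: "B \<in> carrier_mat n n \<Longrightarrow> pact B p v \<in> carrier_vec n"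
  by (simp add: pact_def)

lemma dim_pact [simp]: "dim_vec (pact B p v) = dim_row B"
  by (simp add: pact_def)

lemma index_mult_mat_vec_sum:
  assumes "M \<in> carrier_mat n m" and "v \<in> carrier_vec m" and "i < n"
  shows "(M *\<^sub>v v) $ i = (\<Sum>j<m. M $$ (i, j) * v $ j)"
  using assms by (auto simp: scalar_prod_def lessThan_atLeast0)

lemma index_pact:
  assumes "B \<in> carrier_mat n n" and "i < n" and "degree p \<le> N"
  shows "pact B p v $ i = (\<Sum>k\<le>N. coeff p k * ((B ^\<^sub>m k) *\<^sub>v v) $ i)"
proof -
  have "pact B p v $ i = (\<Sum>k\<le>degree p. coeff p k * ((B ^\<^sub>m k) *\<^sub>v v) $ i)"
    using assms by (simp add: pact_def)
  also have "\<dots> = (\<Sum>k\<le>N. coeff p k * ((B ^\<^sub>m k) *\<^sub>v v) $ i)"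
    using assms(3) by (intro sum.mono_neutral_left) (auto simp: coeff_eq_0)
  finally show ?thesis .
qed

lemma pact_add:
  assumes B: "B \<in> carrier_mat n n"
  shows "pact B (p + q) v = pact B p v + pact B q v"
proof (rule eq_vecI)
  fix i assume "i < dim_vec (pact B p v + pact B q v)"
  then have i: "i < n" using B by simp
  define N where "N = max (degree p) (degree q)"
  have "degree (p + q) \<le> N" by (simp add: N_def degree_add_le_max)
  then show "pact B (p + q) v $ i = (pact B p v + pact B q v) $ i"
    using B i by (simp add: index_pact[OF B i, of _ N] N_def sum.distrib algebra_simps)
qed (use B in simp)

lemma pact_smult:
  assumes B: "B \<in> carrier_mat n n"
  shows "pact B (smult c p) v = c \<cdot>\<^sub>v pact B p v"
proof (rule eq_vecI)
  fix i assume "i < dim_vec (c \<cdot>\<^sub>v pact B p v)"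
  then have i: "i < n" using B by simp
  then show "pact B (smult c p) v $ i = (c \<cdot>\<^sub>v pact B p v) $ i"
    using B by (simp add: index_pact[OF B i, of _ "degree p"] degree_smult_le sum_distrib_left mult.assoc)
qed (use B in simp)

lemma pact_0 [simp]: "B \<in> carrier_mat n n \<Longrightarrow> pact B 0 v = 0\<^sub>v n"
  by (auto simp: pact_def)

lemma index_pact_sum:
  assumes B: "B \<in> carrier_mat n n" and "i < n"
  shows "pact B (\<Sum>x\<in>X. p x) v $ i = (\<Sum>x\<in>X. pact B (p x) v $ i)"
  using assms by (induction X rule: infinite_finite_induct) (simp_all add: pact_add[OF B])

lemma pow_mat_mult_vec_carrier [simp]:
  "B \<in> carrier_mat n n \<Longrightarrow> v \<in> carrier_vec n \<Longrightarrow> (B ^\<^sub>m k) *\<^sub>v v \<in> carrier_vec n"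
  by (intro mult_mat_vec_carrier[of _ n n]) auto

lemma pow_mat_mult_vec_Suc:
  fixes B :: "'a::comm_ring_1 mat"
  assumes B: "B \<in> carrier_mat n n" and v: "v \<in> carrier_vec n"
  shows "(B ^\<^sub>m Suc k) *\<^sub>v v = B *\<^sub>v ((B ^\<^sub>m k) *\<^sub>v v)"
proof -
  have "(B ^\<^sub>m k) * B = B * (B ^\<^sub>m k)"
    by (induction k) (use B in \<open>auto simp: assoc_mult_mat[of _ n n _ n _ n]\<close>)
  then show ?thesis using B v by (simp add: assoc_mult_mat_vec[of _ n n _ n])
qed

lemma pow_mat_mult_vec_add:
  fixes B :: "'a::comm_ring_1 mat"
  assumes B: "B \<in> carrier_mat n n" and v: "v \<in> carrier_vec n"
  shows "(B ^\<^sub>m (j + k)) *\<^sub>v v = (B ^\<^sub>m j) *\<^sub>v ((B ^\<^sub>m k) *\<^sub>v v)"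
proof (induction j)
  case (Suc j)
  have w: "(B ^\<^sub>m k) *\<^sub>v v \<in> carrier_vec n" using B v by simp
  show ?case unfolding add_Suc pow_mat_mult_vec_Suc[OF B v] pow_mat_mult_vec_Suc[OF B w] Suc ..
next
  case 0
  have "(B ^\<^sub>m k) *\<^sub>v v \<in> carrier_vec n" using B v by simp
  then show ?case using B by simp
qed

lemma pact_monom:
  assumes B: "B \<in> carrier_mat n n" and v: "v \<in> carrier_vec n"
  shows "pact B (monom c k) v = c \<cdot>\<^sub>v ((B ^\<^sub>m k) *\<^sub>v v)"
proof (rule eq_vecI)
  have c: "(B ^\<^sub>m k) *\<^sub>v v \<in> carrier_vec n" using B v by simp
  fix i assume "i < dim_vec (c \<cdot>\<^sub>v ((B ^\<^sub>m k) *\<^sub>v v))"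
  then have i: "i < n" using B by simp
  have "(\<Sum>j\<le>k. coeff (monom c k) j * ((B ^\<^sub>m j) *\<^sub>v v) $ i) = c * ((B ^\<^sub>m k) *\<^sub>v v) $ i"
    by (subst sum.mono_neutral_right[of "{..k}" "{k}"]) auto
  then show "pact B (monom c k) v $ i = (c \<cdot>\<^sub>v ((B ^\<^sub>m k) *\<^sub>v v)) $ i"
    using i B by (simp only: index_pact[OF B i degree_monom_le]) simp
qed (use B in auto)

lemma pact_1 [simp]:
  assumes B: "B \<in> carrier_mat n n" and v: "v \<in> carrier_vec n"
  shows "pact B 1 v = v"
  using pact_monom[OF B v, of 1 0] B v by (simp add: monom_0 flip: one_pCons)

text \<open>Horner's rule; it makes identities for \<open>pact\<close> accessible to induction on
  \<open>pCons\<close>.\<close>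

lemma pact_pCons:
  assumes B: "B \<in> carrier_mat n n" and v: "v \<in> carrier_vec n"
  shows "pact B (pCons a p) v = a \<cdot>\<^sub>v v + B *\<^sub>v pact B p v"
proof (rule eq_vecI)
  fix i assume "i < dim_vec (a \<cdot>\<^sub>v v + B *\<^sub>v pact B p v)"
  then have i: "i < n" using B by simp
  define N where "N = degree p"
  have d: "degree (pCons a p) \<le> Suc N" by (simp add: N_def degree_pCons_le)
  have c: "(B ^\<^sub>m k) *\<^sub>v v \<in> carrier_vec n" for k using B v by simp
  have "(B *\<^sub>v pact B p v) $ i = (\<Sum>j<n. B $$ (i, j) * (\<Sum>k\<le>N. coeff p k * ((B ^\<^sub>m k) *\<^sub>v v) $ j))"
    by (subst index_mult_mat_vec_sum[OF B pact_carrier[OF B] i])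
      (auto intro!: sum.cong simp: index_pact[OF B _ order_refl] N_def)
  also have "\<dots> = (\<Sum>k\<le>N. coeff p k * (\<Sum>j<n. B $$ (i, j) * ((B ^\<^sub>m k) *\<^sub>v v) $ j))"
    unfolding sum_distrib_left by (subst sum.swap) (simp add: ac_simps)
  also have "\<dots> = (\<Sum>k\<le>N. coeff p k * ((B ^\<^sub>m Suc k) *\<^sub>v v) $ i)"
    unfolding pow_mat_mult_vec_Suc[OF B v] by (subst index_mult_mat_vec_sum[OF B c i]) simp
  finally have "(B *\<^sub>v pact B p v) $ i = (\<Sum>k\<le>N. coeff p k * ((B ^\<^sub>m Suc k) *\<^sub>v v) $ i)" .
  then show "pact B (pCons a p) v $ i = (a \<cdot>\<^sub>v v + B *\<^sub>v pact B p v) $ i"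
    unfolding index_pact[OF B i d] sum.atMost_Suc_shift using B v i by (simp del: pow_mat.simps(2))
qed (use B in simp)

lemma pact_mult:
  assumes B: "B \<in> carrier_mat n n" and v: "v \<in> carrier_vec n"
  shows "pact B (p * q) v = pact B p (pact B q v)"
proof (induction p)
  case (pCons a p)
  have "pact B (pCons a p * q) v = a \<cdot>\<^sub>v pact B q v + pact B (pCons 0 (p * q)) v"
    by (simp add: pact_add[OF B] pact_smult[OF B])
  also have "pact B (pCons 0 (p * q)) v = B *\<^sub>v pact B (p * q) v"
  proof -
    have "0 \<cdot>\<^sub>v v + w = w" if "w \<in> carrier_vec n" for w using v that by auto
    then show ?thesis using B by (simp add: pact_pCons[OF B v])
  qed
  finally show ?case using B by (simp add: pCons pact_pCons[OF B, of "pact B q v"])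
qed (use B in simp)

text \<open>Linearity of p(B) in the vector, in coordinates. It reduces Cayley--Hamilton to unit
  vectors and lets relations between vectors be pushed through a polynomial.\<close>

lemma index_pact_unit_vec:
  assumes B: "B \<in> carrier_mat n n" and v: "v \<in> carrier_vec n" and i: "i < n"
  shows "pact B p v $ i = (\<Sum>s<n. pact B p (unit_vec n s) $ i * v $ s)"
proof -
  have e: "((B ^\<^sub>m k) *\<^sub>v unit_vec n s) $ i = (B ^\<^sub>m k) $$ (i, s)" if "s < n" for k s
    using B i that by (subst index_mult_mat_vec_sum[of _ n n]) (auto simp: if_distrib sum.delta cong: if_cong)
  have "(\<Sum>s<n. pact B p (unit_vec n s) $ i * v $ s)
      = (\<Sum>s<n. \<Sum>k\<le>degree p. coeff p k * ((B ^\<^sub>m k) $$ (i, s) * v $ s))"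
    by (intro sum.cong) (simp_all add: index_pact[OF B i order_refl] e sum_distrib_right mult.assoc)
  also have "\<dots> = (\<Sum>k\<le>degree p. coeff p k * (\<Sum>s<n. (B ^\<^sub>m k) $$ (i, s) * v $ s))"
    by (subst sum.swap) (simp add: sum_distrib_left)
  also have "\<dots> = pact B p v $ i"
    unfolding index_pact[OF B i order_refl]
    using B v i by (intro sum.cong) (simp_all add: scalar_prod_def lessThan_atLeast0)
  finally show ?thesis by simp
qed

text \<open>Cayley--Hamilton: apply \<open>(x 1 - B) adj(x 1 - B) = \<chi> 1\<close> to the relations
  \<open>x e\<^sub>i = \<Sum>\<^sub>j B\<^sub>j\<^sub>i e\<^sub>j\<close> of the module on which \<open>x\<close> acts as \<open>B\<close>.\<close>

theorem pact_char_poly: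
  fixes B :: "'a::comm_ring_1 mat"
  assumes B: "B \<in> carrier_mat n n" and v: "v \<in> carrier_vec n"
  shows "pact B (char_poly B) v = 0\<^sub>v n"
proof -
  define M where "M = char_poly_matrix B"
  have M: "M \<in> carrier_mat n n" using B by (simp add: M_def)
  have Mij: "M $$ (j, i) = (if j = i then [:0, 1:] else 0) + [:- (B $$ (j, i)):]" if "i < n" "j < n" for i j
    using that B by (auto simp: M_def char_poly_matrix_def)
  have adj: "adj_mat M \<in> carrier_mat n n" "M * adj_mat M = det M \<cdot>\<^sub>m 1\<^sub>m n"
    using adj_mat[OF M] by auto
  have uv: "unit_vec n j \<in> carrier_vec n" for j by simp
  have rel: "(\<Sum>j<n. pact B (M $$ (j, i)) (unit_vec n j) $ r) = 0" if i: "i < n" and r: "r < n" for i r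
  proof -
    have X: "pact B [:0, 1:] (unit_vec n i) $ r = B $$ (r, i)"
      using B r i by (simp add: pact_pCons[OF B] scalar_prod_right_unit flip: one_pCons)
    have "pact B (M $$ (j, i)) (unit_vec n j) $ r
        = (if j = i then B $$ (r, i) else 0) - (if j = r then B $$ (r, i) else 0)" if j: "j < n" for j
      unfolding Mij[OF i j] using X B r i j
      by (auto simp: pact_add[OF B] pact_pCons[OF B, of _ _ 0] index_mult_mat_vec_sum[OF B])
    then show ?thesis using i r by (simp add: sum_subtractf)
  qed
  have unit: "pact B (char_poly B) (unit_vec n k) $ r = 0" if k: "k < n" and r: "r < n" for k r
  proof -
    let ?a = "\<lambda>i. adj_mat M $$ (i, k)"
    have "(\<Sum>i<n. M $$ (j, i) * ?a i) = (if j = k then char_poly B else 0)" if j: "j < n" for j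
    proof -
      have "(\<Sum>i<n. M $$ (j, i) * ?a i) = (M * adj_mat M) $$ (j, k)"
        using M adj(1) j k by (simp add: scalar_prod_def lessThan_atLeast0)
      then show ?thesis using adj(2) j k by (simp add: char_poly_def M_def)
    qed
    \<comment> \<open>Write the characteristic polynomial times e_k as a sum over j of (row j of M
      times column k of the adjugate) e_j. After exchanging the sums, each entry of the adjugate
      acts on the vector in \<open>rel\<close>, which is zero.\<close>
    then have "pact B (char_poly B) (unit_vec n k) $ r
        = (\<Sum>j<n. pact B (\<Sum>i<n. M $$ (j, i) * ?a i) (unit_vec n j) $ r)"
      using k r B by (simp add: if_distrib[of "\<lambda>p. pact B p _ $ _"] sum.delta cong: if_cong)
    also have "\<dots> = (\<Sum>j<n. \<Sum>i<n. pact B (?a i) (pact B (M $$ (j, i)) (unit_vec n j)) $ r)"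
      by (simp add: index_pact_sum[OF B r] pact_mult[OF B uv, symmetric] mult.commute)
    also have "\<dots> = (\<Sum>i<n. \<Sum>j<n. pact B (?a i) (pact B (M $$ (j, i)) (unit_vec n j)) $ r)"
      by (rule sum.swap)
    also have "\<dots> = (\<Sum>i<n. \<Sum>s<n. pact B (?a i) (unit_vec n s) $ r *
        (\<Sum>j<n. pact B (M $$ (j, i)) (unit_vec n j) $ s))"
      unfolding sum_distrib_left
      by (subst index_pact_unit_vec[OF B pact_carrier[OF B] r], subst (2) sum.swap) simp
    also have "\<dots> = 0" using rel by (intro sum.neutral) auto
    finally show ?thesis .
  qed
  show ?thesis
    by (rule eq_vecI)
      (use B in \<open>auto simp: index_pact_unit_vec[OF B v] unit intro!: sum.neutral\<close>)
qed

lemma pact_dvd_zero: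
  fixes B :: "'a::comm_ring_1 mat"
  assumes B: "B \<in> carrier_mat n n" and v: "v \<in> carrier_vec n" and "char_poly B dvd p"
  shows "pact B p v = 0\<^sub>v n"
proof -
  obtain q where "p = char_poly B * q" using assms(3) by blast
  then show ?thesis using B by (simp add: pact_mult[OF B v] pact_char_poly[OF B])
qed

section \<open>Spectrum, characteristic polynomial and growth of matrix powers\<close>

lemma cpoly_char_poly:
  assumes "B \<in> carrier_mat n n"
  shows "char_poly (cmat B) = cpoly (char_poly B)"
  by (rule of_real_hom.char_poly_hom[OF assms])

lemma char_poly_neq_0:
  fixes B :: "'a::comm_ring_1 mat"
  assumes "B \<in> carrier_mat n n" shows "char_poly B \<noteq> 0"
  using degree_monic_char_poly[OF assms] by auto

lemma spec_iff_root:
  assumes "B \<in> carrier_mat n n"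
  shows "z \<in> spec B \<longleftrightarrow> poly (cpoly (char_poly B)) z = 0"
proof -
  have "cmat B \<in> carrier_mat n n" using assms by simp
  then show ?thesis
    by (simp add: spec_def spectrum_def eigenvalue_root_char_poly cpoly_char_poly[OF assms])
qed

lemma finite_spec: "B \<in> carrier_mat n n \<Longrightarrow> finite (spec B)"
  using card_finite_spectrum[of "cmat B" n] by (simp add: spec_def)

text \<open>By Cayley--Hamilton, B^k v equals the remainder of x^k modulo the characteristic
  polynomial applied to v. This is a combination of finitely many fixed vectors whose coefficients
  are bounded by a multiple of r^k.\<close>

lemma pow_mat_vec_bound:
  fixes B :: "real mat"
  assumes B: "B \<in> carrier_mat n n" and v: "v \<in> carrier_vec n" and r: "0 < r"
    and spec: "\<And>z. z \<in> spec B \<Longrightarrow> cmod z < r"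
  shows "\<exists>C\<ge>0. \<forall>k. \<forall>i<n. \<bar>((B ^\<^sub>m k) *\<^sub>v v) $ i\<bar> \<le> C * r ^ k"
proof -
  define q where "q = char_poly B"
  have q0: "q \<noteq> 0" unfolding q_def by (rule char_poly_neq_0[OF B])
  have "degree q = n" using degree_monic_char_poly[OF B] by (simp add: q_def)
  obtain C where C: "\<And>k j. \<bar>coeff (monom 1 k mod q) j\<bar> \<le> C * r ^ k"
    using power_mod_bound[OF q0 r] spec spec_iff_root[OF B] unfolding q_def by blast
  have C0: "0 \<le> C" using order_trans[OF abs_ge_zero C[of 0 0]] by simp
  define D where "D = (\<Sum>i<n. \<Sum>j\<le>n. \<bar>((B ^\<^sub>m j) *\<^sub>v v) $ i\<bar>)"
  have "\<bar>((B ^\<^sub>m k) *\<^sub>v v) $ i\<bar> \<le> C * D * r ^ k" if i: "i < n" for k i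
  proof -
    have "(B ^\<^sub>m k) *\<^sub>v v = pact B (monom 1 k) v"
      unfolding pact_monom[OF B v] by simp
    also have "monom 1 k = q * (monom 1 k div q) + monom 1 k mod q" by simp
    also have "pact B \<dots> v = pact B (monom 1 k mod q) v"
      unfolding pact_add[OF B] using B v by (simp add: pact_dvd_zero[OF B v] q_def)
    finally have "((B ^\<^sub>m k) *\<^sub>v v) $ i = (\<Sum>j\<le>n. coeff (monom 1 k mod q) j * ((B ^\<^sub>m j) *\<^sub>v v) $ i)"
      using degree_mod_less[OF q0, of "monom 1 k"] \<open>degree q = n\<close>
      by (subst index_pact[OF B i, symmetric]) auto
    also have "\<bar>\<dots>\<bar> \<le> (\<Sum>j\<le>n. C * r ^ k * \<bar>((B ^\<^sub>m j) *\<^sub>v v) $ i\<bar>)"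
      by (intro order_trans[OF sum_abs] sum_mono) (auto simp: abs_mult intro!: mult_right_mono C)
    also have "\<dots> = C * r ^ k * (\<Sum>j\<le>n. \<bar>((B ^\<^sub>m j) *\<^sub>v v) $ i\<bar>)" by (simp add: sum_distrib_left)
    also have "\<dots> \<le> C * r ^ k * D"
      unfolding D_def using C0 r i
      by (intro mult_left_mono member_le_sum[of i _ "\<lambda>i. \<Sum>j\<le>n. \<bar>((B ^\<^sub>m j) *\<^sub>v v) $ i\<bar>"])
        (auto intro!: sum_nonneg)
    finally show ?thesis by (simp add: ac_simps)
  qed
  moreover have "0 \<le> C * D" using C0 by (auto simp: D_def intro!: mult_nonneg_nonneg sum_nonneg)
  ultimately show ?thesis by blast
qed

section \<open>Peripheral spectrum of an irreducible matrix\<close>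

lemma nonneg_mat_index:
  assumes "nonneg_mat A" and "A \<in> carrier_mat n m" and "i < n" and "j < m"
  shows "0 \<le> A $$ (i, j)"
  using assms by (auto simp: nonneg_mat_def elements_mat_def)

text \<open>If no nonzero entry led from I to its complement, a permutation listing I first would
  produce the zero upper right block that reducibility asks for.\<close>

lemma irreducible_connected:
  fixes A :: "real mat"
  assumes A: "A \<in> carrier_mat n n" and irr: "irreducible_mat A"
    and I: "I \<subseteq> {..<n}" "I \<noteq> {}" "I \<noteq> {..<n}"
  shows "\<exists>i\<in>I. \<exists>j\<in>{..<n} - I. A $$ (i, j) \<noteq> 0"
proof (rule ccontr)
  assume "\<not> ?thesis"
  then have z: "A $$ (i, j) = 0" if "i \<in> I" "j \<in> {..<n} - I" for i j using that by auto
  define r where "r = card I"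
  have fI: "finite I" using I(1) finite_subset by auto
  have r0: "0 < r" using I fI by (simp add: r_def card_gt_0_iff)
  have rn: "r < n" using I psubset_card_mono[of "{..<n}" I] by (auto simp: r_def)
  obtain f where f: "bij_betw f {..<r} I"
    using ex_bij_betw_nat_finite[OF fI] by (auto simp: r_def lessThan_atLeast0)
  have "card {r..<n} = card ({..<n} - I)" using I(1) by (simp add: card_Diff_subset fI r_def)
  then obtain g where g: "bij_betw g {r..<n} ({..<n} - I)"
    using finite_same_card_bij[of "{r..<n}" "{..<n} - I"] by auto
  \<comment> \<open>Positions below r enumerate I and the positions from r to n - 1 its complement;
    the identity outside is what \<open>permutes\<close> demands.\<close>
  define p where "p x = (if x < r then f x else if x < n then g x else x)" for x
  have "bij_betw p {..<r} I" using f by (rule bij_betw_cong[THEN iffD1, rotated]) (simp add: p_def)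
  moreover have "bij_betw p {r..<n} ({..<n} - I)"
    using g by (rule bij_betw_cong[THEN iffD1, rotated]) (simp add: p_def)
  ultimately have "bij_betw p ({..<r} \<union> {r..<n}) (I \<union> ({..<n} - I))"
    by (rule bij_betw_combine) auto
  moreover have "{..<r} \<union> {r..<n} = {..<n}" using rn by auto
  ultimately have "bij_betw p {..<n} {..<n}" using I(1) by (simp add: Un_absorb1)
  then have perm: "p permutes {..<n}"
    by (rule bij_imp_permutes) (use rn in \<open>auto simp: p_def\<close>)
  have pI: "p i \<in> I" if "i < r" for i using f that by (auto simp: p_def bij_betw_def)
  have pJ: "p i \<in> {..<n} - I" if "r \<le> i" "i < n" for i using g that by (auto simp: p_def bij_betw_def)
  have pn: "p i < n" if "i < n" for i using permutes_in_image[OF perm, of i] that by simp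
  define P :: "real mat" where "P = mat n n (\<lambda>(i, j). if i = p j then 1 else 0)"
  have P: "P \<in> carrier_mat n n" by (simp add: P_def)
  have PA: "(transpose_mat P * A) $$ (i, l) = A $$ (p i, l)" if "i < n" "l < n" for i l
  proof -
    have "(transpose_mat P * A) $$ (i, l) = (\<Sum>k<n. (if k = p i then 1 else 0) * A $$ (k, l))"
      using that A P by (simp add: scalar_prod_def lessThan_atLeast0 P_def)
    also have "\<dots> = (\<Sum>k<n. if k = p i then A $$ (k, l) else 0)" by (intro sum.cong) auto
    finally show ?thesis using pn[OF that(1)] by simp
  qed
  have PAP: "(transpose_mat P * A * P) $$ (i, j) = A $$ (p i, p j)" if "i < n" "j < n" for i j
  proof -
    have "(Q * P) $$ (i, j) = (\<Sum>k<n. Q $$ (i, k) * P $$ (k, j))" if "Q \<in> carrier_mat n n" for Q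
      using that \<open>i < n\<close> \<open>j < n\<close> P by (simp add: scalar_prod_def lessThan_atLeast0)
    moreover have "transpose_mat P * A \<in> carrier_mat n n"
      using A P by (intro mult_carrier_mat[of _ n n]) auto
    ultimately have "(transpose_mat P * A * P) $$ (i, j) = (\<Sum>k<n. (transpose_mat P * A) $$ (i, k) * P $$ (k, j))"
      by blast
    also have "\<dots> = (\<Sum>k<n. A $$ (p i, k) * (if k = p j then 1 else 0))"
    proof (rule sum.cong)
      fix k assume "k \<in> {..<n}"
      then show "(transpose_mat P * A) $$ (i, k) * P $$ (k, j) = A $$ (p i, k) * (if k = p j then 1 else 0)"
        using that by (subst PA) (auto simp: P_def)
    qed simp
    also have "\<dots> = (\<Sum>k<n. if k = p j then A $$ (p i, k) else 0)" by (intro sum.cong) auto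
    finally show ?thesis using pn[OF that(2)] by simp
  qed
  have "transpose_mat P * A * P = four_block_mat (mat r r (\<lambda>(i, j). A $$ (p i, p j))) (0\<^sub>m r (n - r))
      (mat (n - r) r (\<lambda>(i, j). A $$ (p (i + r), p j))) (mat (n - r) (n - r) (\<lambda>(i, j). A $$ (p (i + r), p (j + r))))"
    (is "_ = ?F")
  proof (rule eq_matI)
    fix i j assume "i < dim_row ?F" "j < dim_col ?F"
    then have ij: "i < n" "j < n" using rn by auto
    show "(transpose_mat P * A * P) $$ (i, j) = ?F $$ (i, j)"
      unfolding PAP[OF ij] using ij rn z[OF pI pJ] by auto
  qed (use P rn in auto)
  moreover have "permutation_matrix (dim_row A) P"
    using perm A by (auto simp: permutation_matrix_def P_def)
  moreover have "0 < n - r" "r + (n - r) = dim_row A" using rn A by auto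
  moreover note r0 mat_carrier[of r r] mat_carrier[of "n - r" r] mat_carrier[of "n - r" "n - r"]
  ultimately have "reducible_mat A" unfolding reducible_mat_def by metis
  then show False using irr by (simp add: irreducible_mat_def)
qed

lemma spec_eigenvector:
  assumes "A \<in> carrier_mat n n"
  shows "z \<in> spec A \<longleftrightarrow> (\<exists>y\<in>carrier_vec n. y \<noteq> 0\<^sub>v n \<and>
    (\<forall>i<n. (\<Sum>j<n. complex_of_real (A $$ (i, j)) * y $ j) = z * y $ i))"
proof -
  have c: "cmat A \<in> carrier_mat n n" using assms by simp
  have "cmat A *\<^sub>v y = z \<cdot>\<^sub>v y \<longleftrightarrow>
      (\<forall>i<n. (\<Sum>j<n. complex_of_real (A $$ (i, j)) * y $ j) = z * y $ i)" if y: "y \<in> carrier_vec n" for y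
  proof -
    have "cmat A *\<^sub>v y = z \<cdot>\<^sub>v y \<longleftrightarrow> (\<forall>i<n. (cmat A *\<^sub>v y) $ i = (z \<cdot>\<^sub>v y) $ i)"
      using assms y by (auto simp: vec_eq_iff simp del: index_mult_mat_vec)
    also have "\<dots> \<longleftrightarrow> (\<forall>i<n. (\<Sum>j<n. complex_of_real (A $$ (i, j)) * y $ j) = z * y $ i)"
      using assms y by (auto simp: index_mult_mat_vec_sum[OF c y] simp del: index_mult_mat_vec)
    finally show ?thesis .
  qed
  then show ?thesis using assms
    by (auto simp: spec_def spectrum_def eigenvalue_def eigenvector_def Bex_def)
qed

lemma spec_le_rho:
  assumes "A \<in> carrier_mat n n" and "z \<in> spec A"
  shows "cmod z \<le> rho A"
proof -
  have c: "cmat A \<in> carrier_mat n n" using assms by simp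
  \<comment> \<open>The empty matrix has to be excluded because its \<open>rho\<close> is
    unspecified; its characteristic polynomial is 1, so it has no eigenvalue.\<close>
  have "n \<noteq> 0"
  proof
    assume "n = 0"
    then have "degree (char_poly A) = 0" using degree_monic_char_poly[OF assms(1)] by simp
    then have "char_poly A = 1" using degree_monic_char_poly[OF assms(1)]
      by (metis degree_0_id lead_coeff_pCons(2) coeff_eq_0 monic_degree_0 \<open>n = 0\<close>)
    then show False using assms by (simp add: spec_iff_root[OF assms(1)])
  qed
  then show ?thesis using spectral_radius_mem_max(2)[OF c] assms(2)
    by (auto simp: rho_def spec_def)
qed

section \<open>Perron--Frobenius theory of irreducible nonnegative matrices\<close>

context
  fixes A :: "real mat" and n :: nat
  assumes A: "A \<in> carrier_mat n n" and nn: "nonneg_mat A" and irr: "irreducible_mat A"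
begin

text \<open>Passing from u to u + A u transforms the slack z = A u - \<rho> u into z + A z. Its
  support contains the old one and, by irreducibility, grows strictly until all coordinates have
  slack; the induction is on the number of coordinates without it.\<close>

lemma slack_everywhere:
  fixes u :: "real vec"
  assumes "u \<in> carrier_vec n" and "\<And>i. i < n \<Longrightarrow> 0 \<le> u $ i"
    and "\<And>i. i < n \<Longrightarrow> \<rho> * u $ i \<le> (A *\<^sub>v u) $ i"
    and "\<exists>i<n. \<rho> * u $ i < (A *\<^sub>v u) $ i"
  shows "\<exists>u\<in>carrier_vec n. (\<forall>i<n. 0 \<le> u $ i) \<and> (\<forall>i<n. \<rho> * u $ i < (A *\<^sub>v u) $ i)"
  using assms
proof (induction "n - card {i\<in>{..<n}. \<rho> * u $ i < (A *\<^sub>v u) $ i}" arbitrary: u rule: less_induct)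
  case less
  define T where "T u = {i\<in>{..<n}. \<rho> * u $ i < (A *\<^sub>v u) $ i}" for u
  have u: "u \<in> carrier_vec n" by (rule less.prems)
  have Au: "A *\<^sub>v u \<in> carrier_vec n" using A u by simp
  show ?case
  proof (cases "T u = {..<n}")
    case True
    then show ?thesis using less.prems by (auto simp: T_def)
  next
    case False
    have "{..<n} - T u \<subseteq> {..<n}" "{..<n} - T u \<noteq> {}" "{..<n} - T u \<noteq> {..<n}"
      using False less.prems(4) by (auto simp: T_def)
    from irreducible_connected[OF A irr this] obtain i j where
      ij: "i \<in> {..<n} - T u" "j \<in> T u" "A $$ (i, j) \<noteq> 0" by auto
    have ijn: "i < n" "j < n" using ij by (auto simp: T_def)
    have Aij: "0 < A $$ (i, j)" using nonneg_mat_index[OF nn A ijn] ij(3) by simp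
    define u' where "u' = u + A *\<^sub>v u"
    have u': "u' \<in> carrier_vec n" using u Au by (simp add: u'_def)
    define z where "z k = (A *\<^sub>v u) $ k - \<rho> * u $ k" for k
    have z0: "0 \<le> z k" if "k < n" for k using less.prems(3) that by (simp add: z_def)
    have slack: "(A *\<^sub>v u') $ k - \<rho> * u' $ k = z k + (\<Sum>l<n. A $$ (k, l) * z l)" if k: "k < n" for k
    proof -
      have "(A *\<^sub>v u') $ k = (A *\<^sub>v u) $ k + (\<Sum>l<n. A $$ (k, l) * (A *\<^sub>v u) $ l)"
        using A u Au k by (simp add: u'_def mult_add_distrib_mat_vec[of A n n] del: index_mult_mat_vec)
          (simp add: index_mult_mat_vec_sum[OF A Au k] del: index_mult_mat_vec)
      moreover have "u' $ k = u $ k + (\<Sum>l<n. A $$ (k, l) * u $ l)"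
        using A u Au k by (simp add: u'_def index_mult_mat_vec_sum[OF A u k] del: index_mult_mat_vec)
      ultimately show ?thesis
        by (simp add: z_def algebra_simps sum_subtractf sum_distrib_left)
    qed
    have Az: "0 \<le> A $$ (k, l) * z l" if "k < n" "l < n" for k l
      using that z0 nonneg_mat_index[OF nn A] by simp
    have sum0: "0 \<le> (\<Sum>l<n. A $$ (k, l) * z l)" if "k < n" for k
      using Az that by (intro sum_nonneg) auto
    have "0 < A $$ (i, j) * z j" using Aij ij(2) by (simp add: T_def z_def)
    also have "\<dots> \<le> (\<Sum>l<n. A $$ (i, l) * z l)" using Az ijn by (intro member_le_sum) auto
    finally have iT: "i \<in> T u'" using slack[OF ijn(1)] z0[OF ijn(1)] ijn by (simp add: T_def)
    have "T u \<subseteq> T u'"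
    proof
      fix k assume k: "k \<in> T u"
      then have "k < n" "0 < z k" by (auto simp: T_def z_def)
      then show "k \<in> T u'" using slack[of k] sum0[of k] by (simp add: T_def)
    qed
    then have "T u \<subset> T u'" using iT ij(1) by auto
    then have "card (T u) < card (T u')" by (intro psubset_card_mono) (auto simp: T_def)
    moreover have "card (T u') \<le> n"
      using card_mono[of "{..<n}" "T u'"] by (auto simp: T_def)
    ultimately have lt: "n - card (T u') < n - card (T u)" by linarith
    show ?thesis
    proof (rule less.hyps[OF lt[unfolded T_def] u'])
      show "0 \<le> u' $ k" if k: "k < n" for k
      proof -
        have "0 \<le> (A *\<^sub>v u) $ k"
          unfolding index_mult_mat_vec_sum[OF A u k]
          using less.prems(2) nonneg_mat_index[OF nn A] k by (intro sum_nonneg) simp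
        then show ?thesis using less.prems(2)[OF k] Au k A by (simp add: u'_def del: index_mult_mat_vec)
      qed
      show "\<rho> * u' $ k \<le> (A *\<^sub>v u') $ k" if k: "k < n" for k
        using slack[OF k] z0[OF k] sum0[OF k] by linarith
      show "\<exists>k<n. \<rho> * u' $ k < (A *\<^sub>v u') $ k" using iT by (auto simp: T_def)
    qed
  qed
qed

lemma pow_mat_mult_vec_ge:
  assumes u: "u \<in> carrier_vec n" and "0 \<le> c" and ge: "\<And>i. i < n \<Longrightarrow> c * u $ i \<le> (A *\<^sub>v u) $ i"
  shows "i < n \<Longrightarrow> c ^ k * u $ i \<le> ((A ^\<^sub>m k) *\<^sub>v u) $ i"
proof (induction k arbitrary: i)
  case (Suc k)
  have w: "(A ^\<^sub>m k) *\<^sub>v u \<in> carrier_vec n" using A u by simp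
  have "c ^ Suc k * u $ i = c ^ k * (c * u $ i)" by simp
  also have "\<dots> \<le> c ^ k * (A *\<^sub>v u) $ i"
    using ge[OF Suc.prems] assms(2) by (intro mult_left_mono) auto
  also have "\<dots> = (\<Sum>j<n. A $$ (i, j) * (c ^ k * u $ j))"
    unfolding index_mult_mat_vec_sum[OF A u Suc.prems] sum_distrib_left by (simp add: ac_simps)
  also have "\<dots> \<le> (\<Sum>j<n. A $$ (i, j) * ((A ^\<^sub>m k) *\<^sub>v u) $ j)"
    using Suc nonneg_mat_index[OF nn A] by (intro sum_mono mult_left_mono) auto
  also have "\<dots> = ((A ^\<^sub>m Suc k) *\<^sub>v u) $ i"
    unfolding pow_mat_mult_vec_Suc[OF A u] index_mult_mat_vec_sum[OF A w Suc.prems] ..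
  finally show ?case .
qed (use A u in simp)

text \<open>A strict inequality in one coordinate can be spread to all of them and then improves
  \<rho> to \<rho> + \<epsilon> for some nonzero w >= 0. Iterating gives A^k w >= (\<rho> +
  \<epsilon>)^k w, which is incompatible with the growth bound at \<rho> + \<epsilon> / 2, a number
  above the moduli of all eigenvalues.\<close>

lemma subinvariant_imp_eigenvector:
  fixes u :: "real vec"
  assumes u: "u \<in> carrier_vec n" and u0: "\<And>i. i < n \<Longrightarrow> 0 \<le> u $ i"
    and ge: "\<And>i. i < n \<Longrightarrow> \<rho> * u $ i \<le> (A *\<^sub>v u) $ i"
    and \<rho>: "0 \<le> \<rho>" "\<And>z. z \<in> spec A \<Longrightarrow> cmod z \<le> \<rho>" and i: "i < n"
  shows "(A *\<^sub>v u) $ i = \<rho> * u $ i"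
proof (rule ccontr)
  assume "(A *\<^sub>v u) $ i \<noteq> \<rho> * u $ i"
  then have "\<exists>i<n. \<rho> * u $ i < (A *\<^sub>v u) $ i" using ge[OF i] i by force
  from slack_everywhere[OF u u0 ge this] obtain w where
    w: "w \<in> carrier_vec n" "\<And>i. i < n \<Longrightarrow> 0 \<le> w $ i" "\<And>i. i < n \<Longrightarrow> \<rho> * w $ i < (A *\<^sub>v w) $ i"
    by auto
  define \<delta> where "\<delta> = Min ((\<lambda>i. (A *\<^sub>v w) $ i - \<rho> * w $ i) ` {..<n})"
  define m where "m = Max ((\<lambda>i. w $ i) ` {..<n}) + 1"
  have ne: "{..<n} \<noteq> {}" using i by auto
  have \<delta>: "0 < \<delta>" unfolding \<delta>_def using ne w(3) by (subst Min_gr_iff) auto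
  have wm: "w $ j < m" if "j < n" for j
  proof -
    have "w $ j \<le> Max ((\<lambda>i. w $ i) ` {..<n})" using that by (intro Max_ge) auto
    then show ?thesis by (simp add: m_def)
  qed
  have m: "0 < m" using w(2)[OF i] wm[OF i] by linarith
  define \<epsilon> where "\<epsilon> = \<delta> / m"
  have \<epsilon>: "0 < \<epsilon>" using \<delta> m by (simp add: \<epsilon>_def)
  have geps: "(\<rho> + \<epsilon>) * w $ j \<le> (A *\<^sub>v w) $ j" if j: "j < n" for j
  proof -
    have "\<epsilon> * w $ j \<le> \<epsilon> * m" using wm[OF j] \<epsilon> by (intro mult_left_mono) auto
    also have "\<dots> = \<delta>" using m by (simp add: \<epsilon>_def)
    also have "\<dots> \<le> (A *\<^sub>v w) $ j - \<rho> * w $ j" unfolding \<delta>_def using j by (intro Min_le) auto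
    finally show ?thesis by (simp add: algebra_simps)
  qed
  have "\<exists>j<n. 0 < w $ j"
  proof (rule ccontr)
    assume "\<not> ?thesis"
    then have "w $ j = 0" if "j < n" for j using w(2)[OF that] that by force
    then have "(A *\<^sub>v w) $ i = 0" "w $ i = 0" using i by (auto simp: index_mult_mat_vec_sum[OF A w(1) i] simp del: index_mult_mat_vec)
    then show False using w(3)[OF i] by simp
  qed
  then obtain j where j: "j < n" "0 < w $ j" by auto
  define r where "r = \<rho> + \<epsilon> / 2"
  have r: "0 < r" "r < \<rho> + \<epsilon>" using \<rho>(1) \<epsilon> by (auto simp: r_def)
  have "cmod z < r" if "z \<in> spec A" for z using \<rho>(2)[OF that] \<epsilon> by (simp add: r_def)
  from pow_mat_vec_bound[OF A w(1) r(1) this] obtain C where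
    C: "\<And>k i. i < n \<Longrightarrow> \<bar>((A ^\<^sub>m k) *\<^sub>v w) $ i\<bar> \<le> C * r ^ k" by auto
  obtain k where k: "C / w $ j < ((\<rho> + \<epsilon>) / r) ^ k"
    using real_arch_pow[of "(\<rho> + \<epsilon>) / r"] r by auto
  have "(\<rho> + \<epsilon>) ^ k * w $ j \<le> C * r ^ k"
    using order_trans[OF pow_mat_mult_vec_ge[OF w(1) _ geps j(1), of k] order_trans[OF abs_ge_self C[OF j(1)]]]
      \<rho> \<epsilon> by simp
  then have "((\<rho> + \<epsilon>) / r) ^ k \<le> C / w $ j" using r j by (simp add: field_simps)
  then show False using k by linarith
qed

text \<open>The triangle inequality makes the vector of moduli of y subinvariant for |z|, and at
  maximal |z| subinvariance is equality. If some but not all entries of y vanished, irreducibility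
  would give a vanishing row sum containing a positive term.\<close>

lemma peripheral_eigenvector:
  fixes y :: "complex vec"
  assumes y: "y \<in> carrier_vec n" "y \<noteq> 0\<^sub>v n"
    and ev: "\<And>i. i < n \<Longrightarrow> (\<Sum>j<n. complex_of_real (A $$ (i, j)) * y $ j) = z * y $ i"
    and z: "\<And>x. x \<in> spec A \<Longrightarrow> cmod x \<le> cmod z"
  shows "i < n \<Longrightarrow> (\<Sum>j<n. A $$ (i, j) * cmod (y $ j)) = cmod z * cmod (y $ i)"
    and "i < n \<Longrightarrow> 0 < cmod (y $ i)"
proof -
  define u where "u = vec n (\<lambda>i. cmod (y $ i))"
  have u: "u \<in> carrier_vec n" by (simp add: u_def)
  have Au: "(A *\<^sub>v u) $ i = (\<Sum>j<n. A $$ (i, j) * cmod (y $ j))" if "i < n" for i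
    unfolding index_mult_mat_vec_sum[OF A u that] by (simp add: u_def)
  have ge: "cmod z * u $ i \<le> (A *\<^sub>v u) $ i" if i: "i < n" for i
  proof -
    have "cmod z * u $ i = cmod (\<Sum>j<n. complex_of_real (A $$ (i, j)) * y $ j)"
      using ev[OF i] i by (simp add: u_def norm_mult)
    also have "\<dots> \<le> (\<Sum>j<n. cmod (complex_of_real (A $$ (i, j)) * y $ j))" by (rule norm_sum)
    also have "\<dots> = (A *\<^sub>v u) $ i"
      unfolding Au[OF i] using nonneg_mat_index[OF nn A] i by (intro sum.cong) (auto simp: norm_mult)
    finally show ?thesis .
  qed
  have eq: "(A *\<^sub>v u) $ i = cmod z * u $ i" if "i < n" for i
    using subinvariant_imp_eigenvector[OF u _ ge _ z that] by (simp add: u_def)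
  show eq': "i < n \<Longrightarrow> (\<Sum>j<n. A $$ (i, j) * cmod (y $ j)) = cmod z * cmod (y $ i)" for i
    using eq[of i] Au[of i] by (simp add: u_def)
  define I where "I = {i\<in>{..<n}. y $ i = 0}"
  have "I = {}"
  proof (rule ccontr)
    assume ne: "I \<noteq> {}"
    have "I \<noteq> {..<n}"
    proof
      assume "I = {..<n}"
      then have "y = 0\<^sub>v n" using y(1) by (intro eq_vecI) (auto simp: I_def)
      then show False using y(2) by simp
    qed
    from irreducible_connected[OF A irr _ ne this] obtain i j where
      ij: "i \<in> I" "j \<in> {..<n} - I" "A $$ (i, j) \<noteq> 0" by (auto simp: I_def)
    then have i: "i < n" "j < n" "y $ i = 0" "y $ j \<noteq> 0" by (auto simp: I_def)
    have "0 < A $$ (i, j) * cmod (y $ j)" using ij(3) nonneg_mat_index[OF nn A i(1,2)] i by simp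
    also have "\<dots> \<le> (\<Sum>j<n. A $$ (i, j) * cmod (y $ j))"
      using i nonneg_mat_index[OF nn A i(1)] by (intro member_le_sum) auto
    finally show False using eq'[OF i(1)] i by simp
  qed
  then show "i < n \<Longrightarrow> 0 < cmod (y $ i)" for i by (auto simp: I_def)
qed

text \<open>Wielandt's argument: let D be the diagonal matrix of the phases d of a peripheral
  eigenvector and \<omega> the phase of w. Equality in the triangle inequality forces A D = \<omega>
  D A, the relation \<open>twist\<close>. Hence D maps eigenvectors for z to eigenvectors for
  \<omega> z.\<close>

lemma rotation_peripheral:
  assumes w: "w \<in> spec A" "\<And>x. x \<in> spec A \<Longrightarrow> cmod x \<le> cmod w" "0 < cmod w" and z: "z \<in> spec A"
  shows "w / cmod w * z \<in> spec A"
proof -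
  obtain y where y: "y \<in> carrier_vec n" "y \<noteq> 0\<^sub>v n"
    "\<And>i. i < n \<Longrightarrow> (\<Sum>j<n. complex_of_real (A $$ (i, j)) * y $ j) = w * y $ i"
    using w(1) unfolding spec_eigenvector[OF A] by auto
  obtain x where x: "x \<in> carrier_vec n" "x \<noteq> 0\<^sub>v n"
    "\<And>i. i < n \<Longrightarrow> (\<Sum>j<n. complex_of_real (A $$ (i, j)) * x $ j) = z * x $ i"
    using z unfolding spec_eigenvector[OF A] by auto
  have per: "(\<Sum>j<n. A $$ (i, j) * cmod (y $ j)) = cmod w * cmod (y $ i)" "0 < cmod (y $ i)"
    if i: "i < n" for i
  proof -
    show "(\<Sum>j<n. A $$ (i, j) * cmod (y $ j)) = cmod w * cmod (y $ i)"
      using y w(2) i by (rule peripheral_eigenvector(1))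
    show "0 < cmod (y $ i)" using y w(2) i by (rule peripheral_eigenvector(2))
  qed
  define \<omega> where "\<omega> = w / cmod w"
  have w\<omega>: "w = cmod w * \<omega>" and n\<omega>: "cmod \<omega> = 1" using w(3) by (auto simp: \<omega>_def norm_divide)
  define d where "d i = y $ i / cmod (y $ i)" for i
  have d: "y $ i = cmod (y $ i) * d i" "cmod (d i) = 1" if "i < n" for i
    using per(2)[OF that] by (auto simp: d_def norm_divide)
  have cnj1: "v * cnj v = 1" if "cmod v = 1" for v using complex_norm_square[of v] that by simp
  have twist: "A $$ (i, j) * d j = A $$ (i, j) * (\<omega> * d i)" if i: "i < n" and j: "j < n" for i j
  proof (cases "A $$ (i, j) = 0")
    case False
    \<comment> \<open>Multiplication by e turns row i of the eigenvalue equation into a positive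
      real number that equals the sum of the moduli of its terms. Every term with
      \<open>A $$ (i, j)\<close> nonzero must then coincide with its modulus.\<close>
    define e where "e = cnj (\<omega> * d i)"
    have e1: "cmod e = 1" using n\<omega> d(2)[OF i] by (simp add: e_def norm_mult)
    have e: "\<omega> * d i * e = 1" unfolding e_def using n\<omega> d(2)[OF i] by (intro cnj1) (simp add: norm_mult)
    have "(\<Sum>j<n. complex_of_real (A $$ (i, j)) * y $ j) * e = w * y $ i * e" using y(3)[OF i] by simp
    also have "\<dots> = of_real (cmod w * cmod (y $ i)) * (\<omega> * d i * e)"
      using d(1)[OF i] w\<omega> by (metis (no_types, lifting) mult.assoc mult.left_commute of_real_mult)
    finally have "(\<Sum>j<n. complex_of_real (A $$ (i, j)) * (y $ j * e)) = of_real (cmod w * cmod (y $ i))"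
      unfolding e by (simp add: sum_distrib_right mult.assoc)
    moreover have "Re (\<Sum>j<n. complex_of_real (A $$ (i, j)) * f j) = (\<Sum>j<n. A $$ (i, j) * Re (f j))" for f
      by simp
    ultimately have "(\<Sum>j<n. A $$ (i, j) * Re (y $ j * e)) = cmod w * cmod (y $ i)"
      by (metis Re_complex_of_real)
    also have "\<dots> = (\<Sum>j<n. A $$ (i, j) * cmod (y $ j))" using per(1)[OF i] by simp
    finally have "(\<Sum>j<n. A $$ (i, j) * (cmod (y $ j) - Re (y $ j * e))) = 0"
      by (simp add: right_diff_distrib sum_subtractf)
    moreover have "0 \<le> A $$ (i, j) * (cmod (y $ j) - Re (y $ j * e))" if "j < n" for j
      using nonneg_mat_index[OF nn A i that] complex_Re_le_cmod[of "y $ j * e"] e1 by (simp add: norm_mult)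
    ultimately have "A $$ (i, j) * (cmod (y $ j) - Re (y $ j * e)) = 0"
      using j by (subst (asm) sum_nonneg_eq_0_iff) auto
    then have re: "Re (y $ j * e) = cmod (y $ j * e)" using False e1 by (simp add: norm_mult)
    have "v = of_real (cmod v)" if "Re v = cmod v" for v
      using cmod_power2[of v] that by (simp add: complex_eq_iff)
    from this[OF re] have "y $ j * e = of_real (cmod (y $ j))"
      using e1 by (simp add: norm_mult)
    then have "d j * e = 1" using per(2)[OF j] by (simp add: d_def)
    then have "d j * e = \<omega> * d i * e" using e by simp
    moreover have "e \<noteq> 0" using e1 by auto
    ultimately have "d j = \<omega> * d i" by (simp only: mult_cancel_right) simp
    then show ?thesis by simp
  qed simp
  define v where "v = vec n (\<lambda>j. d j * x $ j)"
  have "(\<Sum>j<n. complex_of_real (A $$ (i, j)) * v $ j) = \<omega> * z * v $ i" if i: "i < n" for i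
  proof -
    have "(\<Sum>j<n. complex_of_real (A $$ (i, j)) * v $ j) = (\<Sum>j<n. (A $$ (i, j) * d j) * x $ j)"
      by (simp add: v_def mult.assoc)
    also have "\<dots> = (\<Sum>j<n. (A $$ (i, j) * (\<omega> * d i)) * x $ j)"
      using twist[OF i] by (intro sum.cong) auto
    also have "\<dots> = \<omega> * d i * (\<Sum>j<n. complex_of_real (A $$ (i, j)) * x $ j)"
      by (simp add: sum_distrib_left ac_simps)
    finally show ?thesis using x(3)[OF i] i by (simp add: v_def)
  qed
  moreover have "v \<noteq> 0\<^sub>v n"
  proof
    assume v0: "v = 0\<^sub>v n"
    have "x $ i = 0" if i: "i < n" for i
    proof -
      have "d i * x $ i = 0" using v0 i by (metis v_def index_vec index_zero_vec(1))
      moreover have "d i \<noteq> 0" using d(2)[OF i] by auto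
      ultimately show ?thesis by simp
    qed
    then have "x = 0\<^sub>v n" using x(1) by (intro eq_vecI) auto
    then show False using x(2) by simp
  qed
  moreover have "v \<in> carrier_vec n" by (simp add: v_def)
  ultimately show ?thesis unfolding \<omega>_def[symmetric] spec_eigenvector[OF A] by auto
qed

text \<open>With spectral radius 0, A would annihilate the entrywise positive vector of moduli and
  hence be the zero matrix. That is reducible for n > 1 and ruled out for n = 1 by the convention on
  the single entry.\<close>

lemma peripheral_pos:
  assumes w: "w \<in> spec A" "\<And>x. x \<in> spec A \<Longrightarrow> cmod x \<le> cmod w"
  shows "0 < cmod w"
proof (rule ccontr)
  assume "\<not> 0 < cmod w"
  then have w0: "cmod w = 0" by simp
  obtain y where y: "y \<in> carrier_vec n" "y \<noteq> 0\<^sub>v n"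
    "\<And>i. i < n \<Longrightarrow> (\<Sum>j<n. complex_of_real (A $$ (i, j)) * y $ j) = w * y $ i"
    using w(1) unfolding spec_eigenvector[OF A] by auto
  have per: "(\<Sum>j<n. A $$ (i, j) * cmod (y $ j)) = cmod w * cmod (y $ i)" "0 < cmod (y $ i)"
    if i: "i < n" for i
  proof -
    show "(\<Sum>j<n. A $$ (i, j) * cmod (y $ j)) = cmod w * cmod (y $ i)"
      using y w(2) i by (rule peripheral_eigenvector(1))
    show "0 < cmod (y $ i)" using y w(2) i by (rule peripheral_eigenvector(2))
  qed
  have A0: "A $$ (i, j) = 0" if ij: "i < n" "j < n" for i j
  proof -
    have "(\<Sum>j<n. A $$ (i, j) * cmod (y $ j)) = 0" using per(1)[OF ij(1)] w0 by simp
    then have "A $$ (i, j) * cmod (y $ j) = 0"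
      using ij nonneg_mat_index[OF nn A] by (subst (asm) sum_nonneg_eq_0_iff) auto
    then show ?thesis using per(2)[OF ij(2)] by simp
  qed
  have n0: "0 < n" using y by (metis carrier_vecD eq_vecI gr0I index_zero_vec(2) less_nat_zero_code)
  show False
  proof (cases "n = 1")
    case True
    then show False using irr A A0[of 0 0] by (simp add: irreducible_mat_def)
  next
    case False
    have "{0} \<noteq> {..<n}" using False n0 by (metis card_lessThan card_1_singleton_iff One_nat_def is_singletonI is_singleton_altdef)
    from irreducible_connected[OF A irr _ _ this] show False using n0 A0 by auto
  qed
qed

end

section \<open>Roots of recursion polynomials\<close>

lemma cis_eq_1_iff: "cis x = 1 \<longleftrightarrow> (\<exists>k::int. x = of_int k * 2 * pi)"
proof
  assume "cis x = 1"
  then have "cos x = 1" by (metis cis.sel(1) one_complex.sel(1))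
  then show "\<exists>k::int. x = of_int k * 2 * pi" by (simp add: cos_one_2pi_int)
next
  assume "\<exists>k::int. x = of_int k * 2 * pi"
  then obtain k :: int where k: "x = of_int k * 2 * pi" by blast
  then have "cos x = 1" using cos_one_2pi_int by blast
  moreover have "sin x = 0" using \<open>cos x = 1\<close> sin_cos_squared_add[of x] by simp
  ultimately show "cis x = 1" by (simp add: complex_eq_iff)
qed

lemma sgn_power_eq_1_iff_Arg:
  assumes "z \<noteq> 0" and "0 < d"
  shows "sgn z ^ d = 1 \<longleftrightarrow> (\<exists>k::int. Arg z = of_int k * (2 * pi / real d))"
proof -
  have "sgn z ^ d = cis (real d * Arg z)"
    using assms by (simp add: cis_Arg[symmetric] DeMoivre)
  then show ?thesis using assms(2) by (simp add: cis_eq_1_iff field_simps)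
qed

lemma pos_real_power_iff_sgn:
  fixes z :: complex
  assumes "z \<noteq> 0"
  shows "z ^ d \<in> \<real> \<and> 0 < Re (z ^ d) \<longleftrightarrow> sgn z ^ d = 1"
proof
  assume "z ^ d \<in> \<real> \<and> 0 < Re (z ^ d)"
  then obtain t where t: "z ^ d = of_real t" "0 < t" by (auto elim: Reals_cases)
  then have "cmod z ^ d = t" by (metis norm_power norm_of_real abs_of_pos)
  then show "sgn z ^ d = 1" using t assms by (simp add: complex_sgn_def scaleR_conv_of_real field_simps flip: of_real_power)
next
  assume "sgn z ^ d = 1"
  then have "z ^ d = of_real (cmod z ^ d)"
    using assms by (simp add: complex_sgn_def scaleR_conv_of_real field_simps)
  then show "z ^ d \<in> \<real> \<and> 0 < Re (z ^ d)" using assms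
    by (metis Re_complex_of_real Reals_of_real zero_less_norm_iff zero_less_power)
qed

lemma power_gcd_eq_1:
  fixes x :: "'a::idom"
  assumes "x ^ a = 1" and "x ^ b = 1"
  shows "x ^ gcd a b = 1"
proof (cases "a = 0")
  case False
  obtain u v where "a * u = b * v + gcd a b" using bezout_nat[OF False] by blast
  then have "x ^ (a * u) = x ^ (b * v) * x ^ gcd a b" by (simp add: power_add)
  then show ?thesis using assms by (simp add: power_mult)
qed (use assms in simp)

lemma cis_root_power_eq_1_iff:
  assumes "0 < h" shows "cis (2 * pi / real h) ^ g = 1 \<longleftrightarrow> h dvd g"
proof -
  have "cis (2 * pi / real h) ^ g = 1 \<longleftrightarrow> (\<exists>k::int. real g = of_int k * real h)"
    using assms by (simp add: DeMoivre cis_eq_1_iff field_simps)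
  also have "\<dots> \<longleftrightarrow> (\<exists>k::int. int g = k * int h)"
  proof -
    have "real g = of_int k * real h \<longleftrightarrow> int g = k * int h" for k
      using of_int_eq_iff[of "int g" "k * int h", where 'a = real] by simp
    then show ?thesis by simp
  qed
  also have "\<dots> \<longleftrightarrow> int h dvd int g" by (auto simp: dvd_def mult.commute)
  finally show ?thesis by simp
qed

text \<open>Turns the explicit exponentials in the degree of cyclicity and in
  \<open>min_period\<close> into the equation z^m = r^m, in which exponents can be handled by
  divisibility.\<close>

lemma scaled_roots_of_unity:
  assumes "0 < m" and "r \<noteq> 0"
  shows "{complex_of_real r * exp (2 * of_nat k * of_real pi * \<i> / of_nat m) | k. k < m} = {z. z ^ m = of_real r ^ m}"
proof -
  have e: "exp (2 * of_nat k * of_real pi * \<i> / of_nat m) = cis (2 * pi * real k / real m)" for k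
    by (simp add: cis_conv_exp ac_simps)
  have "z \<in> (\<lambda>k. of_real r * cis (2 * pi * real k / real m)) ` {..<m} \<longleftrightarrow> z ^ m = of_real r ^ m" for z
  proof -
    have "z ^ m = of_real r ^ m \<longleftrightarrow> z / of_real r \<in> {w. w ^ m = 1}"
      using assms by (auto simp: power_divide)
    also have "{w. w ^ m = 1} = (\<lambda>k. cis (2 * pi * real k / real m)) ` {..<m}"
      using bij_betw_roots_unity[OF assms(1)] by (simp add: bij_betw_def)
    also have "z / of_real r \<in> \<dots> \<longleftrightarrow> z \<in> (\<lambda>k. of_real r * cis (2 * pi * real k / real m)) ` {..<m}"
      using assms(2) by (auto simp: image_iff field_simps)
    finally show ?thesis by blast
  qed
  then show ?thesis unfolding e by auto
qed

lemma order_prod_linear_factors: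
  fixes z :: "'a::idom"
  shows "order z (\<Prod>x\<leftarrow>xs. [:- x, 1:]) = count_list xs z"
proof (induction xs)
  case (Cons a xs)
  have ne: "[:- a, 1:] * (\<Prod>x\<leftarrow>xs. [:- x, 1:]) \<noteq> 0" by (auto simp del: mult_pCons_left)
  have "order z [:- a, 1:] = (if z = a then 1 else 0)"
    using order_power_n_n[of a 1] by (auto intro: order_0I)
  then show ?case using Cons order_mult[OF ne, of z] by (simp del: mult_pCons_left)
qed (auto intro: order_0I)

section \<open>Position and multiplicity of the roots of a recursion polynomial\<close>

context
  fixes F :: "real poly" and r :: real
  assumes F: "recursion_poly F" and r: "0 < r" and root: "poly F r = 0"
begin

private abbreviation (input) "N \<equiv> degree F"
private abbreviation (input) "J \<equiv> {i. i < degree F \<and> coeff F i \<noteq> 0}"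

text \<open>Dividing by the leading power expresses the root condition as an identity 1 = weighted
  sum. Only the support J is kept, so that all weights \<open>- coeff F i\<close> are strictly
  positive, as the strict comparisons and equality cases require.\<close>

lemma recursion_poly_eval:
  fixes z :: complex
  assumes "z \<noteq> 0"
  shows "poly (cpoly F) z = z ^ N * (1 + (\<Sum>i\<in>J. coeff F i * (1 / z) ^ (N - i)))"
proof -
  have "poly (cpoly F) z = z ^ N + (\<Sum>i<N. coeff F i * z ^ i)"
    using F unfolding poly_altdef recursion_poly_def
    by (simp add: lessThan_Suc_atMost[symmetric])
  also have "(\<Sum>i<N. coeff F i * z ^ i) = (\<Sum>i\<in>J. coeff F i * z ^ i)"
    by (intro sum.mono_neutral_right) auto
  also have "\<dots> = (\<Sum>i\<in>J. z ^ N * (coeff F i * (1 / z) ^ (N - i)))"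
  proof (rule sum.cong)
    fix i assume "i \<in> J"
    then have "z ^ N = z ^ i * z ^ (N - i)" by (simp flip: power_add)
    then show "coeff F i * z ^ i = z ^ N * (coeff F i * (1 / z) ^ (N - i))"
      using assms by (simp add: power_divide)
  qed simp
  finally show ?thesis by (simp add: sum_distrib_left distrib_left)
qed

text \<open>The weights of a convex combination: a complex root of modulus r exhibits 1 as the
  average, with these weights, of powers of a number on the unit circle.\<close>

lemma recursion_poly_sum_root: "(\<Sum>i\<in>J. - coeff F i * (1 / r) ^ (N - i)) = 1"
proof -
  have "poly (cpoly F) (of_real r) = 0" using root by simp
  then have "1 + (\<Sum>i\<in>J. complex_of_real (coeff F i) * (1 / of_real r) ^ (N - i)) = 0"
    using recursion_poly_eval[of "of_real r"] r by simp
  then have "complex_of_real (1 + (\<Sum>i\<in>J. coeff F i * (1 / r) ^ (N - i))) = 0" by simp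
  then have "1 + (\<Sum>i\<in>J. coeff F i * (1 / r) ^ (N - i)) = 0" by (simp only: of_real_eq_0_iff)
  then show ?thesis by (simp add: sum_negf)
qed

lemma recursion_poly_support_nonempty: "J \<noteq> {}"
  using recursion_poly_sum_root by fastforce

lemma recursion_poly_coeff_neg: "i \<in> J \<Longrightarrow> coeff F i < 0"
  using F by (fastforce simp: recursion_poly_def)

lemma recursion_poly_sum_strict:
  assumes "0 < s" and "s < t"
  shows "(\<Sum>i\<in>J. - coeff F i * (1 / t) ^ (N - i)) < (\<Sum>i\<in>J. - coeff F i * (1 / s) ^ (N - i))"
proof (rule sum_strict_mono)
  fix i assume i: "i \<in> J"
  have "(1 / t) ^ (N - i) < (1 / s) ^ (N - i)"
    using assms i by (intro power_strict_mono) (auto simp: frac_less2)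
  then show "- coeff F i * (1 / t) ^ (N - i) < - coeff F i * (1 / s) ^ (N - i)"
    using recursion_poly_coeff_neg[OF i] by simp
qed (use recursion_poly_support_nonempty in auto)

context
  fixes z :: complex
  assumes z: "z \<noteq> 0" and rootz: "poly (cpoly F) z = 0"
begin

lemma recursion_poly_sum_complex_root:
  "(\<Sum>i\<in>J. - coeff F i * (1 / z) ^ (N - i)) = 1"
proof -
  have "1 + (\<Sum>i\<in>J. complex_of_real (coeff F i) * (1 / z) ^ (N - i)) = 0"
    using recursion_poly_eval[OF z] z rootz by simp
  then have "(\<Sum>i\<in>J. complex_of_real (coeff F i) * (1 / z) ^ (N - i)) = - 1"
    by (metis add.commute add_eq_0_iff)
  then show ?thesis by (simp add: sum_negf)
qed

text \<open>Outside the circle of radius r the moduli of the weighted terms add up to less than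
  1.\<close>

lemma recursion_poly_root_le: "cmod z \<le> r"
proof (rule ccontr)
  assume "\<not> cmod z \<le> r"
  then have "(\<Sum>i\<in>J. - coeff F i * (1 / cmod z) ^ (N - i)) < 1"
    using recursion_poly_sum_strict[of r "cmod z"] recursion_poly_sum_root r by simp
  moreover have "cmod (\<Sum>i\<in>J. - coeff F i * (1 / z) ^ (N - i))
      \<le> (\<Sum>i\<in>J. cmod (- coeff F i * (1 / z) ^ (N - i)))" by (rule norm_sum)
  moreover have "(\<Sum>i\<in>J. cmod (- coeff F i * (1 / z) ^ (N - i)))
      = (\<Sum>i\<in>J. - coeff F i * (1 / cmod z) ^ (N - i))"
  proof (rule sum.cong)
    fix i assume "i \<in> J"
    from recursion_poly_coeff_neg[OF this]
    show "cmod (- coeff F i * (1 / z) ^ (N - i)) = - coeff F i * (1 / cmod z) ^ (N - i)"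
      by (simp add: norm_mult norm_power norm_divide)
  qed simp
  ultimately show False using recursion_poly_sum_complex_root by simp
qed

text \<open>The number 1 is an extreme point of the unit disc, so a convex combination of unimodular
  numbers equals 1 only if each of them does.\<close>

lemma recursion_poly_peripheral_root:
  assumes "cmod z = r" and i: "i \<in> J"
  shows "sgn z ^ (N - i) = 1"
proof -
  define u where "u = 1 / sgn z"
  have nu: "cmod u = 1" using z by (simp add: u_def norm_divide norm_sgn)
  have zu: "1 / z = of_real (1 / r) * u"
    using z assms(1) r by (simp add: u_def complex_sgn_def scaleR_conv_of_real field_simps)
  have "(\<Sum>i\<in>J. complex_of_real (- coeff F i * (1 / r) ^ (N - i)) * u ^ (N - i)) = 1"
  proof -
    have "(1 / z) ^ k = of_real ((1 / r) ^ k) * u ^ k" for k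
      by (simp only: zu power_mult_distrib of_real_power)
    then show ?thesis using recursion_poly_sum_complex_root by (simp add: mult.assoc)
  qed
  then have "Re (\<Sum>i\<in>J. complex_of_real (- coeff F i * (1 / r) ^ (N - i)) * u ^ (N - i)) = 1"
    by (simp only: one_complex.sel)
  moreover have "Re (\<Sum>i\<in>J. complex_of_real (g i) * u ^ (N - i)) = (\<Sum>i\<in>J. g i * Re (u ^ (N - i)))" for g
    by simp
  ultimately have "(\<Sum>i\<in>J. (- coeff F i * (1 / r) ^ (N - i)) * Re (u ^ (N - i))) = 1"
    by (simp only:)
  then have "(\<Sum>i\<in>J. (- coeff F i * (1 / r) ^ (N - i)) * (1 - Re (u ^ (N - i)))) = 0"
    using recursion_poly_sum_root by (simp add: right_diff_distrib sum_subtractf sum_negf)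
  moreover have Rle: "Re (u ^ k) \<le> 1" for k
    using complex_Re_le_cmod[of "u ^ k"] nu by (simp add: norm_power)
  moreover have "0 \<le> (- coeff F i * (1 / r) ^ (N - i)) * (1 - Re (u ^ (N - i)))" if "i \<in> J" for i
    using recursion_poly_coeff_neg[OF that] r Rle[of "N - i"] by (intro mult_nonneg_nonneg) auto
  ultimately have "\<forall>i\<in>J. (- coeff F i * (1 / r) ^ (N - i)) * (1 - Re (u ^ (N - i))) = 0"
    by (subst (asm) sum_nonneg_eq_0_iff) simp_all
  then have "(- coeff F i * (1 / r) ^ (N - i)) * (1 - Re (u ^ (N - i))) = 0" using i by blast
  then have "Re (u ^ (N - i)) = 1" using recursion_poly_coeff_neg[OF i] r by auto
  moreover have "v = 1" if "Re v = 1" "cmod v = 1" for v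
    using cmod_power2[of v] that by (simp add: complex_eq_iff)
  ultimately have "u ^ (N - i) = 1" using nu by (simp add: norm_power)
  then show ?thesis by (simp add: u_def power_divide)
qed

text \<open>If the phase of z disappears in every exponent that occurs, the root condition for z is
  that for |z|, and r is the only positive root. This is the mechanism behind (c4).\<close>

lemma recursion_poly_root_aligned:
  assumes "\<And>i. i \<in> J \<Longrightarrow> sgn z ^ (N - i) = 1"
  shows "cmod z = r"
proof -
  have "(1 / z) ^ (N - i) = of_real ((1 / cmod z) ^ (N - i))" if "i \<in> J" for i
  proof -
    have "z ^ (N - i) = of_real (cmod z) ^ (N - i)"
      using assms[OF that] z by (simp add: complex_sgn_def scaleR_conv_of_real field_simps)
    then show ?thesis by (simp add: power_divide)
  qed
  then have "(\<Sum>i\<in>J. - complex_of_real (coeff F i) * of_real ((1 / cmod z) ^ (N - i)))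
      = (\<Sum>i\<in>J. - coeff F i * (1 / z) ^ (N - i))"
    by (intro sum.cong) simp_all
  then have "(\<Sum>i\<in>J. - complex_of_real (coeff F i) * of_real ((1 / cmod z) ^ (N - i))) = 1"
    using recursion_poly_sum_complex_root by (rule trans)
  then have "complex_of_real (\<Sum>i\<in>J. - coeff F i * (1 / cmod z) ^ (N - i)) = of_real 1" by simp
  then have "(\<Sum>i\<in>J. - coeff F i * (1 / cmod z) ^ (N - i)) = 1" by (simp only: of_real_eq_iff)
  then show ?thesis
    using recursion_poly_sum_strict[of r "cmod z"] recursion_poly_sum_strict[of "cmod z" r]
      recursion_poly_sum_root r z by (cases "cmod z" r rule: linorder_cases) auto
qed

text \<open>At a root, z F'(z) = z F'(z) - N F(z), which is the sum of (i - N) times the i-th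
  coefficient times z^i. On the circle of radius r all these terms have the phase of z^N, and the
  factors i - N and the coefficients are both negative, so nothing cancels and F'(z) is
  nonzero.\<close>

lemma recursion_poly_peripheral_simple:
  assumes "cmod z = r"
  shows "order z (cpoly F) = 1"
proof -
  define p where "p = cpoly F"
  have p0: "p \<noteq> 0" using F by (auto simp: p_def recursion_poly_def)
  have degp: "degree p = N" by (simp add: p_def)
  have N0: "0 < N" using recursion_poly_support_nonempty by auto
  have "z * poly (pderiv p) z = (\<Sum>k\<le>N - 1. z * (of_nat (Suc k) * coeff p (Suc k) * z ^ k))"
    unfolding poly_altdef degree_pderiv degp coeff_pderiv sum_distrib_left ..
  also have "\<dots> = (\<Sum>k\<le>N - 1. of_nat (Suc k) * coeff p (Suc k) * z ^ Suc k)"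
    by (simp add: ac_simps)
  also have "\<dots> = (\<Sum>i\<le>N. of_nat i * coeff p i * z ^ i)"
    using N0 sum.atMost_Suc_shift[of "\<lambda>i. of_nat i * coeff p i * z ^ i" "N - 1"] by simp
  finally have "z * poly (pderiv p) z = (\<Sum>i\<le>N. of_nat i * coeff p i * z ^ i)" .
  moreover have "of_nat N * poly p z = (\<Sum>i\<le>N. of_nat N * (coeff p i * z ^ i))"
    unfolding poly_altdef degp sum_distrib_left ..
  ultimately have "z * poly (pderiv p) z = (\<Sum>i\<le>N. (of_nat i - of_nat N) * (coeff p i * z ^ i))"
    using rootz unfolding p_def[symmetric] by (simp add: left_diff_distrib sum_subtractf mult.assoc)
  also have "\<dots> = (\<Sum>i\<in>J. (of_nat i - of_nat N) * (coeff p i * z ^ i))"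
    by (intro sum.mono_neutral_right) (auto simp: p_def)
  also have "\<dots> = (\<Sum>i\<in>J. z ^ N * of_real ((real N - real i) * (- coeff F i) * (1 / r) ^ (N - i)))"
  proof (rule sum.cong)
    fix i assume i: "i \<in> J"
    have "z ^ (N - i) = of_real r ^ (N - i)"
      using recursion_poly_peripheral_root[OF assms i] z assms r
      by (simp add: complex_sgn_def scaleR_conv_of_real field_simps)
    moreover have "z ^ N = z ^ i * z ^ (N - i)" using i by (simp flip: power_add)
    ultimately have "z ^ i = z ^ N * of_real ((1 / r) ^ (N - i))" using r by (simp add: power_divide)
    then show "(of_nat i - of_nat N) * (coeff p i * z ^ i)
        = z ^ N * of_real ((real N - real i) * (- coeff F i) * (1 / r) ^ (N - i))"
      by (simp add: p_def algebra_simps)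
  qed simp
  also have "\<dots> = z ^ N * of_real (\<Sum>i\<in>J. (real N - real i) * (- coeff F i) * (1 / r) ^ (N - i))"
    by (simp add: sum_distrib_left)
  finally have eq: "z * poly (pderiv p) z
      = z ^ N * of_real (\<Sum>i\<in>J. (real N - real i) * (- coeff F i) * (1 / r) ^ (N - i))" .
  have "0 < (\<Sum>i\<in>J. (real N - real i) * (- coeff F i) * (1 / r) ^ (N - i))"
  proof (rule sum_pos)
    fix i assume i: "i \<in> J"
    then have "0 < real N - real i" by simp
    then show "0 < (real N - real i) * (- coeff F i) * (1 / r) ^ (N - i)"
      using recursion_poly_coeff_neg[OF i] r by (intro mult_pos_pos) auto
  qed (use recursion_poly_support_nonempty in auto)
  then have "z ^ N * complex_of_real (\<Sum>i\<in>J. (real N - real i) * (- coeff F i) * (1 / r) ^ (N - i)) \<noteq> 0"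
    using z by (simp only: mult_eq_0_iff of_real_eq_0_iff power_eq_0_iff) auto
  then have "poly (pderiv p) z \<noteq> 0" using eq by auto
  then have "order z (pderiv p) = 0" by (rule order_0I)
  moreover have "pderiv p \<noteq> 0" using \<open>poly (pderiv p) z \<noteq> 0\<close> by auto
  moreover have "order z p \<noteq> 0" using rootz p0 by (simp add: order_root p_def)
  ultimately show ?thesis using order_pderiv[of p z] p0 rootz by (simp add: p_def)
qed

end

end

section \<open>The decomposed controllable system\<close>

lemma index_finsum_mat:
  fixes f :: "'b \<Rightarrow> 'a::comm_ring_1 mat"
  assumes "finite I" and "\<And>x. x \<in> I \<Longrightarrow> f x \<in> carrier_mat n m"
  shows "finsum (module_mat TYPE('a) n m) f I \<in> carrier_mat n m \<and>
    (\<forall>i<n. \<forall>j<m. finsum (module_mat TYPE('a) n m) f I $$ (i, j) = (\<Sum>x\<in>I. f x $$ (i, j)))"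
proof -
  interpret abelian_group "module_mat TYPE('a) n m" by (rule abelian_group_mat)
  show ?thesis using assms
  proof (induction I rule: finite_induct)
    case (insert x I)
    have "f \<in> I \<rightarrow> carrier (module_mat TYPE('a) n m)" "f x \<in> carrier (module_mat TYPE('a) n m)"
      using insert.prems by (auto simp: module_mat_simps)
    from finsum_insert[OF insert.hyps this] show ?case
      using insert by (auto simp: module_mat_simps)
  qed (simp add: module_mat_simps)
qed

lemma mult_mat_zero_vec [simp]:
  "M \<in> carrier_mat n m \<Longrightarrow> M *\<^sub>v 0\<^sub>v m = (0\<^sub>v n :: 'a::comm_ring_1 vec)"
  by (intro eq_vecI) auto

locale controllable_system =
  fixes A S S' A1 A2 :: "real mat" and b :: "real vec" and n h :: nat
  assumes A: "A \<in> carrier_mat n n" and nn: "nonneg_mat A"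
    and irr: "irreducible_mat A" and cyc: "degree_of_cyclicity A h"
    and b: "b \<in> carrier_vec n" and b_nn: "\<forall>i < n. 0 \<le> b $ i"
    and rank: "vec_space.rank n (conmat n A b) = n"
    and S: "S \<in> carrier_mat n n" and S': "S' \<in> carrier_mat n n"
    and SS': "inverts_mat S S'" and S'S: "inverts_mat S' S"
    and A1: "A1 \<in> carrier_mat h h" and A2: "A2 \<in> carrier_mat (n - h) (n - h)"
    and decomp: "S' * A * S = four_block_mat A1 (0\<^sub>m h (n - h)) (0\<^sub>m (n - h) h) A2"
    and spec_A1: "spec A1 = sigma_rho A" and spec_A2: "spec A2 = sigma_minus A"
begin

lemma h_pos: "0 < h" and h_le: "h \<le> n"
  using cyc A by (auto simp: degree_of_cyclicity_def)

lemma rho_in_sigma_rho: "complex_of_real (rho A) \<in> sigma_rho A"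
proof -
  have "complex_of_real (rho A) * exp (2 * of_real pi * \<i> * of_nat 0 / of_nat h) \<in> sigma_rho A"
    using cyc h_pos unfolding degree_of_cyclicity_def by blast
  then show ?thesis by simp
qed

lemma rho_pos: "0 < rho A"
proof -
  have r: "complex_of_real (rho A) \<in> spec A" "cmod (of_real (rho A)) = rho A"
    using rho_in_sigma_rho by (auto simp: sigma_rho_def)
  then show ?thesis
    using peripheral_pos[OF A nn irr r(1)] spec_le_rho[OF A] by simp
qed

lemma sigma_rho_eq: "sigma_rho A = {z. z ^ h = of_real (rho A) ^ h}"
proof -
  have "sigma_rho A = {complex_of_real (rho A) * exp (2 * of_real pi * \<i> * of_nat k / of_nat h) | k. k < h}"
    using cyc by (simp add: degree_of_cyclicity_def)
  also have "\<dots> = {complex_of_real (rho A) * exp (2 * of_nat k * of_real pi * \<i> / of_nat h) | k. k < h}"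
    by (simp add: ac_simps)
  also have "\<dots> = {z. z ^ h = of_real (rho A) ^ h}"
    using h_pos rho_pos by (intro scaled_roots_of_unity) auto
  finally show ?thesis .
qed

lemma spec_rotate:
  assumes "z \<in> spec A" shows "cis (2 * pi / real h) * z \<in> spec A"
proof -
  define w where "w = complex_of_real (rho A) * cis (2 * pi / real h)"
  have "cis (2 * pi / real h) ^ h = 1" using h_pos by (simp add: cis_root_power_eq_1_iff)
  then have "w \<in> sigma_rho A" by (simp add: w_def sigma_rho_eq power_mult_distrib)
  then have w: "w \<in> spec A" by (simp add: sigma_rho_def)
  have nw: "cmod w = rho A" using rho_pos by (simp add: w_def norm_mult)
  have "w / cmod w * z \<in> spec A"
    using w nw rho_pos spec_le_rho[OF A] assms by (intro rotation_peripheral[OF A nn irr]) auto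
  then show ?thesis using rho_pos unfolding nw by (simp add: w_def)
qed

lemma spec_A2_rotate:
  assumes "z \<in> spec A2" shows "cis (2 * pi / real h) ^ k * z \<in> spec A2"
proof (induction k)
  case (Suc k)
  then show ?case using spec_rotate[of "cis (2 * pi / real h) ^ k * z"] unfolding spec_A2 sigma_minus_def
    by (simp add: norm_mult norm_power mult.assoc)
qed (use assms in simp)

text \<open>The hypothesis on \<open>spec A1\<close> fixes only a set, but that set has h elements.
  Two monic polynomials of degree h with these h common roots have a difference of degree below h
  and are therefore equal.\<close>

lemma char_poly_A1: "char_poly A1 = monom 1 h - [:rho A ^ h:]"
proof (rule ccontr)
  assume ne: "char_poly A1 \<noteq> monom 1 h - [:rho A ^ h:]"
  define p where "p = char_poly A1 - (monom 1 h - [:rho A ^ h:])"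
  have p0: "p \<noteq> 0" using ne by (simp add: p_def)
  have d: "degree (char_poly A1) = h" "coeff (char_poly A1) h = 1"
    using degree_monic_char_poly[OF A1] by auto
  have "coeff p k = 0" if "h \<le> k" for k
    using that d h_pos by (cases "k = h") (auto simp: p_def coeff_pCons coeff_eq_0 split: nat.split)
  then have "degree p < h" using p0 by (metis leading_coeff_0_iff not_less)
  have "{z. z ^ h = of_real (rho A) ^ h} \<subseteq> {z. poly (cpoly p) z = 0}"
  proof
    fix z :: complex assume z: "z \<in> {z. z ^ h = of_real (rho A) ^ h}"
    then have "poly (cpoly (char_poly A1)) z = 0"
      using spec_iff_root[OF A1, of z] spec_A1 sigma_rho_eq by simp
    moreover have "poly (cpoly (monom 1 h - [:rho A ^ h:])) z = 0"
      using z by (simp add: of_real_poly_hom.hom_minus poly_monom of_real_hom.map_poly_pCons_hom)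
    ultimately show "z \<in> {z. poly (cpoly p) z = 0}" by (simp add: p_def of_real_poly_hom.hom_minus)
  qed
  then have "card {z::complex. z ^ h = of_real (rho A) ^ h} \<le> card {z. poly (cpoly p) z = 0}"
    using p0 by (intro card_mono poly_roots_finite) auto
  also have "\<dots> \<le> degree (cpoly p)" using p0 by (intro poly_roots_degree) simp
  finally show False using \<open>degree p < h\<close> card_nth_roots[of "of_real (rho A) ^ h" h] h_pos rho_pos by simp
qed

section \<open>Components of b and annihilating polynomials\<close>

definition b1 :: "real vec" where "b1 = vec_first (S' *\<^sub>v b) h"
definition b2 :: "real vec" where "b2 = vec_last (S' *\<^sub>v b) (n - h)"

lemma b1_carrier [simp]: "b1 \<in> carrier_vec h" and b2_carrier [simp]: "b2 \<in> carrier_vec (n - h)"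
  by (simp_all add: b1_def b2_def)

lemma append_carrier [simp]: "x \<in> carrier_vec h \<Longrightarrow> y \<in> carrier_vec (n - h) \<Longrightarrow> x @\<^sub>v y \<in> carrier_vec n"
  using append_carrier_vec[of x h y "n - h"] h_le by simp

lemma SS'_one: "S * S' = 1\<^sub>m n" and S'S_one: "S' * S = 1\<^sub>m n"
  using SS' S'S S S' by (auto simp: inverts_mat_def)

lemma b_split: "b = S *\<^sub>v (b1 @\<^sub>v b2)"
proof -
  have "S' *\<^sub>v b \<in> carrier_vec (h + (n - h))" using S' b h_le by simp
  then have "b1 @\<^sub>v b2 = S' *\<^sub>v b" by (simp add: b1_def b2_def)
  then have "S *\<^sub>v (b1 @\<^sub>v b2) = (S * S') *\<^sub>v b" using S S' b by (simp add: assoc_mult_mat_vec[of _ n n _ n])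
  then show ?thesis using b by (simp add: SS'_one)
qed

lemma A_S_append:
  assumes x: "x \<in> carrier_vec h" and y: "y \<in> carrier_vec (n - h)"
  shows "A *\<^sub>v (S *\<^sub>v (x @\<^sub>v y)) = S *\<^sub>v ((A1 *\<^sub>v x) @\<^sub>v (A2 *\<^sub>v y))"
proof -
  have xy: "x @\<^sub>v y \<in> carrier_vec n" using x y by simp
  have "S * (S' * A * S) = (S * S') * (A * S)"
    using S S' A by (simp add: assoc_mult_mat[of _ n n _ n _ n])
  then have "A * S = S * four_block_mat A1 (0\<^sub>m h (n - h)) (0\<^sub>m (n - h) h) A2"
    using S A by (simp add: decomp SS'_one)
  moreover have D: "four_block_mat A1 (0\<^sub>m h (n - h)) (0\<^sub>m (n - h) h) A2 \<in> carrier_mat n n"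
    using A1 A2 h_le four_block_carrier_mat[OF A1 A2] by simp
  ultimately have "A *\<^sub>v (S *\<^sub>v (x @\<^sub>v y))
      = S *\<^sub>v (four_block_mat A1 (0\<^sub>m h (n - h)) (0\<^sub>m (n - h) h) A2 *\<^sub>v (x @\<^sub>v y))"
    using S A xy by (metis assoc_mult_mat_vec)
  also have "four_block_mat A1 (0\<^sub>m h (n - h)) (0\<^sub>m (n - h) h) A2 *\<^sub>v (x @\<^sub>v y)
      = (A1 *\<^sub>v x) @\<^sub>v (A2 *\<^sub>v y)"
    using x y A1 A2 by (subst four_block_mat_mult_vec[OF A1 _ _ A2 x y]) auto
  finally show ?thesis .
qed

lemma pow_split:
  assumes "x \<in> carrier_vec h" and "y \<in> carrier_vec (n - h)"
  shows "(A ^\<^sub>m k) *\<^sub>v (S *\<^sub>v (x @\<^sub>v y)) = S *\<^sub>v (((A1 ^\<^sub>m k) *\<^sub>v x) @\<^sub>v ((A2 ^\<^sub>m k) *\<^sub>v y))"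
proof (induction k)
  case 0
  then show ?case using A A1 A2 S assms by simp
next
  case (Suc k)
  have "S *\<^sub>v (x @\<^sub>v y) \<in> carrier_vec n" using S assms by (intro mult_mat_vec_carrier[of _ n n]) auto
  then show ?case
    using A1 A2 assms
    by (simp add: pow_mat_mult_vec_Suc[OF A] pow_mat_mult_vec_Suc[OF A1] pow_mat_mult_vec_Suc[OF A2]
        Suc A_S_append del: pow_mat.simps)
qed

lemma pact_split: "pact A p b = S *\<^sub>v (pact A1 p b1 @\<^sub>v pact A2 p b2)"
proof (induction p)
  case 0
  have "0\<^sub>v h @\<^sub>v 0\<^sub>v (n - h) = (0\<^sub>v n :: real vec)" using h_le by (intro eq_vecI) auto
  then show ?case using A A1 A2 S by simp
next
  case (pCons a p)
  have c: "pact A1 p b1 \<in> carrier_vec h" "pact A2 p b2 \<in> carrier_vec (n - h)" using A1 A2 by auto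
  have cA: "A1 *\<^sub>v pact A1 p b1 \<in> carrier_vec h" "A2 *\<^sub>v pact A2 p b2 \<in> carrier_vec (n - h)"
    using A1 A2 by (auto intro!: mult_mat_vec_carrier)
  have "pact A (pCons a p) b = a \<cdot>\<^sub>v (S *\<^sub>v (b1 @\<^sub>v b2)) + A *\<^sub>v (S *\<^sub>v (pact A1 p b1 @\<^sub>v pact A2 p b2))"
    by (simp add: pact_pCons[OF A b] pCons b_split[symmetric])
  also have "\<dots> = S *\<^sub>v (a \<cdot>\<^sub>v (b1 @\<^sub>v b2) + ((A1 *\<^sub>v pact A1 p b1) @\<^sub>v (A2 *\<^sub>v pact A2 p b2)))"
    unfolding A_S_append[OF c]
    using S cA by (simp add: mult_mat_vec[OF S] mult_add_distrib_mat_vec[OF S])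
  also have "a \<cdot>\<^sub>v (b1 @\<^sub>v b2) + ((A1 *\<^sub>v pact A1 p b1) @\<^sub>v (A2 *\<^sub>v pact A2 p b2))
      = (a \<cdot>\<^sub>v b1 + A1 *\<^sub>v pact A1 p b1) @\<^sub>v (a \<cdot>\<^sub>v b2 + A2 *\<^sub>v pact A2 p b2)"
    using A1 A2 by (intro eq_vecI) (auto simp: carrier_vecD[OF b1_carrier] carrier_vecD[OF b2_carrier])
  finally show ?case by (simp add: pact_pCons[OF A1] pact_pCons[OF A2])
qed

lemma S_zero_iff:
  assumes "x \<in> carrier_vec n" shows "S *\<^sub>v x = 0\<^sub>v n \<longleftrightarrow> x = 0\<^sub>v n"
proof
  assume "S *\<^sub>v x = 0\<^sub>v n"
  then have "S' *\<^sub>v (S *\<^sub>v x) = 0\<^sub>v n" using S' by simp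
  then show "x = 0\<^sub>v n" using S S' assms by (simp add: S'S_one flip: assoc_mult_mat_vec[of _ n n _ n])
qed (use S in simp)

text \<open>The coefficients of p form a vector in the kernel of the controllability matrix, which
  has full rank.\<close>

lemma controllable:
  assumes "pact A p b = 0\<^sub>v n" and "degree p < n"
  shows "p = 0"
proof -
  have C: "conmat n A b \<in> carrier_mat n n" using A by (simp add: conmat_def mat_of_cols_def)
  have "det (conmat n A b) \<noteq> 0" using vec_space.det_rank_iff[OF C] rank by simp
  then have inj: "v = 0\<^sub>v n" if "v \<in> carrier_vec n" "conmat n A b *\<^sub>v v = 0\<^sub>v n" for v
    using det_0_iff_vec_prod_zero_field[OF C] that by blast
  have Cij: "conmat n A b $$ (i, k) = ((A ^\<^sub>m k) *\<^sub>v b) $ i" if "i < n" "k < n" for i k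
    using A that by (simp add: conmat_def mat_of_cols_index)
  define v where "v = vec n (coeff p)"
  have v: "v \<in> carrier_vec n" by (simp add: v_def)
  have "conmat n A b *\<^sub>v v = pact A p b"
  proof (rule eq_vecI)
    fix i assume "i < dim_vec (pact A p b)"
    then have i: "i < n" using A by simp
    have "{..n - 1} = {..<n}" using i by auto
    have "pact A p b $ i = (\<Sum>k\<le>n - 1. coeff p k * ((A ^\<^sub>m k) *\<^sub>v b) $ i)"
      using assms(2) by (intro index_pact[OF A i]) simp
    then show "(conmat n A b *\<^sub>v v) $ i = pact A p b $ i"
      unfolding \<open>{..n - 1} = {..<n}\<close> index_mult_mat_vec_sum[OF C v i] using i
      by (auto intro!: sum.cong simp: v_def Cij)
  qed (use A C in auto)
  then have "v = 0\<^sub>v n" using inj[OF v] assms(1) by simp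
  then have "coeff p k = 0" if "k < n" for k using that by (metis v_def index_vec index_zero_vec(1))
  moreover have "coeff p k = 0" if "\<not> k < n" for k using assms(2) that by (intro coeff_eq_0) auto
  ultimately show ?thesis by (auto simp: poly_eq_iff)
qed

text \<open>Multiplying p by the characteristic polynomial of \<open>A1\<close> also kills the first
  component of b. The remainder of this product modulo both characteristic polynomials then
  annihilates b and has degree below n, so it is zero by controllability; cancelling the factor of
  \<open>A1\<close> leaves the divisibility.\<close>

lemma pact_A2_zero_iff: "pact A2 p b2 = 0\<^sub>v (n - h) \<longleftrightarrow> char_poly A2 dvd p"
proof
  assume p: "pact A2 p b2 = 0\<^sub>v (n - h)"
  let ?c = "char_poly A1 * char_poly A2"
  have zero: "pact A q b = 0\<^sub>v n" if "char_poly A1 dvd q" "pact A2 q b2 = 0\<^sub>v (n - h)" for q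
  proof -
    have "0\<^sub>v h @\<^sub>v 0\<^sub>v (n - h) = (0\<^sub>v n :: real vec)" using h_le by (intro eq_vecI) auto
    then show ?thesis unfolding pact_split using that S by (simp add: pact_dvd_zero[OF A1])
  qed
  have "pact A2 (p * char_poly A1) b2 = pact A2 (char_poly A1 * p) b2" by (simp add: mult.commute)
  moreover have "pact A2 q (0\<^sub>v (n - h)) = 0\<^sub>v (n - h)" for q
    using pact_mult[OF A2 zero_carrier_vec, of q 0] A2 by simp
  ultimately have "pact A2 (char_poly A1 * p) b2 = 0\<^sub>v (n - h)"
    using p by (simp only: pact_mult[OF A2 b2_carrier, of "char_poly A1" p])
  then have "pact A (char_poly A1 * p) b = 0\<^sub>v n" by (intro zero) auto
  moreover have "pact A (?c * (char_poly A1 * p div ?c)) b = 0\<^sub>v n"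
    by (intro zero pact_dvd_zero[OF A2]) auto
  moreover have "pact A (char_poly A1 * p) b
      = pact A (?c * (char_poly A1 * p div ?c)) b + pact A (char_poly A1 * p mod ?c) b"
    by (simp only: pact_add[OF A, symmetric] mult_div_mod_eq)
  ultimately have "pact A (char_poly A1 * p mod ?c) b = 0\<^sub>v n"
    using pact_carrier[OF A, of "char_poly A1 * p mod ?c" b] by simp
  moreover have "degree (char_poly A1 * p mod ?c) < n"
  proof -
    have ne: "char_poly A1 \<noteq> 0" "char_poly A2 \<noteq> 0" by (rule char_poly_neq_0[OF A1], rule char_poly_neq_0[OF A2])
    then have "degree ?c = n"
      using h_le degree_monic_char_poly[OF A1] degree_monic_char_poly[OF A2] by (simp add: degree_mult_eq)
    then show ?thesis using ne degree_mod_less[of ?c "char_poly A1 * p"] h_pos h_le by auto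
  qed
  ultimately have "char_poly A1 * p mod ?c = 0" by (rule controllable)
  then have "?c dvd char_poly A1 * p" by (simp only: dvd_eq_mod_eq_0)
  then show "char_poly A2 dvd p" using char_poly_neq_0[OF A1] by simp
qed (rule pact_dvd_zero[OF A2 b2_carrier])

text \<open>From the matrix identity it suffices to test the single vector \<open>b2\<close>, whose
  annihilating polynomials are known. Conversely Cayley--Hamilton applied to unit vectors recovers
  the matrix identity column by column.\<close>

lemma nonneg_recursion_iff:
  "nonneg_recursion A2 \<longleftrightarrow> (\<exists>F. recursion_poly F \<and> char_poly A2 dvd F)"
proof
  assume "nonneg_recursion A2"
  then obtain m and c :: "nat \<Rightarrow> real" where c: "\<forall>i<m. 0 \<le> c i"
    "A2 ^\<^sub>m m = finsum (module_mat TYPE(real) (n - h) (n - h)) (\<lambda>i. c i \<cdot>\<^sub>m (A2 ^\<^sub>m i)) {..<m}"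
    using A2 by (auto simp: nonneg_recursion_def)
  have pm: "(A2 ^\<^sub>m m) $$ (i, j) = (\<Sum>k<m. c k * (A2 ^\<^sub>m k) $$ (i, j))" if "i < n - h" "j < n - h" for i j
    using that A2 unfolding c(2)
    by (subst index_finsum_mat[THEN conjunct2, rule_format]) (auto intro!: sum.cong)
  define F where "F = monom 1 m - (\<Sum>i<m. monom (c i) i)"
  have coF: "coeff F k = (if k = m then 1 else 0) - (if k < m then c k else 0)" for k
    by (simp add: F_def coeff_sum)
  have "degree F \<le> m" by (rule degree_le) (simp add: coF)
  moreover have "m \<le> degree F" by (rule le_degree) (simp add: coF)
  ultimately have degF: "degree F = m" by simp
  have "pact A2 F b2 = 0\<^sub>v (n - h)"
  proof (rule eq_vecI)
    fix i assume "i < dim_vec (0\<^sub>v (n - h) :: real vec)"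
    then have i: "i < n - h" by simp
    have "pact A2 F b2 $ i = (\<Sum>k\<le>m. coeff F k * (\<Sum>j<n - h. (A2 ^\<^sub>m k) $$ (i, j) * b2 $ j))"
      using A2 i by (subst index_pact[OF A2 i, of F m])
        (auto simp: degF scalar_prod_def lessThan_atLeast0 carrier_vecD[OF b2_carrier] intro!: sum.cong)
    also have "\<dots> = (\<Sum>j<n - h. ((A2 ^\<^sub>m m) $$ (i, j) - (\<Sum>k<m. c k * (A2 ^\<^sub>m k) $$ (i, j))) * b2 $ j)"
    proof -
      have "(\<Sum>k\<le>m. coeff F k * (\<Sum>j<n - h. (A2 ^\<^sub>m k) $$ (i, j) * b2 $ j))
          = (\<Sum>j<n - h. (\<Sum>k\<le>m. coeff F k * (A2 ^\<^sub>m k) $$ (i, j)) * b2 $ j)"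
        unfolding sum_distrib_left sum_distrib_right by (subst sum.swap) (simp add: mult.assoc)
      moreover have "(\<Sum>k\<le>m. coeff F k * x k) = x m - (\<Sum>k<m. c k * x k)" for x
        by (simp add: coF sum_negf lessThan_Suc_atMost[symmetric])
      ultimately show ?thesis by simp
    qed
    also have "\<dots> = 0" using pm[OF i] by (intro sum.neutral) auto
    finally show "pact A2 F b2 $ i = 0\<^sub>v (n - h) $ i" using i by simp
  qed (use A2 in simp)
  then have "char_poly A2 dvd F" by (simp add: pact_A2_zero_iff)
  moreover have "recursion_poly F" using c(1) by (auto simp: recursion_poly_def degF coF)
  ultimately show "\<exists>F. recursion_poly F \<and> char_poly A2 dvd F" by blast
next
  assume "\<exists>F. recursion_poly F \<and> char_poly A2 dvd F"
  then obtain F where F: "recursion_poly F" "char_poly A2 dvd F" by blast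
  define m where "m = degree F"
  let ?M = "finsum (module_mat TYPE(real) (n - h) (n - h)) (\<lambda>i. - coeff F i \<cdot>\<^sub>m (A2 ^\<^sub>m i)) {..<m}"
  have M: "?M \<in> carrier_mat (n - h) (n - h)"
    "\<And>i j. i < n - h \<Longrightarrow> j < n - h \<Longrightarrow> ?M $$ (i, j) = (\<Sum>x<m. (- coeff F x \<cdot>\<^sub>m (A2 ^\<^sub>m x)) $$ (i, j))"
    using index_finsum_mat[of "{..<m}" "\<lambda>i. - coeff F i \<cdot>\<^sub>m (A2 ^\<^sub>m i)" "n - h" "n - h"] A2 by auto
  have "A2 ^\<^sub>m m = ?M"
  proof (rule eq_matI)
    fix i j assume "i < dim_row ?M" "j < dim_col ?M"
    then have ij: "i < n - h" "j < n - h" using M(1) by auto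
    have e: "((A2 ^\<^sub>m k) *\<^sub>v unit_vec (n - h) j) $ i = (A2 ^\<^sub>m k) $$ (i, j)" for k
      using A2 ij by (simp add: scalar_prod_right_unit)
    have "pact A2 F (unit_vec (n - h) j) = 0\<^sub>v (n - h)"
      using F(2) by (intro pact_dvd_zero[OF A2]) auto
    then have "(\<Sum>k\<le>m. coeff F k * (A2 ^\<^sub>m k) $$ (i, j)) = 0"
      using index_pact[OF A2 ij(1), of F m "unit_vec (n - h) j"] ij by (simp only: e m_def) simp
    then have "(A2 ^\<^sub>m m) $$ (i, j) = (\<Sum>k<m. - coeff F k * (A2 ^\<^sub>m k) $$ (i, j))"
      using F(1) by (simp add: lessThan_Suc_atMost[symmetric] recursion_poly_def m_def sum_negf)
    then show "(A2 ^\<^sub>m m) $$ (i, j) = ?M $$ (i, j)"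
      using A2 ij by (simp add: M(2))
  qed (use A2 M(1) in auto)
  moreover have "\<forall>i<m. 0 \<le> - coeff F i" using F(1) by (auto simp: recursion_poly_def m_def)
  ultimately show "nonneg_recursion A2"
    unfolding nonneg_recursion_def using A2
    by (intro exI[of _ m] exI[of _ "\<lambda>i. - coeff F i"]) simp
qed

end

section \<open>Recursions and dominant roots\<close>

context controllable_system
begin

text \<open>Condition (c), worded exactly as in the final statement so that unfolding it there
  suffices.\<close>

definition dominant_root_condition :: bool where
  "dominant_root_condition \<longleftrightarrow>
    (\<forall>lr :: real. 0 < lr \<and> complex_of_real lr \<in> spec A2 \<longrightarrow>
           lr = rho A2 \<and>
           (\<forall>z \<in> sigma_rho A2. \<exists>\<phi> \<in> \<rat>.
              z = complex_of_real (rho A2) * exp (complex_of_real \<phi> * 2 * of_real pi * \<i>)) \<and>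
           (\<forall>z \<in> sigma_rho A2. simple_eigenvalue A2 z) \<and>
           \<not> (\<exists>z \<in> sigma_minus A2. z \<noteq> 0 \<and>
                (\<exists>k :: int. Arg z = of_int k * (2 * pi / real (min_period h A2 * h)))))"

lemma spec_A2_le: "z \<in> spec A2 \<Longrightarrow> cmod z \<le> rho A2"
  by (rule spec_le_rho[OF A2])

lemma spec_A2_less: "z \<in> spec A2 \<Longrightarrow> cmod z < rho A"
  by (simp add: spec_A2 sigma_minus_def)

lemma min_period_eq:
  assumes "rho A2 \<noteq> 0"
  shows "min_period h A2 = (LEAST M. 0 < M \<and> sigma_rho A2 \<subseteq> {z. z ^ (M * h) = of_real (rho A2) ^ (M * h)})"
proof -
  have "(0 < M \<and> sigma_rho A2 \<subseteq> {complex_of_real (rho A2) * exp (2 * of_nat k * of_real pi * \<i> / of_nat (M * h)) | k. k < M * h})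
    \<longleftrightarrow> (0 < M \<and> sigma_rho A2 \<subseteq> {z. z ^ (M * h) = of_real (rho A2) ^ (M * h)})" for M
    using scaled_roots_of_unity[of "M * h" "rho A2"] assms h_pos by (cases "0 < M") auto
  then show ?thesis unfolding min_period_def by presburger
qed

text \<open>\<open>LEAST\<close> carries information only once some candidate exists. A common
  exponent N is itself a candidate, since z^N = rho^N implies z^(N h) = rho^(N h).\<close>

lemma min_period_props:
  assumes "rho A2 \<noteq> 0" and "0 < N" and "\<forall>z\<in>sigma_rho A2. z ^ N = of_real (rho A2) ^ N"
  shows "0 < min_period h A2"
    and "z \<in> sigma_rho A2 \<Longrightarrow> z ^ (min_period h A2 * h) = of_real (rho A2) ^ (min_period h A2 * h)"
proof -
  let ?P = "\<lambda>M. 0 < M \<and> sigma_rho A2 \<subseteq> {z. z ^ (M * h) = of_real (rho A2) ^ (M * h)}"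
  have "?P N" using assms by (auto simp: power_mult)
  then have "?P (min_period h A2)" unfolding min_period_eq[OF assms(1)] by (rule LeastI)
  then show "0 < min_period h A2"
    and "z \<in> sigma_rho A2 \<Longrightarrow> z ^ (min_period h A2 * h) = of_real (rho A2) ^ (min_period h A2 * h)" by auto
qed

lemma sgn_power_iff:
  fixes z :: complex
  assumes "cmod z = r" and "0 < r"
  shows "z ^ k = of_real r ^ k \<longleftrightarrow> sgn z ^ k = 1"
  using assms by (auto simp: complex_sgn_def scaleR_conv_of_real power_mult_distrib power_divide field_simps)

text \<open>F vanishes on \<open>spec A2\<close>, so \<open>lr\<close> is its positive root and
  bounds all other eigenvalues in modulus. Rational angles come from any single exponent N - i in
  the support, simplicity from the simple peripheral roots of F. For (c4), M h divides all these
  exponents, so an eigenvalue at one of the excluded angles would be aligned and hence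
  peripheral.\<close>

lemma recursion_imp_dominant_root_condition:
  assumes F: "recursion_poly F" and dvd: "char_poly A2 dvd F"
  shows dominant_root_condition
  unfolding dominant_root_condition_def
proof (intro allI impI)
  fix lr :: real assume lr: "0 < lr \<and> complex_of_real lr \<in> spec A2"
  have root: "poly (cpoly F) z = 0" if "z \<in> spec A2" for z
  proof -
    obtain u where "F = char_poly A2 * u" using dvd by blast
    then show ?thesis using that spec_iff_root[OF A2] by (simp add: of_real_poly_hom.hom_mult)
  qed
  have lr0: "0 < lr" and lrs: "complex_of_real lr \<in> spec A2" using lr by auto
  have Flr: "poly F lr = 0" using root[OF lrs] by simp
  have F0: "F \<noteq> 0" using F by (auto simp: recursion_poly_def)
  let ?J = "{i. i < degree F \<and> coeff F i \<noteq> 0}"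
  have le: "cmod z \<le> lr" if "z \<in> spec A2" for z
    using recursion_poly_root_le[OF F lr0 Flr _ root[OF that]] lr0 by (cases "z = 0") auto
  have "rho A2 \<le> lr"
  proof -
    have c: "cmat A2 \<in> carrier_mat (n - h) (n - h)" using A2 by simp
    have "0 < n - h" using lrs spec_eigenvector[OF A2, of "of_real lr"] by (auto simp: vec_eq_iff)
    from spectral_radius_mem_max(1)[OF c this] show ?thesis
      using le by (auto simp: rho_def spec_def)
  qed
  then have lr_eq: "lr = rho A2" using spec_A2_le[OF lrs] lr0 by simp
  have per: "z \<noteq> 0" "z \<in> spec A2" "cmod z = lr" "poly (cpoly F) z = 0" if "z \<in> sigma_rho A2" for z
    using that lr0 root by (auto simp: sigma_rho_def lr_eq)
  obtain i0 where i0: "i0 \<in> ?J" using recursion_poly_support_nonempty[OF F lr0 Flr] by blast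
  have sgn1: "sgn z ^ (degree F - i) = 1" if "z \<in> sigma_rho A2" "i \<in> ?J" for z i
    using recursion_poly_peripheral_root[OF F lr0 Flr per(1) per(4) per(3)] that by blast
  have pow: "\<forall>z\<in>sigma_rho A2. z ^ (degree F - i) = of_real (rho A2) ^ (degree F - i)" if "i \<in> ?J" for i
    using sgn1[OF _ that] per(3) lr0 by (auto simp: lr_eq sgn_power_iff)
  have N0: "0 < degree F - i" if "i \<in> ?J" for i using that by auto
  have r0: "rho A2 \<noteq> 0" using lr0 by (simp add: lr_eq)
  define M where "M = min_period h A2"
  have M: "0 < M" "\<And>z. z \<in> sigma_rho A2 \<Longrightarrow> z ^ (M * h) = of_real (rho A2) ^ (M * h)"
    unfolding M_def using min_period_props[OF r0 N0[OF i0] pow[OF i0]] by auto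
  \<comment> \<open>The gcd g of the exponent and M h still sends all peripheral phases to 1;
    minimality of M should give g = M h.\<close>
  have Mdvd: "M * h dvd degree F - i" if i: "i \<in> ?J" for i
  proof -
    define g where "g = gcd (degree F - i) (M * h)"
    have g1: "sgn z ^ g = 1" if "z \<in> sigma_rho A2" for z
      unfolding g_def
    proof (rule power_gcd_eq_1[OF sgn1[OF that i]])
      show "sgn z ^ (M * h) = 1" using M(2)[OF that] per(3)[OF that] lr0 by (simp add: sgn_power_iff lr_eq)
    qed
    \<comment> \<open>Minimality of M speaks only about multiples of h. That g is one follows from
      the rotational symmetry, since the rotated \<open>lr\<close> is again a peripheral eigenvalue
      of \<open>A2\<close>.\<close>
    have "cis (2 * pi / real h) * of_real lr \<in> sigma_rho A2"
      using spec_A2_rotate[OF lrs, of 1] lr0 by (simp add: sigma_rho_def norm_mult lr_eq)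
    from g1[OF this] have "cis (2 * pi / real h) ^ g = 1"
      using lr0 by (simp add: sgn_mult sgn_of_real)
    then have "h dvd g" using h_pos by (simp add: cis_root_power_eq_1_iff)
    then obtain m where m: "g = m * h" by (auto simp: dvd_def mult.commute)
    have "0 < g" using N0[OF i] by (simp add: g_def)
    then have m0: "0 < m" using m by (cases m) auto
    have "\<forall>z\<in>sigma_rho A2. z ^ (m * h) = of_real (rho A2) ^ (m * h)"
      using g1 per(3) lr0 by (auto simp: m[symmetric] sgn_power_iff lr_eq)
    then have "M \<le> m" unfolding M_def min_period_eq[OF r0] using m0 by (intro Least_le) auto
    moreover have "m * h \<le> M * h" using M(1) h_pos by (intro dvd_imp_le) (auto simp: m[symmetric] g_def)
    ultimately have "m = M" using h_pos by simp
    then show ?thesis using m unfolding g_def by (metis gcd_dvd1)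
  qed
  show "lr = rho A2 \<and>
           (\<forall>z \<in> sigma_rho A2. \<exists>\<phi> \<in> \<rat>.
              z = complex_of_real (rho A2) * exp (complex_of_real \<phi> * 2 * of_real pi * \<i>)) \<and>
           (\<forall>z \<in> sigma_rho A2. simple_eigenvalue A2 z) \<and>
           \<not> (\<exists>z \<in> sigma_minus A2. z \<noteq> 0 \<and>
                (\<exists>k :: int. Arg z = of_int k * (2 * pi / real (min_period h A2 * h))))"
  proof (intro conjI ballI notI)
    show "lr = rho A2" by (rule lr_eq)
  next
    fix z assume z: "z \<in> sigma_rho A2"
    define m where "m = degree F - i0"
    have m: "0 < m" using N0[OF i0] by (simp add: m_def)
    have "z ^ m = of_real (rho A2) ^ m" using pow[OF i0] z by (simp add: m_def)
    then have "z \<in> {complex_of_real (rho A2) * exp (2 * of_nat k * of_real pi * \<i> / of_nat m) | k. k < m}"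
      using scaled_roots_of_unity[OF m r0] by auto
    then obtain k where "z = complex_of_real (rho A2) * exp (2 * of_nat k * of_real pi * \<i> / of_nat m)" by auto
    then have "z = complex_of_real (rho A2) * exp (complex_of_real (real k / real m) * 2 * of_real pi * \<i>)"
      by (simp add: ac_simps)
    then show "\<exists>\<phi>\<in>\<rat>. z = complex_of_real (rho A2) * exp (complex_of_real \<phi> * 2 * of_real pi * \<i>)"
      by (intro bexI[of _ "real k / real m"]) auto
  next
    fix z assume z: "z \<in> sigma_rho A2"
    have "order z (cpoly F) = 1"
      by (rule recursion_poly_peripheral_simple[OF F lr0 Flr per(1)[OF z] per(4)[OF z] per(3)[OF z]])
    moreover have "cpoly (char_poly A2) dvd cpoly F" using dvd by (rule of_real_poly_hom.hom_dvd)
    ultimately have "order z (cpoly (char_poly A2)) \<le> 1"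
      using F0 dvd_imp_order_le[of "cpoly F" "cpoly (char_poly A2)" z] by simp
    moreover have "order z (cpoly (char_poly A2)) \<noteq> 0"
      using per(2)[OF z] char_poly_neq_0[OF A2] by (simp add: order_root spec_iff_root[OF A2])
    ultimately show "simple_eigenvalue A2 z"
      using per(2)[OF z] by (simp add: simple_eigenvalue_def cpoly_char_poly[OF A2])
  next
    assume "\<exists>z \<in> sigma_minus A2. z \<noteq> 0 \<and>
                (\<exists>k :: int. Arg z = of_int k * (2 * pi / real (min_period h A2 * h)))"
    then obtain z where z: "z \<in> sigma_minus A2" "z \<noteq> 0"
      "\<exists>k :: int. Arg z = of_int k * (2 * pi / real (M * h))" unfolding M_def by blast
    have "sgn z ^ (M * h) = 1" using z M(1) h_pos by (simp only: sgn_power_eq_1_iff_Arg[OF z(2)] nat_0_less_mult_iff)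
    then have "sgn z ^ (degree F - i) = 1" if "i \<in> ?J" for i
      using Mdvd[OF that] by (auto simp: power_mult)
    moreover have zs: "z \<in> spec A2" "cmod z < lr" using z(1) by (auto simp: sigma_minus_def lr_eq)
    ultimately have "cmod z = lr"
      using recursion_poly_root_aligned[OF F lr0 Flr z(2) root[OF zs(1)]] by blast
    then show False using zs(2) by simp
  qed
qed

text \<open>Everything depends on a radius r <= \<open>rho A\<close> and an exponent d. With a
  positive eigenvalue, r is that eigenvalue and d = M h: the peripheral eigenvalues get d-th power
  r^d, and (c4) keeps the d-th powers of the others off the positive axis. Without one, d = h works
  by rotational symmetry, and r is any number between the moduli and \<open>rho A\<close>. In both
  cases \<open>rho A ^ d\<close> lies at or beyond the positive root r^d of F, which gives the
  sign.\<close>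

lemma dominant_root_condition_imp_recursion:
  assumes dominant_root_condition
  shows "\<exists>F d. recursion_poly F \<and> 0 < degree F \<and> 0 < d \<and> h dvd d \<and> 0 \<le> poly F (rho A ^ d) \<and>
    char_poly A2 dvd pcompose F (monom 1 d)"
proof -
  obtain xs where xs: "cpoly (char_poly A2) = (\<Prod>x\<leftarrow>xs. [:- x, 1:])"
    using char_poly_factorized[of "cmat A2" "n - h"] A2 cpoly_char_poly[OF A2] by auto
  have xs_spec: "x \<in> set xs \<longleftrightarrow> x \<in> spec A2" for x
  proof -
    have "poly (\<Prod>x\<leftarrow>xs. [:- x, 1:]) x = 0 \<longleftrightarrow> x \<in> set xs" by (induction xs) auto
    then show ?thesis by (simp add: spec_iff_root[OF A2] xs)
  qed
  have "\<exists>r d. 0 < r \<and> r \<le> rho A \<and> 0 < d \<and> h dvd d \<and> (\<forall>x\<in>set xs.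
      x ^ d = of_real (r ^ d) \<and> count_list xs x = 1 \<or> cmod x < r \<and> \<not> (x ^ d \<in> \<real> \<and> 0 < Re (x ^ d)))"
  proof (cases "\<exists>lr::real. 0 < lr \<and> complex_of_real lr \<in> spec A2")
    case True
    then obtain lr :: real where lr: "0 < lr" "complex_of_real lr \<in> spec A2" by blast
    with assms have c: "lr = rho A2"
      "\<forall>z \<in> sigma_rho A2. \<exists>\<phi> \<in> \<rat>. z = complex_of_real (rho A2) * exp (complex_of_real \<phi> * 2 * of_real pi * \<i>)"
      "\<forall>z \<in> sigma_rho A2. simple_eigenvalue A2 z"
      "\<not> (\<exists>z \<in> sigma_minus A2. z \<noteq> 0 \<and> (\<exists>k :: int. Arg z = of_int k * (2 * pi / real (min_period h A2 * h))))"
      unfolding dominant_root_condition_def by blast+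
    have r0: "rho A2 \<noteq> 0" using lr c by simp
    have "\<exists>q>0. z ^ q = of_real (rho A2) ^ q" if "z \<in> sigma_rho A2" for z
    proof -
      obtain \<phi> where \<phi>: "\<phi> \<in> \<rat>" "z = complex_of_real (rho A2) * exp (complex_of_real \<phi> * 2 * of_real pi * \<i>)"
        using c(2) \<open>z \<in> sigma_rho A2\<close> by blast
      obtain a and q :: nat where q: "q \<noteq> 0" "\<bar>\<phi>\<bar> = real a / real q" using Rats_abs_nat_div_natE[OF \<phi>(1)] by metis
      \<comment> \<open>Only the absolute value of \<phi> is available as a quotient of naturals, so
        the sign is restored here.\<close>
      define s :: int where "s = (if \<phi> < 0 then - int a else int a)"
      have s: "\<phi> * real q = of_int s" using q by (auto simp: s_def field_simps split: if_splits)
      have "exp (complex_of_real \<phi> * 2 * of_real pi * \<i>) = cis (2 * pi * \<phi>)"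
        by (simp add: cis_conv_exp ac_simps)
      moreover have "cis (2 * pi * \<phi>) ^ q = cis (of_int s * 2 * pi)"
        unfolding DeMoivre s[symmetric] by (simp add: ac_simps)
      moreover have "cis (of_int s * 2 * pi) = 1" by (subst cis_eq_1_iff) blast
      ultimately show ?thesis using q(1) \<phi>(2) by (intro exI[of _ q]) (simp add: power_mult_distrib)
    qed
    then obtain q where q: "\<And>z. z \<in> sigma_rho A2 \<Longrightarrow> 0 < q z \<and> z ^ q z = of_real (rho A2) ^ q z" by metis
    have fin: "finite (sigma_rho A2)" using finite_spec[OF A2] by (simp add: sigma_rho_def)
    \<comment> \<open>A common exponent for all peripheral eigenvalues; it serves only to show that
      the minimal period exists.\<close>
    define N where "N = (\<Prod>z\<in>sigma_rho A2. q z)"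
    have N: "0 < N" unfolding N_def using q by (intro prod_pos) auto
    have "\<forall>z\<in>sigma_rho A2. z ^ N = of_real (rho A2) ^ N"
    proof
      fix z assume z: "z \<in> sigma_rho A2"
      then have "q z dvd N" unfolding N_def using fin by (intro dvd_prodI) auto
      then show "z ^ N = of_real (rho A2) ^ N" using q[OF z] by (auto simp: power_mult)
    qed
    note mp = min_period_props[OF r0 N this]
    define d where "d = min_period h A2 * h"
    have d0: "0 < d" using mp(1) h_pos by (simp add: d_def)
    show ?thesis
    proof (intro exI[of _ lr] exI[of _ d] conjI ballI)
      show "lr \<le> rho A" using spec_A2_less[OF lr(2)] lr(1) by simp
      fix x assume "x \<in> set xs"
      then have x: "x \<in> spec A2" by (simp add: xs_spec)
      show "x ^ d = of_real (lr ^ d) \<and> count_list xs x = 1 \<or> cmod x < lr \<and> \<not> (x ^ d \<in> \<real> \<and> 0 < Re (x ^ d))"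
      proof (cases "cmod x = rho A2")
        case True
        then have xr: "x \<in> sigma_rho A2" using x by (simp add: sigma_rho_def)
        have "count_list xs x = 1"
          using c(3) xr by (auto simp: simple_eigenvalue_def cpoly_char_poly[OF A2] xs order_prod_linear_factors)
        then show ?thesis using mp(2)[OF xr] c(1) by (simp add: d_def)
      next
        case False
        then have less: "cmod x < rho A2" using spec_A2_le[OF x] by simp
        have "\<not> (x ^ d \<in> \<real> \<and> 0 < Re (x ^ d))"
        proof (cases "x = 0")
          case False
          have "x \<in> sigma_minus A2" using x less by (simp add: sigma_minus_def)
          then have "\<not> (\<exists>k :: int. Arg x = of_int k * (2 * pi / real d))" using c(4) False by (auto simp: d_def)
          then show ?thesis using pos_real_power_iff_sgn[OF False] sgn_power_eq_1_iff_Arg[OF False d0] by blast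
        qed (use d0 in \<open>auto simp: power_0_left\<close>)
        then show ?thesis using less c(1) by simp
      qed
    qed (use lr d0 in \<open>auto simp: d_def\<close>)
  next
    case False
    \<comment> \<open>The midpoint of t and \<open>rho A\<close> becomes the artificial radius:
      every eigenvalue of \<open>A2\<close> lies strictly inside it. The inserted 0 covers an empty
      spectrum.\<close>
    define t where "t = Max (insert 0 (cmod ` set xs))"
    have t: "0 \<le> t" "t < rho A" "\<And>x. x \<in> set xs \<Longrightarrow> cmod x \<le> t"
      using spec_A2_less rho_pos by (auto simp: t_def xs_spec)
    show ?thesis
    proof (intro exI[of _ "(t + rho A) / 2"] exI[of _ h] conjI ballI disjI2)
      fix x assume x: "x \<in> set xs"
      show "cmod x < (t + rho A) / 2" using t(2) t(3)[OF x] by simp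
      have xs': "x \<in> spec A2" using x by (simp add: xs_spec)
      show "\<not> (x ^ h \<in> \<real> \<and> 0 < Re (x ^ h))"
      proof
        assume pos: "x ^ h \<in> \<real> \<and> 0 < Re (x ^ h)"
        then have x0: "x \<noteq> 0" using h_pos by (auto simp: power_0_left)
        then have "sgn x ^ h = 1" using pos by (simp add: pos_real_power_iff_sgn)
        then have "sgn x \<in> {z. z ^ h = 1}" by simp
        also have "{z. z ^ h = 1} = (\<lambda>k. cis (2 * pi * real k / real h)) ` {..<h}"
          using bij_betw_roots_unity[OF h_pos] by (simp add: bij_betw_def)
        finally obtain k where k: "k < h" "sgn x = cis (2 * pi * real k / real h)" by auto
        have ck: "cis (2 * pi / real h) ^ k = sgn x" unfolding k(2) DeMoivre by (simp add: ac_simps)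
        \<comment> \<open>x is a positive multiple of an h-th root of unity. Rotating it by the
          inverse root stays inside \<open>spec A2\<close> and yields a positive real eigenvalue,
          which this case excludes.\<close>
        have "cis (2 * pi / real h) ^ (h - k) * sgn x = cis (2 * pi / real h) ^ h"
          unfolding ck[symmetric] using k(1) by (simp flip: power_add)
        also have "\<dots> = 1" using h_pos by (simp add: cis_root_power_eq_1_iff)
        finally have "cis (2 * pi / real h) ^ (h - k) * x = of_real (cmod x)"
          using x0 by (simp add: complex_sgn_def scaleR_conv_of_real field_simps)
        then have "complex_of_real (cmod x) \<in> spec A2"
          using spec_A2_rotate[OF xs', of "h - k"] by simp
        then show False using False x0 by (metis zero_less_norm_iff)
      qed
    qed (use t rho_pos h_pos in auto)
  qed
  then obtain r d where rd: "0 < r" "r \<le> rho A" "0 < d" "h dvd d" "\<And>x. x \<in> set xs \<Longrightarrow>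
      x ^ d = of_real (r ^ d) \<and> count_list xs x = 1 \<or> cmod x < r \<and> \<not> (x ^ d \<in> \<real> \<and> 0 < Re (x ^ d))"
    by blast
  from recursion_multiple[OF rd(1,3,5)] obtain F where F: "recursion_poly F" "0 < degree F" "poly F (r ^ d) = 0"
    "(\<Prod>x\<leftarrow>xs. [:- x, 1:]) dvd cpoly (pcompose F (monom 1 d))" by blast
  have "0 \<le> poly F (rho A ^ d)"
    using rd by (intro recursion_poly_ge_0[OF F(1) _ F(3)] power_mono) auto
  moreover have "char_poly A2 dvd pcompose F (monom 1 d)"
    using F(4) unfolding xs[symmetric] by (rule of_real_hom.dvd_map_poly_hom_imp_dvd)
  ultimately show ?thesis using F rd by blast
qed

theorem nonneg_recursion_iff_dominant_root_condition: "nonneg_recursion A2 \<longleftrightarrow> dominant_root_condition"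
  unfolding nonneg_recursion_iff
  using recursion_imp_dominant_root_condition dominant_root_condition_imp_recursion recursion_poly_pcompose_monom
  by meson

end

section \<open>Cones of nonnegative vectors\<close>

text \<open>Used as an induction principle: by \<open>cone_least\<close>, a property holds on a
  generated cone once it defines a convex cone and holds for the generators.\<close>

definition convex_cone :: "nat \<Rightarrow> real vec set \<Rightarrow> bool" where
  "convex_cone n D \<longleftrightarrow> D \<subseteq> carrier_vec n \<and> 0\<^sub>v n \<in> D \<and> (\<forall>x\<in>D. \<forall>y\<in>D. x + y \<in> D) \<and>
    (\<forall>x\<in>D. \<forall>c\<ge>0. c \<cdot>\<^sub>v x \<in> D)"

lemma convex_cone_finsum:
  assumes "convex_cone n D" and "finite I" and "\<And>i. i \<in> I \<Longrightarrow> x i \<in> D" and "\<And>i. i \<in> I \<Longrightarrow> 0 \<le> c i"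
  shows "finsum_vec TYPE(real) n (\<lambda>i. c i \<cdot>\<^sub>v x i) I \<in> D"
  using assms(2-4)
proof (induction I rule: finite_induct)
  case empty
  then show ?case using assms(1) by (simp add: finsum_vec_empty convex_cone_def)
next
  case (insert i I)
  have D: "c j \<cdot>\<^sub>v x j \<in> D" if "j \<in> insert i I" for j
    using insert.prems that assms(1) by (simp add: convex_cone_def)
  have "finsum_vec TYPE(real) n (\<lambda>i. c i \<cdot>\<^sub>v x i) (insert i I)
      = c i \<cdot>\<^sub>v x i + finsum_vec TYPE(real) n (\<lambda>i. c i \<cdot>\<^sub>v x i) I"
    using insert.hyps D assms(1) by (intro finsum_vec_insert) (auto simp: convex_cone_def simp del: smult_carrier_vec)
  then show ?case using D[of i] insert assms(1) by (simp add: convex_cone_def)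
qed

lemma index_finsum_vec_smult:
  assumes "finite I" and "\<And>i. i \<in> I \<Longrightarrow> x i \<in> carrier_vec n" and "r < n"
  shows "finsum_vec TYPE(real) n (\<lambda>i. c i \<cdot>\<^sub>v x i) I $ r = (\<Sum>i\<in>I. c i * x i $ r)"
proof -
  have "finsum_vec TYPE(real) n (\<lambda>i. c i \<cdot>\<^sub>v x i) I $ r = (\<Sum>i\<in>I. (c i \<cdot>\<^sub>v x i) $ r)"
    using assms by (intro index_finsum_vec) auto
  also have "\<dots> = (\<Sum>i\<in>I. c i * x i $ r)"
  proof (rule sum.cong)
    fix i assume "i \<in> I"
    then show "(c i \<cdot>\<^sub>v x i) $ r = c i * x i $ r" using carrier_vecD[OF assms(2)] assms(3) by simp
  qed simp
  finally show ?thesis .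
qed

lemma finsum_vec_smult_eq:
  assumes "finite I" and "\<And>i. i \<in> I \<Longrightarrow> x i \<in> carrier_vec n"
  shows "finsum_vec TYPE(real) n (\<lambda>i. c i \<cdot>\<^sub>v x i) I = vec n (\<lambda>r. \<Sum>i\<in>I. c i * x i $ r)"
proof (rule eq_vecI)
  have "finsum_vec TYPE(real) n (\<lambda>i. c i \<cdot>\<^sub>v x i) I \<in> carrier_vec n"
    using assms by (intro finsum_vec_closed) auto
  then show "dim_vec (finsum_vec TYPE(real) n (\<lambda>i. c i \<cdot>\<^sub>v x i) I) = dim_vec (vec n (\<lambda>r. \<Sum>i\<in>I. c i * x i $ r))"
    by simp
qed (use index_finsum_vec_smult[OF assms] in simp)

lemma convex_cone_sum:
  assumes D: "convex_cone n D" and I: "finite I" and x: "\<And>i. i \<in> I \<Longrightarrow> x i \<in> D" and c: "\<And>i. i \<in> I \<Longrightarrow> 0 \<le> c i"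
  shows "vec n (\<lambda>r. \<Sum>i\<in>I. c i * x i $ r) \<in> D"
proof -
  have "x i \<in> carrier_vec n" if "i \<in> I" for i using x[OF that] D by (auto simp: convex_cone_def)
  from finsum_vec_smult_eq[OF I this] convex_cone_finsum[OF D I x c] show ?thesis by simp
qed

lemma cone_least:
  assumes "convex_cone n D" and "G \<subseteq> D"
  shows "cone n G \<subseteq> D"
proof
  fix x assume "x \<in> cone n G"
  then obtain F c where F: "finite F" "F \<subseteq> G" "\<forall>v\<in>F. 0 \<le> c v"
    "x = finsum_vec TYPE(real) n (\<lambda>v. c v \<cdot>\<^sub>v v) F" unfolding cone_def by blast
  show "x \<in> D" unfolding F(4) using F(2,3) assms(2) by (intro convex_cone_finsum[OF assms(1) F(1)]) auto
qed

lemma convex_cone_cone: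
  assumes G: "G \<subseteq> carrier_vec n"
  shows "convex_cone n (cone n G)"
  unfolding convex_cone_def
proof (intro conjI ballI allI impI)
  have e: "finsum_vec TYPE(real) n (\<lambda>v. c v \<cdot>\<^sub>v v) F = vec n (\<lambda>r. \<Sum>v\<in>F. c v * v $ r)"
    if "finite F" "F \<subseteq> G" for F c
    using that G by (intro finsum_vec_smult_eq) auto
  have mem: "x \<in> cone n G \<longleftrightarrow> (\<exists>F c. finite F \<and> F \<subseteq> G \<and> (\<forall>v\<in>F. 0 \<le> c v) \<and> x = vec n (\<lambda>r. \<Sum>v\<in>F. c v * v $ r))" for x
  proof
    assume "x \<in> cone n G"
    then obtain F c where F: "finite F" "F \<subseteq> G" "\<forall>v\<in>F. 0 \<le> c v"
      "x = finsum_vec TYPE(real) n (\<lambda>v. c v \<cdot>\<^sub>v v) F" unfolding cone_def by blast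
    then show "\<exists>F c. finite F \<and> F \<subseteq> G \<and> (\<forall>v\<in>F. 0 \<le> c v) \<and> x = vec n (\<lambda>r. \<Sum>v\<in>F. c v * v $ r)"
      using e[OF F(1,2)] by blast
  next
    assume "\<exists>F c. finite F \<and> F \<subseteq> G \<and> (\<forall>v\<in>F. 0 \<le> c v) \<and> x = vec n (\<lambda>r. \<Sum>v\<in>F. c v * v $ r)"
    then obtain F c where F: "finite F" "F \<subseteq> G" "\<forall>v\<in>F. 0 \<le> c v" "x = vec n (\<lambda>r. \<Sum>v\<in>F. c v * v $ r)"
      by blast
    then show "x \<in> cone n G" unfolding cone_def using e[OF F(1,2), of c] by (auto intro!: exI[of _ F] exI[of _ c])
  qed
  show "cone n G \<subseteq> carrier_vec n" using mem by auto
  show "0\<^sub>v n \<in> cone n G" unfolding mem by (intro exI[of _ "{}"]) (auto intro!: eq_vecI)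
  fix x assume x: "x \<in> cone n G"
  then obtain F c where F: "finite F" "F \<subseteq> G" "\<forall>v\<in>F. 0 \<le> c v" "x = vec n (\<lambda>r. \<Sum>v\<in>F. c v * v $ r)"
    unfolding mem by auto
  show "a \<cdot>\<^sub>v x \<in> cone n G" if "0 \<le> a" for a
    unfolding mem using F that
    by (intro exI[of _ F] exI[of _ "\<lambda>v. a * c v"]) (auto intro!: eq_vecI simp: sum_distrib_left mult.assoc)
  fix y assume "y \<in> cone n G"
  then obtain F' c' where F': "finite F'" "F' \<subseteq> G" "\<forall>v\<in>F'. 0 \<le> c' v" "y = vec n (\<lambda>r. \<Sum>v\<in>F'. c' v * v $ r)"
    unfolding mem by auto
  define d where "d v = (if v \<in> F then c v else 0) + (if v \<in> F' then c' v else 0)" for v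
  have "(\<Sum>v\<in>F. c v * v $ r) + (\<Sum>v\<in>F'. c' v * v $ r) = (\<Sum>v\<in>F \<union> F'. d v * v $ r)" for r
  proof -
    have "(\<Sum>v\<in>F. c v * v $ r) = (\<Sum>v\<in>F \<union> F'. (if v \<in> F then c v else 0) * v $ r)"
      using F F' by (intro sum.mono_neutral_cong_left) auto
    moreover have "(\<Sum>v\<in>F'. c' v * v $ r) = (\<Sum>v\<in>F \<union> F'. (if v \<in> F' then c' v else 0) * v $ r)"
      using F F' by (intro sum.mono_neutral_cong_left) auto
    ultimately show ?thesis by (simp add: d_def distrib_right sum.distrib)
  qed
  then show "x + y \<in> cone n G"
    unfolding mem using F F' by (intro exI[of _ "F \<union> F'"] exI[of _ d]) (auto intro!: eq_vecI simp: d_def)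
qed

lemma cone_incl:
  assumes "G \<subseteq> carrier_vec n" and "g \<in> G"
  shows "g \<in> cone n G"
proof -
  have "finsum_vec TYPE(real) n (\<lambda>v. 1 \<cdot>\<^sub>v v) {g} = g"
    using assms by (subst finsum_vec_smult_eq) (auto intro!: eq_vecI)
  then show ?thesis unfolding cone_def using assms
    by (intro CollectI exI[of _ "{g}"] exI[of _ "\<lambda>_. 1"]) auto
qed

lemma cone_mono: "G \<subseteq> H \<Longrightarrow> cone n G \<subseteq> cone n H"
  unfolding cone_def by blast

text \<open>\<open>cone\<close> sums over a set of vectors, whereas a family such as the orbit may
  repeat vectors. The combinations over the index set form a convex cone containing the family, so
  no injectivity has to be arranged.\<close>

lemma cone_image_iff:
  assumes I: "finite I" and v: "\<And>i. i \<in> I \<Longrightarrow> v i \<in> carrier_vec n"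
  shows "x \<in> cone n (v ` I) \<longleftrightarrow> (\<exists>c. (\<forall>i\<in>I. 0 \<le> c i) \<and> x = vec n (\<lambda>r. \<Sum>i\<in>I. c i * v i $ r))"
proof
  let ?D = "{x. \<exists>c. (\<forall>i\<in>I. 0 \<le> c i) \<and> x = vec n (\<lambda>r. \<Sum>i\<in>I. c i * v i $ r)}"
  have "convex_cone n ?D" unfolding convex_cone_def
  proof (intro conjI ballI allI impI)
    show "0\<^sub>v n \<in> ?D" by (intro CollectI exI[of _ "\<lambda>_. 0"]) (auto intro!: eq_vecI)
    fix x assume "x \<in> ?D"
    then obtain c where c: "\<forall>i\<in>I. 0 \<le> c i" "x = vec n (\<lambda>r. \<Sum>i\<in>I. c i * v i $ r)" by blast
    show "a \<cdot>\<^sub>v x \<in> ?D" if "0 \<le> a" for a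
      using c that by (intro CollectI exI[of _ "\<lambda>i. a * c i"]) (auto intro!: eq_vecI simp: sum_distrib_left mult.assoc)
    fix y assume "y \<in> ?D"
    then obtain d where d: "\<forall>i\<in>I. 0 \<le> d i" "y = vec n (\<lambda>r. \<Sum>i\<in>I. d i * v i $ r)" by blast
    show "x + y \<in> ?D"
      using c d by (intro CollectI exI[of _ "\<lambda>i. c i + d i"]) (auto intro!: eq_vecI simp: sum.distrib distrib_right)
  qed auto
  moreover have "v i \<in> ?D" if i: "i \<in> I" for i
  proof -
    have "v i = vec n (\<lambda>r. \<Sum>j\<in>I. (if j = i then 1 else 0) * v j $ r)"
    proof (rule eq_vecI)
      fix r assume "r < dim_vec (vec n (\<lambda>r. \<Sum>j\<in>I. (if j = i then 1 else 0) * v j $ r))"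
      then have r: "r < n" by simp
      have "(\<Sum>j\<in>I. (if j = i then 1 else 0) * v j $ r) = (\<Sum>j\<in>I. if j = i then v j $ r else 0)"
        by (intro sum.cong) auto
      then show "v i $ r = vec n (\<lambda>r. \<Sum>j\<in>I. (if j = i then 1 else 0) * v j $ r) $ r" using r i I by simp
    qed (use v[OF i] in simp)
    then show ?thesis by (intro CollectI exI[of _ "\<lambda>j. if j = i then 1 else 0"]) simp
  qed
  ultimately have "cone n (v ` I) \<subseteq> ?D" by (intro cone_least) auto
  then show "x \<in> cone n (v ` I) \<Longrightarrow> \<exists>c. (\<forall>i\<in>I. 0 \<le> c i) \<and> x = vec n (\<lambda>r. \<Sum>i\<in>I. c i * v i $ r)" by blast
next
  assume "\<exists>c. (\<forall>i\<in>I. 0 \<le> c i) \<and> x = vec n (\<lambda>r. \<Sum>i\<in>I. c i * v i $ r)"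
  then obtain c where c: "\<forall>i\<in>I. 0 \<le> c i" "x = vec n (\<lambda>r. \<Sum>i\<in>I. c i * v i $ r)" by blast
  have sub: "v ` I \<subseteq> carrier_vec n" using v by auto
  show "x \<in> cone n (v ` I)" unfolding c(2)
    using c(1) sub by (intro convex_cone_sum[OF convex_cone_cone[OF sub] I] cone_incl) auto
qed

section \<open>Closure and convergence in coordinates\<close>

lemma euclidean_closure_iff:
  assumes X: "X \<subseteq> carrier_vec n"
  shows "x \<in> euclidean_closure n X \<longleftrightarrow>
    x \<in> carrier_vec n \<and> (\<exists>y. (\<forall>t. y t \<in> X) \<and> (\<forall>i<n. (\<lambda>t. y t $ i) \<longlonglongrightarrow> x $ i))"
proof (intro iffI conjI)
  have sq: "(x - y) \<bullet> (x - y) = (\<Sum>i<n. (x $ i - y $ i)\<^sup>2)" if "x \<in> carrier_vec n" "y \<in> carrier_vec n" for y x :: "real vec"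
    using that by (simp add: scalar_prod_def lessThan_atLeast0 power2_eq_square)
  assume x: "x \<in> euclidean_closure n X"
  then show xc: "x \<in> carrier_vec n" by (simp add: euclidean_closure_def)
  have "\<exists>y\<in>X. sqrt ((x - y) \<bullet> (x - y)) < inverse (real (Suc t))" for t
    using x by (simp add: euclidean_closure_def)
  then obtain y where y: "\<And>t. y t \<in> X" "\<And>t. sqrt ((x - y t) \<bullet> (x - y t)) < inverse (real (Suc t))" by metis
  have "(\<lambda>t. y t $ i) \<longlonglongrightarrow> x $ i" if i: "i < n" for i
  proof -
    have le: "\<bar>y t $ i - x $ i\<bar> \<le> inverse (real (Suc t))" for t
    proof -
      have "(x $ i - y t $ i)\<^sup>2 \<le> (\<Sum>i<n. (x $ i - y t $ i)\<^sup>2)"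
        using i by (intro member_le_sum) auto
      then have "sqrt ((x $ i - y t $ i)\<^sup>2) \<le> sqrt ((x - y t) \<bullet> (x - y t))"
        using sq[OF xc] X y(1) by (intro real_sqrt_le_mono) (auto simp: subset_iff)
      then show ?thesis using y(2)[of t] by simp
    qed
    have "(\<lambda>t. \<bar>y t $ i - x $ i\<bar>) \<longlonglongrightarrow> 0"
      by (rule tendsto_sandwich[OF _ _ tendsto_const LIMSEQ_inverse_real_of_nat])
        (auto intro!: always_eventually le simp del: of_nat_Suc)
    then show ?thesis by (rule LIM_zero_cancel[OF tendsto_rabs_zero_cancel])
  qed
  then show "\<exists>y. (\<forall>t. y t \<in> X) \<and> (\<forall>i<n. (\<lambda>t. y t $ i) \<longlonglongrightarrow> x $ i)" using y(1) by blast
next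
  have sq: "(x - y) \<bullet> (x - y) = (\<Sum>i<n. (x $ i - y $ i)\<^sup>2)" if "x \<in> carrier_vec n" "y \<in> carrier_vec n" for y x :: "real vec"
    using that by (simp add: scalar_prod_def lessThan_atLeast0 power2_eq_square)
  assume "x \<in> carrier_vec n \<and> (\<exists>y. (\<forall>t. y t \<in> X) \<and> (\<forall>i<n. (\<lambda>t. y t $ i) \<longlonglongrightarrow> x $ i))"
  then obtain y where x: "x \<in> carrier_vec n" and y: "\<And>t. y t \<in> X" "\<And>i. i < n \<Longrightarrow> (\<lambda>t. y t $ i) \<longlonglongrightarrow> x $ i" by blast
  have "(\<lambda>t. sqrt (\<Sum>i<n. (x $ i - y t $ i)\<^sup>2)) \<longlonglongrightarrow> sqrt (\<Sum>i<n. (x $ i - x $ i)\<^sup>2)"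
    using y(2) by (intro tendsto_real_sqrt tendsto_sum tendsto_power tendsto_diff tendsto_const) auto
  then have lim: "(\<lambda>t. sqrt ((x - y t) \<bullet> (x - y t))) \<longlonglongrightarrow> 0"
    using sq[OF x] X y(1) by (simp add: subset_iff)
  have "\<exists>z\<in>X. sqrt ((x - z) \<bullet> (x - z)) < e" if "0 < e" for e
    using order_tendstoD(2)[OF lim that] y(1) eventually_happens[of _ sequentially] by force
  then show "x \<in> euclidean_closure n X" using x by (simp add: euclidean_closure_def)
qed

lemma closure_incl: "X \<subseteq> carrier_vec n \<Longrightarrow> X \<subseteq> euclidean_closure n X"
  using euclidean_closure_iff[of X n] by fastforce

lemma closure_mono: "X \<subseteq> Y \<Longrightarrow> euclidean_closure n X \<subseteq> euclidean_closure n Y"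
  unfolding euclidean_closure_def by blast

lemma convex_cone_closure:
  assumes D: "convex_cone n D" shows "convex_cone n (euclidean_closure n D)"
proof -
  have X: "D \<subseteq> carrier_vec n" using D by (simp add: convex_cone_def)
  note iff = euclidean_closure_iff[OF X]
  show ?thesis unfolding convex_cone_def
  proof (intro conjI ballI allI impI)
    show "euclidean_closure n D \<subseteq> carrier_vec n" by (auto simp: euclidean_closure_def)
    show "0\<^sub>v n \<in> euclidean_closure n D" using closure_incl[OF X] D by (auto simp: convex_cone_def)
    fix x assume x: "x \<in> euclidean_closure n D"
    then obtain x' where x': "\<And>t. x' t \<in> D" "\<And>i. i < n \<Longrightarrow> (\<lambda>t. x' t $ i) \<longlonglongrightarrow> x $ i" and xc: "x \<in> carrier_vec n"
      unfolding iff by blast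
    have dx: "dim_vec (x' t) = n" for t by (rule carrier_vecD) (use x'(1) X in auto)
    have "(\<lambda>t. (c \<cdot>\<^sub>v x' t) $ i) \<longlonglongrightarrow> (c \<cdot>\<^sub>v x) $ i" if "i < n" for c i
      using tendsto_mult_left[OF x'(2)[OF that], of c] xc that by (simp add: dx)
    then show "c \<cdot>\<^sub>v x \<in> euclidean_closure n D" if "0 \<le> c" for c
      unfolding iff using x'(1) xc D that by (intro conjI exI[of _ "\<lambda>t. c \<cdot>\<^sub>v x' t"]) (auto simp: convex_cone_def)
    fix y assume y: "y \<in> euclidean_closure n D"
    then obtain y' where y': "\<And>t. y' t \<in> D" "\<And>i. i < n \<Longrightarrow> (\<lambda>t. y' t $ i) \<longlonglongrightarrow> y $ i" and yc: "y \<in> carrier_vec n"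
      unfolding iff by blast
    have dy: "dim_vec (y' t) = n" for t by (rule carrier_vecD) (use y'(1) X in auto)
    have "(\<lambda>t. (x' t + y' t) $ i) \<longlonglongrightarrow> (x + y) $ i" if "i < n" for i
      using tendsto_add[OF x'(2)[OF that] y'(2)[OF that]] xc yc that by (simp add: dy)
    then show "x + y \<in> euclidean_closure n D"
      unfolding iff using x'(1) y'(1) xc yc D by (intro conjI exI[of _ "\<lambda>t. x' t + y' t"]) (auto simp: convex_cone_def)
  qed
qed

lemma real_bounded_convergent_subseq:
  fixes a :: "nat \<Rightarrow> real"
  assumes "\<And>t. \<bar>a t\<bar> \<le> B"
  shows "\<exists>f l. strict_mono f \<and> (\<lambda>t. a (f t)) \<longlonglongrightarrow> l"
proof -
  obtain f :: "nat \<Rightarrow> nat" where f: "strict_mono f" "monoseq (\<lambda>t. a (f t))" using seq_monosub[of a] by auto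
  have "Bseq (\<lambda>t. a (f t))" by (rule BseqI'[of _ B]) (simp add: assms)
  then have "convergent (\<lambda>t. a (f t))" using f(2) by (rule Bseq_monoseq_convergent)
  then show ?thesis using f(1) by (auto simp: convergent_def)
qed

lemma bounded_family_convergent_subseq:
  fixes a :: "'i \<Rightarrow> nat \<Rightarrow> real"
  assumes "finite I" and "\<And>i. i \<in> I \<Longrightarrow> \<exists>B. \<forall>t. \<bar>a i t\<bar> \<le> B"
  shows "\<exists>f l. strict_mono f \<and> (\<forall>i\<in>I. (\<lambda>t. a i (f t)) \<longlonglongrightarrow> l i)"
  using assms
proof (induction I rule: finite_induct)
  case empty
  show ?case by (intro exI[of _ id]) (auto simp: strict_mono_def)
next
  case (insert j I)
  then have "\<exists>f l. strict_mono f \<and> (\<forall>i\<in>I. (\<lambda>t. a i (f t)) \<longlonglongrightarrow> l i)" by simp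
  then obtain f l where f: "strict_mono f" "\<And>i. i \<in> I \<Longrightarrow> (\<lambda>t. a i (f t)) \<longlonglongrightarrow> l i" by blast
  obtain B where "\<And>t. \<bar>a j t\<bar> \<le> B" using insert.prems[of j] by auto
  then obtain g l' where g: "strict_mono g" "(\<lambda>t. a j (f (g t))) \<longlonglongrightarrow> l'"
    using real_bounded_convergent_subseq[of "\<lambda>t. a j (f t)" B] by auto
  have "(\<lambda>t. a i (f (g t))) \<longlonglongrightarrow> l i" if "i \<in> I" for i
    using LIMSEQ_subseq_LIMSEQ[OF f(2)[OF that] g(1)] by (simp add: o_def)
  then show ?case
    using g insert.hyps strict_mono_o[OF f(1) g(1), unfolded o_def]
    by (intro exI[of _ "\<lambda>t. f (g t)"] exI[of _ "l(j := l')"]) auto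
qed

text \<open>The coefficients of a convergent sequence stay bounded because the generators are nonnegative.\<close>

lemma closed_cone_nonneg:
  assumes G: "finite G" "G \<subseteq> carrier_vec n" and nonneg: "\<And>g i. g \<in> G \<Longrightarrow> i < n \<Longrightarrow> 0 \<le> g $ i"
  shows "euclidean_closure n (cone n G) = cone n G"
proof
  have K: "cone n G \<subseteq> carrier_vec n" using convex_cone_cone[OF G(2)] by (simp add: convex_cone_def)
  show "cone n G \<subseteq> euclidean_closure n (cone n G)" by (rule closure_incl[OF K])
  have mem: "x \<in> cone n G \<longleftrightarrow> (\<exists>c. (\<forall>g\<in>G. 0 \<le> c g) \<and> x = vec n (\<lambda>r. \<Sum>g\<in>G. c g * g $ r))" for x
    using cone_image_iff[OF G(1), of "\<lambda>g. g" n x] G(2) by auto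
  show "euclidean_closure n (cone n G) \<subseteq> cone n G"
  proof
    fix x assume "x \<in> euclidean_closure n (cone n G)"
    then obtain y where x: "x \<in> carrier_vec n" and y: "\<And>t. y t \<in> cone n G" "\<And>i. i < n \<Longrightarrow> (\<lambda>t. y t $ i) \<longlonglongrightarrow> x $ i"
      unfolding euclidean_closure_iff[OF K] by blast
    have "\<forall>t. \<exists>c. (\<forall>g\<in>G. 0 \<le> c g) \<and> y t = vec n (\<lambda>r. \<Sum>g\<in>G. c g * g $ r)" using y(1) mem by blast
    then obtain c where "\<forall>t. (\<forall>g\<in>G. 0 \<le> c t g) \<and> y t = vec n (\<lambda>r. \<Sum>g\<in>G. c t g * g $ r)"
      by (rule choice[THEN exE])
    then have c: "\<And>t g. g \<in> G \<Longrightarrow> 0 \<le> c t g" "\<And>t. y t = vec n (\<lambda>r. \<Sum>g\<in>G. c t g * g $ r)" by blast+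
    \<comment> \<open>A zero generator may carry unbounded coefficients, so zero vectors are
      dropped. Every other generator has a positive coordinate, which bounds its coefficient by the
      convergent coordinate of y.\<close>
    define J where "J = {g\<in>G. \<exists>i<n. g $ i \<noteq> 0}"
    have J: "finite J" "J \<subseteq> G" using G by (auto simp: J_def)
    have yJ: "y t $ i = (\<Sum>g\<in>J. c t g * g $ i)" if "i < n" for t i
      unfolding c(2) using that G(1) by (simp, intro sum.mono_neutral_right) (auto simp: J_def)
    have "\<exists>B. \<forall>t. \<bar>c t g\<bar> \<le> B" if g: "g \<in> J" for g
    proof -
      obtain i where i: "i < n" "g $ i \<noteq> 0" using g by (auto simp: J_def)
      then have gi: "0 < g $ i" using nonneg[of g i] g J by force
      have "Bseq (\<lambda>t. y t $ i)" using y(2)[OF i(1)] by (intro convergent_imp_Bseq) (auto simp: convergent_def)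
      then obtain B where "\<forall>t. norm (y t $ i) \<le> B" unfolding Bseq_def by blast
      then have B: "\<bar>y t $ i\<bar> \<le> B" for t by simp
      have "\<bar>c t g\<bar> \<le> B / g $ i" for t
      proof -
        have "c t g * g $ i \<le> y t $ i"
          unfolding yJ[OF i(1)] using g J c(1) nonneg i by (intro member_le_sum) auto
        then have "c t g * g $ i \<le> B" using B[of t] by simp
        then show ?thesis using gi c(1)[of g t] g J by (auto simp: field_simps)
      qed
      then show ?thesis by blast
    qed
    then obtain f l where
      f: "strict_mono f" "\<And>g. g \<in> J \<Longrightarrow> (\<lambda>t. c (f t) g) \<longlonglongrightarrow> l g"
      using bounded_family_convergent_subseq[OF J(1), of "\<lambda>g t. c t g"] by blast
    have l0: "0 \<le> l g" if "g \<in> J" for g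
      using LIMSEQ_le_const[OF f(2)[OF that]] c(1) that J by blast
    have "x $ i = (\<Sum>g\<in>J. l g * g $ i)" if i: "i < n" for i
    proof (rule LIMSEQ_unique)
      show "(\<lambda>t. y (f t) $ i) \<longlonglongrightarrow> x $ i"
        using LIMSEQ_subseq_LIMSEQ[OF y(2)[OF i] f(1)] by (simp add: o_def)
      show "(\<lambda>t. y (f t) $ i) \<longlonglongrightarrow> (\<Sum>g\<in>J. l g * g $ i)"
        unfolding yJ[OF i] using f(2) by (intro tendsto_sum tendsto_mult_right)
    qed
    then have "x = vec n (\<lambda>r. \<Sum>g\<in>J. l g * g $ r)" using x by (intro eq_vecI) auto
    moreover have "vec n (\<lambda>r. \<Sum>g\<in>J. l g * g $ r) \<in> cone n G"
      using J l0 G(2) by (intro convex_cone_sum[OF convex_cone_cone[OF G(2)] J(1)] cone_incl) auto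
    ultimately show "x \<in> cone n G" by simp
  qed
qed

section \<open>Limits of the controllable cone\<close>

context controllable_system
begin

definition orbit :: "nat \<Rightarrow> real vec" where "orbit k = (A ^\<^sub>m k) *\<^sub>v b"
text \<open>The peripheral component of A^j b; \<open>Af_mult_b\<close> identifies it with the limit
  matrix applied to b.\<close>

definition limit_orbit :: "nat \<Rightarrow> real vec" where "limit_orbit j = S *\<^sub>v (((A1 ^\<^sub>m j) *\<^sub>v b1) @\<^sub>v 0\<^sub>v (n - h))"

lemma orbit_carrier [simp]: "orbit k \<in> carrier_vec n"
  using A b by (simp add: orbit_def)

lemma limit_orbit_carrier [simp]: "limit_orbit j \<in> carrier_vec n"
  unfolding limit_orbit_def using S A1 by (intro mult_mat_vec_carrier[of _ n n]) auto

lemma dim_orbit [simp]: "dim_vec (orbit k) = n" and dim_limit_orbit [simp]: "dim_vec (limit_orbit j) = n"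
  by (rule carrier_vecD, simp)+

lemma range_orbit_carrier: "range orbit \<subseteq> carrier_vec n"
  by auto

lemma orbit_split: "orbit k = S *\<^sub>v (((A1 ^\<^sub>m k) *\<^sub>v b1) @\<^sub>v ((A2 ^\<^sub>m k) *\<^sub>v b2))"
  unfolding orbit_def by (subst b_split) (rule pow_split, simp_all)

lemma A_orbit: "A *\<^sub>v orbit k = orbit (Suc k)"
  unfolding orbit_def by (rule pow_mat_mult_vec_Suc[OF A b, symmetric])

lemma A_limit_orbit: "A *\<^sub>v limit_orbit j = limit_orbit (Suc j)"
proof -
  have "(A1 ^\<^sub>m j) *\<^sub>v b1 \<in> carrier_vec h" using A1 by simp
  then have "A *\<^sub>v limit_orbit j = S *\<^sub>v ((A1 *\<^sub>v ((A1 ^\<^sub>m j) *\<^sub>v b1)) @\<^sub>v (A2 *\<^sub>v 0\<^sub>v (n - h)))"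
    unfolding limit_orbit_def by (intro A_S_append) auto
  then show ?thesis using A2 unfolding limit_orbit_def pow_mat_mult_vec_Suc[OF A1 b1_carrier] by simp
qed

lemma A1_pow_h:
  assumes x: "x \<in> carrier_vec h"
  shows "(A1 ^\<^sub>m h) *\<^sub>v x = rho A ^ h \<cdot>\<^sub>v x"
proof -
  have "char_poly A1 + smult (rho A ^ h) (monom 1 0) = monom 1 h" by (simp add: char_poly_A1 smult_monom monom_0)
  then have "(A1 ^\<^sub>m h) *\<^sub>v x = pact A1 (char_poly A1 + smult (rho A ^ h) (monom 1 0)) x"
    using x A1 by (simp add: pact_monom[OF A1 x])
  also have "\<dots> = rho A ^ h \<cdot>\<^sub>v x"
    using x A1 unfolding pact_add[OF A1] pact_smult[OF A1] pact_monom[OF A1 x] pact_char_poly[OF A1 x] by simp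
  finally show ?thesis .
qed

lemma A1_pow:
  assumes x: "x \<in> carrier_vec h"
  shows "(A1 ^\<^sub>m (k * h + j)) *\<^sub>v x = rho A ^ (k * h) \<cdot>\<^sub>v ((A1 ^\<^sub>m j) *\<^sub>v x)"
proof (induction k)
  case 0
  have "(A1 ^\<^sub>m j) *\<^sub>v x \<in> carrier_vec h" using x A1 by simp
  then show ?case by simp
next
  case (Suc k)
  have c: "(A1 ^\<^sub>m (k * h + j)) *\<^sub>v x \<in> carrier_vec h" using x A1 by simp
  have "(A1 ^\<^sub>m (Suc k * h + j)) *\<^sub>v x = (A1 ^\<^sub>m h) *\<^sub>v ((A1 ^\<^sub>m (k * h + j)) *\<^sub>v x)"
    unfolding pow_mat_mult_vec_add[OF A1 x, symmetric] by (simp add: add.assoc)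
  also have "\<dots> = rho A ^ h \<cdot>\<^sub>v (rho A ^ (k * h) \<cdot>\<^sub>v ((A1 ^\<^sub>m j) *\<^sub>v x))"
    unfolding A1_pow_h[OF c] unfolding Suc ..
  finally show ?case by (simp add: smult_smult_assoc power_add)
qed

text \<open>The eigenvalues of \<open>A2\<close> stay below some t < \<open>rho A\<close>, so the
  powers grow at most like t^(k h), which the division by \<open>rho A ^ (k * h)\<close> drives to
  0.\<close>

lemma A2_pow_lim:
  assumes y: "y \<in> carrier_vec (n - h)" and i: "i < n - h"
  shows "(\<lambda>k. ((A2 ^\<^sub>m (k * h + j)) *\<^sub>v y) $ i / rho A ^ (k * h)) \<longlonglongrightarrow> 0"
proof -
  define t0 where "t0 = Max (insert 0 (cmod ` spec A2))"
  have t0: "0 \<le> t0" "t0 < rho A" "\<And>z. z \<in> spec A2 \<Longrightarrow> cmod z \<le> t0"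
    using spec_A2_less rho_pos finite_spec[OF A2] by (auto simp: t0_def)
  define t where "t = (t0 + rho A) / 2"
  have t: "0 < t" "t < rho A" "\<And>z. z \<in> spec A2 \<Longrightarrow> cmod z < t" using t0 by (force simp: t_def)+
  obtain C where C: "\<And>k i. i < n - h \<Longrightarrow> \<bar>((A2 ^\<^sub>m k) *\<^sub>v y) $ i\<bar> \<le> C * t ^ k"
    using pow_mat_vec_bound[OF A2 y t(1,3)] by auto
  have bound: "\<bar>((A2 ^\<^sub>m (k * h + j)) *\<^sub>v y) $ i / rho A ^ (k * h)\<bar> \<le> C * t ^ j * ((t / rho A) ^ h) ^ k" for k
  proof -
    have "\<bar>((A2 ^\<^sub>m (k * h + j)) *\<^sub>v y) $ i / rho A ^ (k * h)\<bar> \<le> C * t ^ (k * h + j) / rho A ^ (k * h)"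
      using C[OF i, of "k * h + j"] rho_pos by (simp add: abs_div divide_right_mono)
    also have "\<dots> = C * t ^ j * ((t / rho A) ^ h) ^ k"
      by (simp add: power_add power_divide power_mult[symmetric] mult.commute)
    finally show ?thesis .
  qed
  have "(t / rho A) ^ h < 1" using t h_pos by (simp add: power_less_one_iff)
  then have "(\<lambda>k. ((t / rho A) ^ h) ^ k) \<longlonglongrightarrow> 0" using t rho_pos by (intro LIMSEQ_power_zero) auto
  from tendsto_mult_left[OF this, of "C * t ^ j"]
  have lim: "(\<lambda>k. C * t ^ j * ((t / rho A) ^ h) ^ k) \<longlonglongrightarrow> 0" by simp
  have "(\<lambda>k. \<bar>((A2 ^\<^sub>m (k * h + j)) *\<^sub>v y) $ i / rho A ^ (k * h)\<bar>) \<longlonglongrightarrow> 0"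
    by (rule tendsto_sandwich[OF _ _ tendsto_const lim]) (auto intro!: always_eventually bound[simplified])
  then show ?thesis by (rule tendsto_rabs_zero_cancel)
qed

text \<open>Along exponents k h + j the scaled first component is constant, because A1^h is the
  scalar rho^h; only the second component needs a limit.\<close>

lemma pow_lim:
  assumes x: "x \<in> carrier_vec h" and y: "y \<in> carrier_vec (n - h)" and i: "i < n"
  shows "(\<lambda>k. ((A ^\<^sub>m (k * h + j)) *\<^sub>v (S *\<^sub>v (x @\<^sub>v y))) $ i / rho A ^ (k * h))
    \<longlonglongrightarrow> (S *\<^sub>v (((A1 ^\<^sub>m j) *\<^sub>v x) @\<^sub>v 0\<^sub>v (n - h))) $ i"
proof -
  have c1: "(A1 ^\<^sub>m k) *\<^sub>v x \<in> carrier_vec h" and c2: "(A2 ^\<^sub>m k) *\<^sub>v y \<in> carrier_vec (n - h)" for k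
    using x y A1 A2 by auto
  have e: "((A ^\<^sub>m (k * h + j)) *\<^sub>v (S *\<^sub>v (x @\<^sub>v y))) $ i / rho A ^ (k * h)
      = (\<Sum>s<n. S $$ (i, s) * (if s < h then ((A1 ^\<^sub>m j) *\<^sub>v x) $ s
          else ((A2 ^\<^sub>m (k * h + j)) *\<^sub>v y) $ (s - h) / rho A ^ (k * h)))" for k
    unfolding pow_split[OF x y]
    unfolding index_mult_mat_vec_sum[OF S append_carrier[OF c1 c2] i] sum_divide_distrib
  proof (rule sum.cong)
    fix s assume "s \<in> {..<n}"
    then have s: "s < h + (n - h)" using h_le by simp
    show "S $$ (i, s) * (((A1 ^\<^sub>m (k * h + j)) *\<^sub>v x) @\<^sub>v ((A2 ^\<^sub>m (k * h + j)) *\<^sub>v y)) $ s / rho A ^ (k * h)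
      = S $$ (i, s) * (if s < h then ((A1 ^\<^sub>m j) *\<^sub>v x) $ s
          else ((A2 ^\<^sub>m (k * h + j)) *\<^sub>v y) $ (s - h) / rho A ^ (k * h))"
      using s rho_pos carrier_vecD[OF c1] carrier_vecD[OF c2]
      by (simp add: A1_pow[OF x] del: index_mult_mat_vec dim_mult_mat_vec)
  qed simp
  have f: "(S *\<^sub>v (((A1 ^\<^sub>m j) *\<^sub>v x) @\<^sub>v 0\<^sub>v (n - h))) $ i
      = (\<Sum>s<n. S $$ (i, s) * (if s < h then ((A1 ^\<^sub>m j) *\<^sub>v x) $ s else 0))"
    unfolding index_mult_mat_vec_sum[OF S append_carrier[OF c1 zero_carrier_vec] i]
  proof (rule sum.cong)
    fix s assume "s \<in> {..<n}"
    then show "S $$ (i, s) * (((A1 ^\<^sub>m j) *\<^sub>v x) @\<^sub>v 0\<^sub>v (n - h)) $ s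
        = S $$ (i, s) * (if s < h then ((A1 ^\<^sub>m j) *\<^sub>v x) $ s else 0)"
      using h_le carrier_vecD[OF c1] by (simp del: index_mult_mat_vec dim_mult_mat_vec)
  qed simp
  show ?thesis unfolding e f
  proof (intro tendsto_sum tendsto_mult_left)
    fix s assume "s \<in> {..<n}"
    then show "(\<lambda>k. if s < h then ((A1 ^\<^sub>m j) *\<^sub>v x) $ s else ((A2 ^\<^sub>m (k * h + j)) *\<^sub>v y) $ (s - h) / rho A ^ (k * h))
        \<longlonglongrightarrow> (if s < h then ((A1 ^\<^sub>m j) *\<^sub>v x) $ s else 0)"
      using A2_pow_lim[OF y, of "s - h" j] h_le by (cases "s < h") (auto simp del: index_mult_mat_vec)
  qed
qed

lemma split_exists:
  assumes z: "z \<in> carrier_vec n"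
  shows "\<exists>x\<in>carrier_vec h. \<exists>y\<in>carrier_vec (n - h). z = S *\<^sub>v (x @\<^sub>v y)"
proof -
  have "S' *\<^sub>v z \<in> carrier_vec (h + (n - h))" using S' z h_le by simp
  then have "vec_first (S' *\<^sub>v z) h @\<^sub>v vec_last (S' *\<^sub>v z) (n - h) = S' *\<^sub>v z" by simp
  moreover have "S *\<^sub>v (S' *\<^sub>v z) = z"
    using S S' z by (simp add: SS'_one flip: assoc_mult_mat_vec[of _ n n _ n])
  ultimately show ?thesis by (metis vec_first_carrier vec_last_carrier)
qed

lemma orbit_lim:
  assumes "i < n"
  shows "(\<lambda>k. orbit (k * h + j) $ i / rho A ^ (k * h)) \<longlonglongrightarrow> limit_orbit j $ i"
  using pow_lim[OF b1_carrier b2_carrier assms, of j] unfolding orbit_def limit_orbit_def b_split[symmetric] .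

text \<open>The entries of \<open>Af\<close> are values of \<open>lim\<close>, which say something
  only after convergence is known. Each column is therefore written as the image of a unit vector
  and treated by \<open>pow_lim\<close>; then the limit passes through the finite sum defining the
  product with b.\<close>

lemma Af_mult_b: "Af A h j *\<^sub>v b = limit_orbit j"
proof (rule eq_vecI)
  have Afc: "Af A h j \<in> carrier_mat n n" using A by (simp add: Af_def mat_lim_def)
  then show "dim_vec (Af A h j *\<^sub>v b) = dim_vec (limit_orbit j)" by simp
  fix i assume "i < dim_vec (limit_orbit j)"
  then have i: "i < n" by simp
  define X where "X k = (1 / rho A ^ (k * h)) \<cdot>\<^sub>m (A ^\<^sub>m (k * h)) * (A ^\<^sub>m j)" for k
  have Xc: "X k \<in> carrier_mat n n" for k
    unfolding X_def using A by (intro mult_carrier_mat[of _ n n]) auto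
  have X: "(X k *\<^sub>v z) $ i = ((A ^\<^sub>m (k * h + j)) *\<^sub>v z) $ i / rho A ^ (k * h)" if z: "z \<in> carrier_vec n" for k z
  proof -
    have Ajz: "(A ^\<^sub>m j) *\<^sub>v z \<in> carrier_vec n" using A z by simp
    have Mc: "(1 / rho A ^ (k * h)) \<cdot>\<^sub>m (A ^\<^sub>m (k * h)) \<in> carrier_mat n n"
      and Akc: "A ^\<^sub>m (k * h) \<in> carrier_mat n n" using A by auto
    have "X k *\<^sub>v z = ((1 / rho A ^ (k * h)) \<cdot>\<^sub>m (A ^\<^sub>m (k * h))) *\<^sub>v ((A ^\<^sub>m j) *\<^sub>v z)"
      unfolding X_def using A z by (intro assoc_mult_mat_vec[of _ n n _ n]) auto
    also have "\<dots> $ i = (\<Sum>l<n. (1 / rho A ^ (k * h)) * ((A ^\<^sub>m (k * h)) $$ (i, l) * ((A ^\<^sub>m j) *\<^sub>v z) $ l))"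
      unfolding index_mult_mat_vec_sum[OF Mc Ajz i] using A i by (intro sum.cong) auto
    also have "\<dots> = (1 / rho A ^ (k * h)) * ((A ^\<^sub>m (k * h)) *\<^sub>v ((A ^\<^sub>m j) *\<^sub>v z)) $ i"
      unfolding index_mult_mat_vec_sum[OF Akc Ajz i] sum_distrib_left ..
    also have "(A ^\<^sub>m (k * h)) *\<^sub>v ((A ^\<^sub>m j) *\<^sub>v z) = (A ^\<^sub>m (k * h + j)) *\<^sub>v z"
      by (rule pow_mat_mult_vec_add[OF A z, symmetric])
    finally show ?thesis by simp
  qed
  have "\<exists>L. (\<lambda>k. X k $$ (i, c)) \<longlonglongrightarrow> L" if c: "c < n" for c
  proof -
    obtain x y where xy: "x \<in> carrier_vec h" "y \<in> carrier_vec (n - h)" "unit_vec n c = S *\<^sub>v (x @\<^sub>v y)"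
      using split_exists[of "unit_vec n c"] by auto
    have "X k $$ (i, c) = (X k *\<^sub>v unit_vec n c) $ i" for k
      using Xc[of k] i c by (simp add: scalar_prod_right_unit)
    then have "X k $$ (i, c) = ((A ^\<^sub>m (k * h + j)) *\<^sub>v (S *\<^sub>v (x @\<^sub>v y))) $ i / rho A ^ (k * h)" for k
      using X[OF unit_vec_carrier[of n c], of k] unfolding xy(3)[symmetric] by simp
    then show ?thesis using pow_lim[OF xy(1,2) i, of j] by (simp only:) blast
  qed
  then have "(\<lambda>k. X k $$ (i, c)) \<longlonglongrightarrow> Af A h j $$ (i, c)" if "c < n" for c
    using A i that unfolding Af_def mat_lim_def X_def[symmetric]
    by (simp add: convergent_LIMSEQ_iff[symmetric] convergent_def)
  then have "(\<lambda>k. \<Sum>c<n. X k $$ (i, c) * b $ c) \<longlonglongrightarrow> (\<Sum>c<n. Af A h j $$ (i, c) * b $ c)"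
    by (intro tendsto_sum tendsto_mult_right) auto
  then have "(\<lambda>k. (X k *\<^sub>v b) $ i) \<longlonglongrightarrow> (Af A h j *\<^sub>v b) $ i"
    by (simp only: index_mult_mat_vec_sum[OF Xc b i] index_mult_mat_vec_sum[OF Afc b i])
  then have "(\<lambda>k. orbit (k * h + j) $ i / rho A ^ (k * h)) \<longlonglongrightarrow> (Af A h j *\<^sub>v b) $ i"
    unfolding X[OF b] orbit_def .
  then show "(Af A h j *\<^sub>v b) $ i = limit_orbit j $ i" using orbit_lim[OF i] by (rule LIMSEQ_unique)
qed

lemma limit_orbit_periodic: "limit_orbit (j + h) = rho A ^ h \<cdot>\<^sub>v limit_orbit j"
proof -
  have c: "(A1 ^\<^sub>m j) *\<^sub>v b1 \<in> carrier_vec h" using A1 by simp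
  have "(A1 ^\<^sub>m (j + h)) *\<^sub>v b1 = rho A ^ h \<cdot>\<^sub>v ((A1 ^\<^sub>m j) *\<^sub>v b1)"
    using A1_pow[OF b1_carrier, of 1 j] by (simp add: add.commute)
  moreover have "(a \<cdot>\<^sub>v x) @\<^sub>v 0\<^sub>v (n - h) = a \<cdot>\<^sub>v (x @\<^sub>v 0\<^sub>v (n - h))" if "x \<in> carrier_vec h" for a and x :: "real vec"
    using that by (intro eq_vecI) auto
  ultimately show ?thesis unfolding limit_orbit_def using c S by (simp add: mult_mat_vec[OF S])
qed

lemma orbit_nonneg: "i < n \<Longrightarrow> 0 \<le> orbit k $ i"
proof (induction k arbitrary: i)
  case 0
  then show ?case using b b_nn A by (simp add: orbit_def)
next
  case (Suc k)
  show ?case unfolding A_orbit[symmetric] index_mult_mat_vec_sum[OF A orbit_carrier Suc.prems]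
    using Suc nonneg_mat_index[OF nn A] by (intro sum_nonneg mult_nonneg_nonneg) auto
qed

lemma limit_orbit_nonneg: "i < n \<Longrightarrow> 0 \<le> limit_orbit j $ i"
  using orbit_nonneg rho_pos by (intro LIMSEQ_le_const[OF orbit_lim]) auto

text \<open>A power of A1 is a positive multiple of the identity, so a vanishing limit forces
  \<open>b1\<close> = 0. Then the characteristic polynomial of \<open>A2\<close>, of degree n - h <
  n, annihilates b, against controllability.\<close>

lemma limit_orbit_nonzero: "\<exists>i<n. 0 < limit_orbit j $ i"
proof (rule ccontr)
  assume "\<not> ?thesis"
  then have "limit_orbit j $ i = 0" if "i < n" for i using limit_orbit_nonneg[OF that, of j] that by force
  then have "limit_orbit j = 0\<^sub>v n" by (intro eq_vecI) auto
  then have "((A1 ^\<^sub>m j) *\<^sub>v b1) @\<^sub>v 0\<^sub>v (n - h) = 0\<^sub>v n"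
    using A1 unfolding limit_orbit_def by (subst (asm) S_zero_iff) auto
  moreover have "0\<^sub>v h @\<^sub>v 0\<^sub>v (n - h) = (0\<^sub>v n :: real vec)" using h_le by (intro eq_vecI) auto
  ultimately have "((A1 ^\<^sub>m j) *\<^sub>v b1) @\<^sub>v 0\<^sub>v (n - h) = 0\<^sub>v h @\<^sub>v 0\<^sub>v (n - h)" by (simp only:)
  then have "(A1 ^\<^sub>m j) *\<^sub>v b1 = 0\<^sub>v h"
    using append_vec_eq[of "(A1 ^\<^sub>m j) *\<^sub>v b1" h "0\<^sub>v h"] A1 by simp
  then have "pact A1 (monom 1 j) b1 = 0\<^sub>v h"
    by (simp add: pact_monom[OF A1 b1_carrier])
  \<comment> \<open>The exponent is raised from j to the multiple j h, where the power of A1 is a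
    scalar.\<close>
  then have z: "pact A1 (monom 1 (j * h)) b1 = 0\<^sub>v h"
  proof -
    assume "pact A1 (monom 1 j) b1 = 0\<^sub>v h"
    moreover have "monom (1::real) (j * h) = monom 1 (j * h - j) * monom 1 j"
      using h_pos by (simp add: mult_monom)
    moreover have "pact A1 q (0\<^sub>v h) = 0\<^sub>v h" for q
      using pact_mult[OF A1 zero_carrier_vec, of q 0] A1 by simp
    ultimately show ?thesis by (simp add: pact_mult[OF A1 b1_carrier])
  qed
  have "rho A ^ (j * h) \<cdot>\<^sub>v b1 = 0\<^sub>v h"
    using z A1_pow[OF b1_carrier, of j 0] A1
    by (simp add: pact_monom[OF A1 b1_carrier])
  then have "b1 = 0\<^sub>v h"
  proof (intro eq_vecI)
    fix i assume e: "rho A ^ (j * h) \<cdot>\<^sub>v b1 = 0\<^sub>v h" and "i < dim_vec (0\<^sub>v h :: real vec)"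
    then have i: "i < h" by simp
    have "rho A ^ (j * h) * b1 $ i = 0"
      using arg_cong[OF e, of "\<lambda>x. x $ i"] i carrier_vecD[OF b1_carrier] by simp
    then show "b1 $ i = 0\<^sub>v h $ i" using rho_pos i by simp
  qed simp
  moreover have "pact A1 q (0\<^sub>v h) = 0\<^sub>v h" for q
    using pact_mult[OF A1 zero_carrier_vec, of q 0] A1 by simp
  ultimately have "pact A (char_poly A2) b = 0\<^sub>v n"
    unfolding pact_split pact_char_poly[OF A2 b2_carrier]
    using S \<open>0\<^sub>v h @\<^sub>v 0\<^sub>v (n - h) = (0\<^sub>v n :: real vec)\<close> by simp
  moreover have "degree (char_poly A2) < n"
    using degree_monic_char_poly[OF A2] h_pos h_le by simp
  ultimately show False using controllable char_poly_neq_0[OF A2] by blast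
qed

section \<open>The controllable sets as cones over the orbit\<close>

lemma Conset_fin_eq: "Conset_fin A b = cone n (range orbit)"
proof
  have r: "range orbit \<subseteq> carrier_vec n" by auto
  note cc = convex_cone_cone[OF r]
  have dA: "dim_row A = n" using A by simp
  show "Conset_fin A b \<subseteq> cone n (range orbit)"
  proof
    fix x assume "x \<in> Conset_fin A b"
    then obtain k and u :: "nat \<Rightarrow> real" where u: "\<forall>j<k. 0 \<le> u j"
      "x = finsum_vec TYPE(real) n (\<lambda>i. u (k - i) \<cdot>\<^sub>v orbit (i - 1)) {1..k}"
      unfolding Conset_fin_def Conset_def dA orbit_def by auto
    show "x \<in> cone n (range orbit)" unfolding u(2)
      using u(1) r by (intro convex_cone_finsum[OF cc] cone_incl) auto
  qed
  show "cone n (range orbit) \<subseteq> Conset_fin A b"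
  proof
    fix x assume "x \<in> cone n (range orbit)"
    then obtain F where F: "finite F" "F \<subseteq> range orbit" "x \<in> cone n F" unfolding cone_def by blast
    then obtain I where I: "finite I" "F = orbit ` I" by (meson finite_subset_image)
    define k where "k = Suc (Max (insert 0 I))"
    have "I \<subseteq> {..<k}"
    proof
      fix i assume "i \<in> I"
      then have "i \<le> Max (insert 0 I)" using I(1) by (intro Max_ge) auto
      then show "i \<in> {..<k}" by (simp add: k_def)
    qed
    then have "x \<in> cone n (orbit ` {..<k})" using F(3) cone_mono[of "orbit ` I" "orbit ` {..<k}" n] I(2) by blast
    then obtain c where c: "\<forall>i\<in>{..<k}. 0 \<le> c i" "x = vec n (\<lambda>r. \<Sum>i<k. c i * orbit i $ r)"
      by (subst (asm) cone_image_iff) auto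
    have "x = finsum_vec TYPE(real) n (\<lambda>i. c (i - 1) \<cdot>\<^sub>v orbit (i - 1)) {1..k}"
      unfolding c(2) by (subst finsum_vec_smult_eq) (auto intro!: eq_vecI simp: sum.atLeast1_atMost_eq)
    \<comment> \<open>Time reversal: the coefficient of A^(i-1) b is the input at time k - i, so the
      inputs are the coefficients read backwards.\<close>
    also have "\<dots> = finsum_vec TYPE(real) n (\<lambda>i. (\<lambda>j. c (k - 1 - j)) (k - i) \<cdot>\<^sub>v orbit (i - 1)) {1..k}"
      by (subst (1 2) finsum_vec_smult_eq) (auto intro!: eq_vecI sum.cong simp: diff_diff_eq)
    finally have "x \<in> Conset k A b"
      unfolding Conset_def dA orbit_def using c(1) by (intro CollectI exI[of _ "\<lambda>j. c (k - 1 - j)"]) auto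
    then show "x \<in> Conset_fin A b" unfolding Conset_fin_def by (auto simp: k_def)
  qed
qed

lemma Conset_inf_eq: "Conset_inf A b = euclidean_closure n (cone n (range orbit))"
  using A by (simp add: Conset_inf_def Conset_fin_eq)

lemma convex_cone_range_orbit: "convex_cone n (cone n (range orbit))"
  by (rule convex_cone_cone) auto

lemma convex_cone_Conset_inf: "convex_cone n (Conset_inf A b)"
  unfolding Conset_inf_eq by (rule convex_cone_closure[OF convex_cone_range_orbit])

lemma cone_range_orbit_carrier: "cone n (range orbit) \<subseteq> carrier_vec n"
  using convex_cone_range_orbit by (simp add: convex_cone_def)

lemma orbit_in_Conset_inf: "orbit k \<in> Conset_inf A b"
  unfolding Conset_inf_eq using closure_incl[OF cone_range_orbit_carrier] cone_incl[OF range_orbit_carrier, of "orbit k"] by auto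

lemma limit_orbit_in_Conset_inf: "limit_orbit j \<in> Conset_inf A b"
  unfolding Conset_inf_eq euclidean_closure_iff[OF cone_range_orbit_carrier]
proof (intro conjI exI[of _ "\<lambda>k. (1 / rho A ^ (k * h)) \<cdot>\<^sub>v orbit (k * h + j)"] allI impI)
  show "(1 / rho A ^ (k * h)) \<cdot>\<^sub>v orbit (k * h + j) \<in> cone n (range orbit)" for k
    using convex_cone_range_orbit cone_incl[OF range_orbit_carrier, of "orbit (k * h + j)"] rho_pos by (auto simp: convex_cone_def)
  show "(\<lambda>k. ((1 / rho A ^ (k * h)) \<cdot>\<^sub>v orbit (k * h + j)) $ i) \<longlonglongrightarrow> limit_orbit j $ i" if "i < n" for i
    using orbit_lim[OF that, of j] that carrier_vecD[OF orbit_carrier] by simp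
qed simp

text \<open>Gives nonnegativity of the generators when the set is polyhedral; the boundedness
  arguments for their coefficients rest on it.\<close>

lemma Conset_inf_nonneg:
  assumes "x \<in> Conset_inf A b" and i: "i < n"
  shows "0 \<le> x $ i"
proof -
  let ?D = "{x \<in> carrier_vec n. \<forall>i<n. 0 \<le> x $ i}"
  have "convex_cone n ?D" by (auto simp: convex_cone_def carrier_vecD)
  then have D: "cone n (range orbit) \<subseteq> ?D" using orbit_nonneg by (intro cone_least) auto
  obtain y where y: "\<And>t. y t \<in> cone n (range orbit)" "(\<lambda>t. y t $ i) \<longlonglongrightarrow> x $ i"
    using assms unfolding Conset_inf_eq euclidean_closure_iff[OF cone_range_orbit_carrier] by blast
  have "0 \<le> y t $ i" for t using D y(1)[of t] i by auto
  then show ?thesis by (intro LIMSEQ_le_const[OF y(2)]) auto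
qed

lemma recursion_imp_cone:
  assumes F: "recursion_poly F" "0 < degree F" and d: "0 < d" "h dvd d" and pos: "0 \<le> poly F (rho A ^ d)"
    and dvd: "char_poly A2 dvd pcompose F (monom 1 d)"
  shows "\<exists>k\<ge>1. Conset_inf A b = cone n ({orbit i | i. i < k} \<union> {limit_orbit j | j. j < h})"
proof -
  define f where "f = pcompose F (monom 1 d)"
  define m where "m = degree f"
  define c where "c = poly F (rho A ^ d)"
  have rf: "recursion_poly f" unfolding f_def by (rule recursion_poly_pcompose_monom[OF F(1) d(1)])
  have m: "1 \<le> m" using F(2) d(1) unfolding m_def f_def degree_pcompose_monom[OF d(1)] by simp
  \<comment> \<open>A chain of divisibilities: x^h - rho^h divides x^d - rho^d because h divides d,
    and this divides F(x^d) - F(rho^d). So f acts on the first component of b as the scalar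
    c.\<close>
  have "char_poly A1 dvd f - [:c:]"
  proof -
    obtain k where k: "d = h * k" using d(2) by blast
    have "char_poly A1 dvd monom 1 d - [:rho A ^ d:]"
    proof -
      have "monom 1 d = (monom (1::real) h) ^ k" "[:rho A ^ d:] = [:rho A ^ h:] ^ k"
        unfolding k by (simp_all add: monom_power poly_const_pow power_mult)
      then show ?thesis unfolding char_poly_A1 by (simp add: power_diff_sumr2)
    qed
    also have "monom 1 d - [:rho A ^ d:] = pcompose [:- (rho A ^ d), 1:] (monom 1 d)"
      by (simp add: pcompose_pCons)
    also have "\<dots> dvd pcompose (F - [:c:]) (monom 1 d)"
    proof -
      have "[:- (rho A ^ d), 1:] dvd F - [:c:]" by (subst poly_eq_0_iff_dvd[symmetric]) (simp add: c_def)
      then obtain u where "F - [:c:] = [:- (rho A ^ d), 1:] * u" by blast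
      then show ?thesis by (simp only: pcompose_mult dvd_triv_left)
    qed
    also have "\<dots> = f - [:c:]" by (simp add: f_def pcompose_diff)
    finally show ?thesis .
  qed
  then have "pact A1 (f - [:c:] + smult c 1) b1 = c \<cdot>\<^sub>v b1"
    unfolding pact_add[OF A1] pact_smult[OF A1] by (simp add: pact_dvd_zero[OF A1] pact_1[OF A1])
  then have p1: "pact A1 f b1 = c \<cdot>\<^sub>v b1" by simp
  have p2: "pact A2 f b2 = 0\<^sub>v (n - h)" using dvd unfolding f_def by (rule pact_dvd_zero[OF A2 b2_carrier])
  have pf: "pact A f b = c \<cdot>\<^sub>v limit_orbit 0"
  proof -
    have "(c \<cdot>\<^sub>v b1) @\<^sub>v 0\<^sub>v (n - h) = c \<cdot>\<^sub>v (b1 @\<^sub>v 0\<^sub>v (n - h))" by (intro eq_vecI) (auto simp: carrier_vecD[OF b1_carrier])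
    then show ?thesis unfolding pact_split p1 p2 limit_orbit_def using S A1 by (simp add: mult_mat_vec[OF S])
  qed
  define G where "G = {orbit i | i. i < m} \<union> {limit_orbit j | j. j < h}"
  have Gc: "G \<subseteq> carrier_vec n" by (auto simp: G_def)
  have Gf: "finite G" by (simp add: G_def)
  have K: "convex_cone n (cone n G)" by (rule convex_cone_cone[OF Gc])
  have vG: "orbit i \<in> cone n G" if "i < m" for i using that by (intro cone_incl[OF Gc]) (auto simp: G_def)
  have wG: "limit_orbit j \<in> cone n G" if "j < h" for j using that by (intro cone_incl[OF Gc]) (auto simp: G_def)
  have vm: "orbit m \<in> cone n G"
  proof -
    have "orbit m = vec n (\<lambda>r. \<Sum>i<m. - coeff f i * orbit i $ r) + c \<cdot>\<^sub>v limit_orbit 0"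
    proof (rule eq_vecI)
      fix r assume "r < dim_vec (vec n (\<lambda>r. \<Sum>i<m. - coeff f i * orbit i $ r) + c \<cdot>\<^sub>v limit_orbit 0)"
      then have r: "r < n" by simp
      have "(\<Sum>k\<le>m. coeff f k * orbit k $ r) = (c \<cdot>\<^sub>v limit_orbit 0) $ r"
        using index_pact[OF A r, of f m b] unfolding pf orbit_def m_def by simp
      then have "orbit m $ r = (\<Sum>i<m. - coeff f i * orbit i $ r) + (c \<cdot>\<^sub>v limit_orbit 0) $ r"
        using rf by (simp add: lessThan_Suc_atMost[symmetric] recursion_poly_def m_def sum_negf)
      then show "orbit m $ r = (vec n (\<lambda>r. \<Sum>i<m. - coeff f i * orbit i $ r) + c \<cdot>\<^sub>v limit_orbit 0) $ r"
        using r carrier_vecD[OF limit_orbit_carrier] by simp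
    qed (use dim_orbit in simp)
    moreover have "vec n (\<lambda>r. \<Sum>i<m. - coeff f i * orbit i $ r) \<in> cone n G"
      using vG rf by (intro convex_cone_sum[OF K]) (auto simp: recursion_poly_def m_def)
    moreover have "c \<cdot>\<^sub>v limit_orbit 0 \<in> cone n G" using wG[OF h_pos] K pos by (simp add: convex_cone_def c_def)
    ultimately show ?thesis using K by (simp add: convex_cone_def)
  qed
  \<comment> \<open>Invariance of the cone under A has to be checked only on generators. The shift
    leaves the list at two places: orbit m, handled by the recursion, and the h-th limit vector,
    which is a positive multiple of the zeroth.\<close>
  let ?K' = "{x \<in> cone n G. A *\<^sub>v x \<in> cone n G}"
  have sub: "cone n G \<subseteq> carrier_vec n" using K by (simp add: convex_cone_def)
  have "convex_cone n ?K'"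
    unfolding convex_cone_def
  proof (intro conjI ballI allI impI)
    show "?K' \<subseteq> carrier_vec n" using sub by auto
    show "0\<^sub>v n \<in> ?K'" using K A by (simp add: convex_cone_def)
    fix x assume x: "x \<in> ?K'"
    then have xc: "x \<in> carrier_vec n" using sub by auto
    show "a \<cdot>\<^sub>v x \<in> ?K'" if "0 \<le> a" for a
      using x that K by (simp add: convex_cone_def mult_mat_vec[OF A xc])
    fix y assume y: "y \<in> ?K'"
    then have yc: "y \<in> carrier_vec n" using sub by auto
    show "x + y \<in> ?K'" using x y K by (simp add: convex_cone_def mult_add_distrib_mat_vec[OF A xc yc])
  qed
  moreover have "G \<subseteq> ?K'"
  proof
    fix g assume g: "g \<in> G"
    then consider i where "g = orbit i" "i < m" | j where "g = limit_orbit j" "j < h" by (auto simp: G_def)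
    then have "A *\<^sub>v g \<in> cone n G"
    proof cases
      case 1
      then have "Suc i < m \<or> Suc i = m" by linarith
      then show ?thesis using vG[of "Suc i"] vm 1 by (auto simp: A_orbit)
    next
      case 2
      show ?thesis
      proof (cases "Suc j < h")
        case True
        then show ?thesis using 2 wG by (simp add: A_limit_orbit)
      next
        case False
        then have "Suc j = 0 + h" using 2 by simp
        then show ?thesis using 2 wG[OF h_pos] K rho_pos by (simp add: A_limit_orbit limit_orbit_periodic[of 0, simplified] convex_cone_def)
      qed
    qed
    then show "g \<in> ?K'" using cone_incl[OF Gc g] by simp
  qed
  ultimately have inv: "cone n G \<subseteq> ?K'" by (rule cone_least)
  have "orbit k \<in> cone n G" for k
  proof (induction k)
    case (Suc k)
    from subsetD[OF inv this] show ?case by (simp add: A_orbit)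
  next
    case 0
    show ?case using m by (intro vG) simp
  qed
  then have "cone n (range orbit) \<subseteq> cone n G" by (intro cone_least[OF K]) auto
  then have "Conset_inf A b \<subseteq> euclidean_closure n (cone n G)"
    unfolding Conset_inf_eq by (rule closure_mono)
  also have "\<dots> = cone n G"
    using orbit_nonneg limit_orbit_nonneg by (intro closed_cone_nonneg[OF Gf Gc]) (auto simp: G_def)
  finally have "Conset_inf A b \<subseteq> cone n G" .
  moreover have "cone n G \<subseteq> Conset_inf A b"
    using orbit_in_Conset_inf limit_orbit_in_Conset_inf by (intro cone_least[OF convex_cone_Conset_inf]) (auto simp: G_def)
  ultimately show ?thesis using m unfolding G_def by blast
qed

end

section \<open>Extreme rays of a polyhedral controllable set\<close>

lemma cone_split:
  assumes G: "G \<subseteq> carrier_vec n" and g: "g \<in> G" and x: "x \<in> cone n G"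
  shows "\<exists>a\<ge>0. \<exists>s\<in>cone n (G - {g}). x = a \<cdot>\<^sub>v g + s"
proof -
  define D where "D = {x. \<exists>a\<ge>0. \<exists>s\<in>cone n (G - {g}). x = a \<cdot>\<^sub>v g + s}"
  have G0: "G - {g} \<subseteq> carrier_vec n" using G by auto
  note cc = convex_cone_cone[OF G0]
  have gc: "g \<in> carrier_vec n" using G g by auto
  have sc: "cone n (G - {g}) \<subseteq> carrier_vec n" using cc by (simp add: convex_cone_def)
  have "convex_cone n D"
    unfolding convex_cone_def
  proof (intro conjI ballI allI impI)
    show "D \<subseteq> carrier_vec n" using gc sc by (auto simp: D_def)
    have "0\<^sub>v n = 0 \<cdot>\<^sub>v g + 0\<^sub>v n" using gc by (intro eq_vecI) auto
    then show "0\<^sub>v n \<in> D" unfolding D_def using cc by (auto simp: convex_cone_def)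
    fix x assume "x \<in> D"
    then obtain a s where a: "0 \<le> a" "s \<in> cone n (G - {g})" "x = a \<cdot>\<^sub>v g + s" unfolding D_def by blast
    have s: "s \<in> carrier_vec n" using a(2) sc by auto
    show "c \<cdot>\<^sub>v x \<in> D" if c: "0 \<le> c" for c
    proof -
      have "c \<cdot>\<^sub>v x = (c * a) \<cdot>\<^sub>v g + c \<cdot>\<^sub>v s" using s gc unfolding a(3) by (intro eq_vecI) (auto simp: algebra_simps)
      moreover have "c \<cdot>\<^sub>v s \<in> cone n (G - {g})" using cc a(2) c by (simp add: convex_cone_def)
      ultimately show ?thesis unfolding D_def using a(1) c mult_nonneg_nonneg by blast
    qed
    fix y assume "y \<in> D"
    then obtain a' s' where a': "0 \<le> a'" "s' \<in> cone n (G - {g})" "y = a' \<cdot>\<^sub>v g + s'" unfolding D_def by blast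
    have s': "s' \<in> carrier_vec n" using a'(2) sc by auto
    have "x + y = (a + a') \<cdot>\<^sub>v g + (s + s')" using s s' gc unfolding a(3) a'(3)
      by (intro eq_vecI) (auto simp: algebra_simps)
    moreover have "s + s' \<in> cone n (G - {g})" using cc a(2) a'(2) by (simp add: convex_cone_def)
    ultimately show "x + y \<in> D" unfolding D_def using a(1) a'(1) add_nonneg_nonneg by blast
  qed
  moreover have "G \<subseteq> D"
  proof
    fix x assume x: "x \<in> G"
    then have xc: "x \<in> carrier_vec n" using G by auto
    show "x \<in> D"
    proof (cases "x = g")
      case True
      have "x = 1 \<cdot>\<^sub>v g + 0\<^sub>v n" using xc True by (intro eq_vecI) auto
      moreover have "0\<^sub>v n \<in> cone n (G - {g})" using cc by (simp add: convex_cone_def)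
      ultimately show ?thesis unfolding D_def using zero_le_one by blast
    next
      case False
      then have "x \<in> cone n (G - {g})" using x by (intro cone_incl[OF G0]) auto
      moreover have "x = 0 \<cdot>\<^sub>v g + x" using gc xc by (intro eq_vecI) auto
      ultimately show ?thesis unfolding D_def by blast
    qed
  qed
  ultimately show ?thesis using cone_least[of n D G] x unfolding D_def by blast
qed

text \<open>Otherwise every \<open>a g + s\<close> in the cone of the \<open>v k\<close> has \<open>\<epsilon> a\<close> at most the entry sum of \<open>s\<close>. Writing
  \<open>g\<close> as a limit of such vectors, irredundancy forces \<open>a \<longlonglongrightarrow> 1\<close> and hence \<open>s \<longlonglongrightarrow> 0\<close>, a contradiction.\<close>

lemma irredundant_generator_approx:
  fixes r :: "nat \<Rightarrow> real vec"
  assumes G: "finite G" "G \<subseteq> carrier_vec n" and nonneg: "\<And>x i. x \<in> G \<Longrightarrow> i < n \<Longrightarrow> 0 \<le> x $ i"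
    and g: "g \<in> G" "g \<notin> cone n (G - {g})"
    and closure: "g \<in> euclidean_closure n (cone n (range v))"
    and split: "\<And>k. v k = \<alpha> k \<cdot>\<^sub>v g + r k" "\<And>k. 0 \<le> \<alpha> k" "\<And>k. r k \<in> cone n (G - {g})"
    and \<epsilon>: "0 < \<epsilon>"
  shows "\<exists>k. 0 < \<alpha> k \<and> (\<Sum>i<n. r k $ i) \<le> \<epsilon> * \<alpha> k"
proof (rule ccontr)
  assume neg: "\<not> ?thesis"
  define G0 where "G0 = G - {g}"
  have G0: "G0 \<subseteq> carrier_vec n" "finite G0" using G by (auto simp: G0_def)
  note cc = convex_cone_cone[OF G0(1)]
  have sub: "cone n G0 \<subseteq> carrier_vec n" using cc by (simp add: convex_cone_def)
  have gc: "g \<in> carrier_vec n" using G g by auto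
  have s0: "0 \<le> s $ i" if "s \<in> cone n G0" "i < n" for s i
  proof -
    let ?D = "{x \<in> carrier_vec n. \<forall>i<n. 0 \<le> x $ i}"
    have "convex_cone n ?D" by (auto simp: convex_cone_def carrier_vecD)
    then have "cone n G0 \<subseteq> ?D" using nonneg G by (intro cone_least) (auto simp: G0_def)
    then show ?thesis using that by auto
  qed
  have "\<exists>i<n. g $ i \<noteq> 0"
  proof (rule ccontr)
    assume "\<not> ?thesis"
    then have "g = 0\<^sub>v n" using gc by (intro eq_vecI) auto
    then show False using g(2) cc by (auto simp: convex_cone_def G0_def)
  qed
  then obtain i0 where i0: "i0 < n" "0 < g $ i0" using nonneg[OF g(1)] by force
  \<comment> \<open>The vectors satisfying the negated claim. They form a convex cone containing
    every v k, and thus the whole cone generated by them.\<close>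
  define D where "D = {x. \<exists>a\<ge>0. \<exists>s\<in>cone n G0. x = a \<cdot>\<^sub>v g + s \<and> \<epsilon> * a \<le> (\<Sum>i<n. s $ i)}"
  have "convex_cone n D"
    unfolding convex_cone_def
  proof (intro conjI ballI allI impI)
    show "D \<subseteq> carrier_vec n" using gc sub by (auto simp: D_def)
    have "0\<^sub>v n = 0 \<cdot>\<^sub>v g + 0\<^sub>v n" using gc by (intro eq_vecI) auto
    moreover have "0\<^sub>v n \<in> cone n G0" using cc by (simp add: convex_cone_def)
    moreover have "\<epsilon> * 0 \<le> (\<Sum>i<n. (0\<^sub>v n :: real vec) $ i)" by simp
    ultimately show "0\<^sub>v n \<in> D" unfolding D_def by blast
    fix x assume "x \<in> D"
    then obtain a s where a: "0 \<le> a" "s \<in> cone n G0" "x = a \<cdot>\<^sub>v g + s" "\<epsilon> * a \<le> (\<Sum>i<n. s $ i)"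
      unfolding D_def by blast
    have s: "s \<in> carrier_vec n" using a(2) sub by auto
    show "c \<cdot>\<^sub>v x \<in> D" if c: "0 \<le> c" for c
    proof -
      have "c \<cdot>\<^sub>v x = (c * a) \<cdot>\<^sub>v g + c \<cdot>\<^sub>v s" using s gc unfolding a(3) by (intro eq_vecI) (auto simp: algebra_simps)
      moreover have "c \<cdot>\<^sub>v s \<in> cone n G0" using cc a(2) c by (simp add: convex_cone_def)
      moreover have "\<epsilon> * (c * a) \<le> (\<Sum>i<n. (c \<cdot>\<^sub>v s) $ i)"
        using mult_left_mono[OF a(4) c] s by (simp add: sum_distrib_left ac_simps)
      ultimately show ?thesis unfolding D_def using a(1) c mult_nonneg_nonneg by blast
    qed
    fix y assume "y \<in> D"
    then obtain a' s' where a': "0 \<le> a'" "s' \<in> cone n G0" "y = a' \<cdot>\<^sub>v g + s'" "\<epsilon> * a' \<le> (\<Sum>i<n. s' $ i)"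
      unfolding D_def by blast
    have s': "s' \<in> carrier_vec n" using a'(2) sub by auto
    have "x + y = (a + a') \<cdot>\<^sub>v g + (s + s')" using s s' gc unfolding a(3) a'(3)
      by (intro eq_vecI) (auto simp: algebra_simps)
    moreover have "s + s' \<in> cone n G0" using cc a(2) a'(2) by (simp add: convex_cone_def)
    moreover have "\<epsilon> * (a + a') \<le> (\<Sum>i<n. (s + s') $ i)"
      using a(4) a'(4) s s' by (simp add: sum.distrib distrib_left)
    ultimately show "x + y \<in> D" unfolding D_def using a(1) a'(1) add_nonneg_nonneg by blast
  qed
  moreover have "v k \<in> D" for k
  proof -
    have "\<epsilon> * \<alpha> k \<le> (\<Sum>i<n. r k $ i)"
    proof (cases "0 < \<alpha> k")
      case True
      then show ?thesis using neg by force
    next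
      case False
      then have "\<alpha> k = 0" using split(2)[of k] by simp
      then show ?thesis using s0[of "r k"] split(3)[of k] by (auto simp: G0_def intro!: sum_nonneg)
    qed
    then show ?thesis unfolding D_def G0_def using split by blast
  qed
  ultimately have VD: "cone n (range v) \<subseteq> D" by (intro cone_least) auto
  have "range v \<subseteq> carrier_vec n"
  proof clarify
    fix k
    have "r k \<in> carrier_vec n" using split(3)[of k] sub by (auto simp: G0_def)
    then show "v k \<in> carrier_vec n" using gc by (simp add: split(1))
  qed
  from convex_cone_cone[OF this] have Vc: "cone n (range v) \<subseteq> carrier_vec n" by (simp add: convex_cone_def)
  obtain y where y: "\<And>t. y t \<in> cone n (range v)" "\<And>i. i < n \<Longrightarrow> (\<lambda>t. y t $ i) \<longlonglongrightarrow> g $ i"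
    using closure unfolding euclidean_closure_iff[OF Vc] by blast
  have "\<exists>a s. 0 \<le> a \<and> s \<in> cone n G0 \<and> y t = a \<cdot>\<^sub>v g + s \<and> \<epsilon> * a \<le> (\<Sum>i<n. s $ i)" for t
    using y(1)[of t] VD unfolding D_def by blast
  then obtain a s where as: "\<And>t. 0 \<le> a t" "\<And>t. s t \<in> cone n G0" "\<And>t. y t = a t \<cdot>\<^sub>v g + s t"
    "\<And>t. \<epsilon> * a t \<le> (\<Sum>i<n. s t $ i)" by metis
  have sc: "s t \<in> carrier_vec n" for t using as(2) sub by auto
  have yi: "y t $ i = a t * g $ i + s t $ i" if "i < n" for t i
    using that gc carrier_vecD[OF sc] by (simp add: as(3))
  have "Bseq (\<lambda>t. y t $ i0)" using y(2)[OF i0(1)] by (intro convergent_imp_Bseq) (auto simp: convergent_def)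
  then obtain B where B: "\<forall>t. norm (y t $ i0) \<le> B" unfolding Bseq_def by blast
  have "\<bar>a t\<bar> \<le> B / g $ i0" for t
  proof -
    have "a t * g $ i0 \<le> B" using yi[OF i0(1), of t] s0[OF as(2) i0(1), of t] B[rule_format, of t] by simp
    then show ?thesis using i0(2) as(1)[of t] by (simp add: field_simps)
  qed
  then obtain f l where f: "strict_mono f" "(\<lambda>t. a (f t)) \<longlonglongrightarrow> l"
    using real_bounded_convergent_subseq by blast
  have slim: "(\<lambda>t. s (f t) $ i) \<longlonglongrightarrow> g $ i - l * g $ i" if i: "i < n" for i
  proof -
    have "(\<lambda>t. y (f t) $ i - a (f t) * g $ i) \<longlonglongrightarrow> g $ i - l * g $ i"
      using LIMSEQ_subseq_LIMSEQ[OF y(2)[OF i] f(1)] f(2)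
      by (intro tendsto_diff tendsto_mult_right) (auto simp: o_def)
    then show ?thesis by (simp add: yi[OF i])
  qed
  \<comment> \<open>The limit of the s components. If l < 1, rescaling would put g into the cone of
    the other generators; l > 1 would make the positive coordinate i0 negative. Hence l = 1 and the
    s components tend to 0, while their entry sums should stay above \<epsilon> times coefficients
    tending to 1.\<close>
  have "(1 - l) \<cdot>\<^sub>v g \<in> euclidean_closure n (cone n G0)"
    unfolding euclidean_closure_iff[OF sub]
    using as(2) slim gc by (intro conjI exI[of _ "\<lambda>t. s (f t)"]) (auto simp: left_diff_distrib)
  then have rem: "(1 - l) \<cdot>\<^sub>v g \<in> cone n G0"
    using closed_cone_nonneg[OF G0(2,1)] nonneg by (auto simp: G0_def)
  have l0: "0 \<le> l" using as(1) by (intro LIMSEQ_le_const[OF f(2)]) auto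
  have "0 \<le> (1 - l) * g $ i0" using s0[OF rem i0(1)] i0 gc by simp
  then have "l \<le> 1" using i0(2) by (simp add: zero_le_mult_iff)
  moreover have "\<not> l < 1"
  proof
    assume l1: "l < 1"
    have "(1 / (1 - l)) \<cdot>\<^sub>v ((1 - l) \<cdot>\<^sub>v g) \<in> cone n G0"
      using cc rem l1 by (simp add: convex_cone_def)
    then show False using g(2) l1 by (simp add: smult_smult_assoc G0_def)
  qed
  ultimately have l1: "l = 1" by simp
  have "(\<lambda>t. \<Sum>i<n. s (f t) $ i) \<longlonglongrightarrow> (\<Sum>i<n. g $ i - l * g $ i)"
    using slim by (intro tendsto_sum) auto
  then have "(\<lambda>t. \<Sum>i<n. s (f t) $ i) \<longlonglongrightarrow> 0" by (simp add: l1)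
  moreover have "(\<lambda>t. \<epsilon> * a (f t)) \<longlonglongrightarrow> \<epsilon> * 1" using f(2) l1 by (intro tendsto_mult_left) simp
  ultimately have "\<epsilon> * 1 \<le> 0" using as(4) by (intro LIMSEQ_le) auto
  then show False using \<epsilon> by simp
qed

context controllable_system
begin

abbreviation limit_cone :: "nat \<Rightarrow> real vec set" where
  "limit_cone k \<equiv> cone n ({orbit i | i. i < k} \<union> {limit_orbit j | j. j < h})"

lemma limit_cone_generators_carrier: "{orbit i | i. i < k} \<union> {limit_orbit j | j. j < h} \<subseteq> carrier_vec n"
  by auto

lemma convex_cone_limit_cone: "convex_cone n (limit_cone k)"
  by (rule convex_cone_cone[OF limit_cone_generators_carrier])

text \<open>Every irredundant generator lies on the ray of some \<open>orbit k\<close> or, if it is only approached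
  along a sequence of indices tending to infinity, on the ray of some \<open>limit_orbit j\<close>.\<close>

lemma irredundant_generator_in_limit_cone:
  assumes G: "finite G" "G \<subseteq> carrier_vec n" "Conset_inf A b = cone n G"
    and g: "g \<in> G" "g \<notin> cone n (G - {g})"
  shows "\<exists>k. g \<in> limit_cone k"
proof -
  have G0: "G - {g} \<subseteq> carrier_vec n" using G by auto
  have gc: "g \<in> carrier_vec n" using G g by auto
  have nonneg: "0 \<le> x $ i" if "x \<in> G" "i < n" for x i
    using Conset_inf_nonneg[of x i] that cone_incl[OF G(2), of x] G(3) by simp
  have closure: "g \<in> euclidean_closure n (cone n (range orbit))"
    using cone_incl[OF G(2) g(1)] unfolding G(3)[symmetric] Conset_inf_eq .
  have "\<exists>a s. 0 \<le> a \<and> s \<in> cone n (G - {g}) \<and> orbit k = a \<cdot>\<^sub>v g + s" for k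
    using cone_split[OF G(2) g(1), of "orbit k"] orbit_in_Conset_inf[of k] G(3) by auto
  then obtain \<alpha> r where split: "\<And>k. orbit k = \<alpha> k \<cdot>\<^sub>v g + r k" "\<And>k. 0 \<le> \<alpha> k" "\<And>k. r k \<in> cone n (G - {g})"
    by metis
  have rc: "r k \<in> carrier_vec n" for k using split(3)[of k] convex_cone_cone[OF G0] by (auto simp: convex_cone_def)
  have r0: "0 \<le> r k $ i" if "i < n" for k i
    using Conset_inf_nonneg[of "r k" i] that split(3)[of k] cone_mono[of "G - {g}" G n] G(3) by auto
  have rsum: "r k $ i \<le> (\<Sum>i<n. r k $ i)" if "i < n" for k i
    using that r0 by (intro member_le_sum) auto
  have vi: "orbit k $ i = \<alpha> k * g $ i + r k $ i" if "i < n" for k i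
    using that gc carrier_vecD[OF rc] by (simp add: split(1))
  have approx: "\<exists>k. 0 < \<alpha> k \<and> (\<Sum>i<n. r k $ i) \<le> \<epsilon> * \<alpha> k" if "0 < \<epsilon>" for \<epsilon>
    using G(1,2) nonneg g closure split that by (rule irredundant_generator_approx)
  show ?thesis
  proof (cases "\<exists>k. 0 < \<alpha> k \<and> (\<Sum>i<n. r k $ i) = 0")
    case True
    then obtain k where k: "0 < \<alpha> k" "(\<Sum>i<n. r k $ i) = 0" by blast
    have "r k $ i = 0" if "i < n" for i using rsum[OF that, of k] r0[OF that, of k] k(2) by simp
    then have "g = (1 / \<alpha> k) \<cdot>\<^sub>v orbit k" using gc k(1) by (intro eq_vecI) (auto simp: vi)
    moreover have "orbit k \<in> limit_cone (Suc k)" by (intro cone_incl limit_cone_generators_carrier) auto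
    ultimately have "g \<in> limit_cone (Suc k)"
      using convex_cone_limit_cone[of "Suc k"] k(1) by (simp add: convex_cone_def)
    then show ?thesis by blast
  next
    case False
    have pos: "0 < (\<Sum>i<n. r k $ i)" if "0 < \<alpha> k" for k
      using False that r0[of _ k] sum_nonneg[of "{..<n}" "\<lambda>i. r k $ i"] by (metis lessThan_iff order_le_less)
    have "\<exists>k\<ge>t. 0 < \<alpha> k \<and> (\<Sum>i<n. r k $ i) \<le> inverse (real (Suc t)) * \<alpha> k" for t
    proof -
      \<comment> \<open>No orbit vector with positive \<alpha> lies exactly on the ray of g here. An
        accuracy of at most half of each ratio already attained before t forces the approximating
        index to be at least t.\<close>
      define E where "E = insert (inverse (real (Suc t))) ((\<lambda>k. (\<Sum>i<n. r k $ i) / (2 * \<alpha> k)) ` {k. k < t \<and> 0 < \<alpha> k})"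
      have E: "finite E" "E \<noteq> {}" by (auto simp: E_def)
      have "0 < e" if "e \<in> E" for e using that pos by (auto simp: E_def)
      then have "0 < Min E" using E by simp
      from approx[OF this] obtain k where k: "0 < \<alpha> k" "(\<Sum>i<n. r k $ i) \<le> Min E * \<alpha> k" by blast
      have "\<not> k < t"
      proof
        assume "k < t"
        then have "Min E \<le> (\<Sum>i<n. r k $ i) / (2 * \<alpha> k)" using k(1) E by (intro Min_le) (auto simp: E_def)
        then have "Min E * \<alpha> k \<le> (\<Sum>i<n. r k $ i) / 2" using k(1) by (simp add: field_simps)
        then show False using k(2) pos[OF k(1)] by linarith
      qed
      moreover have "Min E \<le> inverse (real (Suc t))" using E by (intro Min_le) (auto simp: E_def)
      then have "Min E * \<alpha> k \<le> inverse (real (Suc t)) * \<alpha> k" using k(1) by (intro mult_right_mono) auto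
      ultimately show ?thesis using k by (intro exI[of _ k]) linarith
    qed
    then obtain \<kappa> where \<kappa>: "\<And>t. t \<le> \<kappa> t" "\<And>t. 0 < \<alpha> (\<kappa> t)"
      "\<And>t. (\<Sum>i<n. r (\<kappa> t) $ i) \<le> inverse (real (Suc t)) * \<alpha> (\<kappa> t)" by metis
    \<comment> \<open>The scaled orbit converges only along a fixed residue modulo h, so infinitely
      many approximating indices with the same residue j are selected.\<close>
    have "finite ((\<lambda>t. \<kappa> t mod h) ` UNIV)"
      by (rule finite_subset[of _ "{..<h}"]) (use h_pos in auto)
    then obtain t0 where t0: "infinite {t \<in> UNIV. \<kappa> t mod h = \<kappa> t0 mod h}"
      using pigeonhole_infinite[of "UNIV :: nat set" "\<lambda>t. \<kappa> t mod h"] infinite_UNIV_nat by blast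
    define j where "j = \<kappa> t0 mod h"
    define T where "T = {t. \<kappa> t mod h = j}"
    define f where "f = enumerate T"
    have T: "infinite T" using t0 by (simp add: T_def j_def)
    have f: "strict_mono f" "\<And>t. \<kappa> (f t) mod h = j"
      using strict_mono_enumerate[OF T] enumerate_in_set[OF T] by (auto simp: f_def T_def)
    have ft: "t \<le> f t" for t using f(1) by (rule strict_mono_imp_increasing)
    define q where "q t = \<kappa> (f t) div h" for t
    have qj: "q t * h + j = \<kappa> (f t)" for t unfolding q_def f(2)[of t, symmetric] by simp
    have "filterlim q at_top sequentially"
      unfolding filterlim_at_top
    proof
      fix Z
      have "Z \<le> q t" if "Z * h \<le> t" for t
      proof -
        have "Z * h \<le> \<kappa> (f t)" using that ft[of t] \<kappa>(1)[of "f t"] by linarith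
        then have "Z * h div h \<le> q t" unfolding q_def by (rule div_le_mono)
        then show ?thesis using h_pos by simp
      qed
      then show "\<forall>\<^sub>F t in sequentially. Z \<le> q t" unfolding eventually_sequentially by blast
    qed
    from filterlim_compose[OF orbit_lim this]
    have lim1: "(\<lambda>t. orbit (\<kappa> (f t)) $ i / rho A ^ (q t * h)) \<longlonglongrightarrow> limit_orbit j $ i" if "i < n" for i
      unfolding qj[symmetric] using that .
    have lim2: "(\<lambda>t. orbit (\<kappa> (f t)) $ i / \<alpha> (\<kappa> (f t))) \<longlonglongrightarrow> g $ i" if i: "i < n" for i
    proof -
      have e: "orbit k $ i / \<alpha> k = g $ i + r k $ i / \<alpha> k" if "0 < \<alpha> k" for k
        using that by (simp add: vi[OF i] field_simps)
      have le: "r (\<kappa> (f t)) $ i / \<alpha> (\<kappa> (f t)) \<le> inverse (real (Suc t))" for t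
      proof -
        have "r (\<kappa> (f t)) $ i \<le> inverse (real (Suc (f t))) * \<alpha> (\<kappa> (f t))"
          using rsum[OF i] \<kappa>(3) by (rule order_trans)
        also have "\<dots> \<le> inverse (real (Suc t)) * \<alpha> (\<kappa> (f t))"
          using ft[of t] \<kappa>(2)[of "f t"] by (intro mult_right_mono le_imp_inverse_le) auto
        finally show ?thesis using \<kappa>(2)[of "f t"] by (simp add: field_simps)
      qed
      have ge: "0 \<le> r (\<kappa> (f t)) $ i / \<alpha> (\<kappa> (f t))" for t
        using r0[OF i] \<kappa>(2)[of "f t"] by (intro divide_nonneg_nonneg) auto
      have "(\<lambda>t. r (\<kappa> (f t)) $ i / \<alpha> (\<kappa> (f t))) \<longlonglongrightarrow> 0"
        by (rule tendsto_sandwich[OF _ _ tendsto_const LIMSEQ_inverse_real_of_nat])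
          (rule always_eventually, rule allI, rule ge, rule always_eventually, rule allI, rule le)
      from tendsto_add[OF tendsto_const[of "g $ i"] this] show ?thesis by (simp add: e[OF \<kappa>(2)])
    qed
    obtain i0 where i0: "i0 < n" "0 < limit_orbit j $ i0" using limit_orbit_nonzero by blast
    \<comment> \<open>The same orbit vectors converge under two normalisations, by powers of
      \<open>rho A\<close> to a limit vector and by \<alpha> to g. Multiplying coordinates crosswise
      compares the limits without a limit for the quotient of the normalisations.\<close>
    have ratio: "limit_orbit j $ i0 * g $ i = limit_orbit j $ i * g $ i0" if i: "i < n" for i
    proof (rule LIMSEQ_unique)
      let ?x = "\<lambda>t. orbit (\<kappa> (f t)) $ i0 / rho A ^ (q t * h) * (orbit (\<kappa> (f t)) $ i / \<alpha> (\<kappa> (f t)))"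
      show "?x \<longlonglongrightarrow> limit_orbit j $ i0 * g $ i" by (intro tendsto_mult lim1 lim2 i i0)
      have "?x = (\<lambda>t. orbit (\<kappa> (f t)) $ i / rho A ^ (q t * h) * (orbit (\<kappa> (f t)) $ i0 / \<alpha> (\<kappa> (f t))))"
        by (simp add: ac_simps)
      also have "\<dots> \<longlonglongrightarrow> limit_orbit j $ i * g $ i0" by (intro tendsto_mult lim1 lim2 i i0)
      finally show "?x \<longlonglongrightarrow> limit_orbit j $ i * g $ i0" .
    qed
    define c where "c = g $ i0 / limit_orbit j $ i0"
    have "g = c \<cdot>\<^sub>v limit_orbit j"
      using gc ratio i0(2) by (intro eq_vecI) (auto simp: c_def field_simps)
    moreover have "0 \<le> c" using nonneg[OF g(1) i0(1)] i0(2) by (simp add: c_def)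
    moreover have "limit_orbit j \<in> limit_cone 0"
      using h_pos by (intro cone_incl limit_cone_generators_carrier) (auto simp: j_def)
    then have "\<forall>c\<ge>0. c \<cdot>\<^sub>v limit_orbit j \<in> limit_cone 0"
      using convex_cone_limit_cone[of 0] unfolding convex_cone_def by blast
    ultimately have "g \<in> limit_cone 0" by simp
    then show ?thesis by blast
  qed
qed

text \<open>A generating set of least cardinality is irredundant. Each of its finitely many members
  lies in some limit cone, and these cones increase with k, so one k serves all of them; then the
  whole controllable set, including orbit k itself, lies in that cone.\<close>

lemma polyhedral_imp_orbit_in_limit_cone:
  assumes "polyhedral n (Conset_inf A b)"
  shows "\<exists>k. orbit k \<in> limit_cone k"
proof -
  let ?Q = "\<lambda>G. finite G \<and> G \<subseteq> carrier_vec n \<and> Conset_inf A b = cone n G"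
  obtain G1 where "?Q G1" using assms unfolding polyhedral_def by blast
  then obtain G where Q: "?Q G" and least: "\<And>H. ?Q H \<Longrightarrow> card G \<le> card H"
    using ex_has_least_nat[of ?Q G1 card] by blast
  have "g \<notin> cone n (G - {g})" if g: "g \<in> G" for g
  proof
    assume gin: "g \<in> cone n (G - {g})"
    have G0: "G - {g} \<subseteq> carrier_vec n" using Q by auto
    have "G \<subseteq> cone n (G - {g})"
    proof
      fix x assume "x \<in> G"
      then show "x \<in> cone n (G - {g})" using gin cone_incl[OF G0, of x] by (cases "x = g") auto
    qed
    then have "cone n G \<subseteq> cone n (G - {g})" by (rule cone_least[OF convex_cone_cone[OF G0]])
    moreover have "cone n (G - {g}) \<subseteq> cone n G" by (rule cone_mono) auto
    ultimately have "?Q (G - {g})" using Q by auto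
    then have "card G \<le> card (G - {g})" by (rule least)
    then show False using Q g card_Diff1_less[of G g] by linarith
  qed
  then have "\<forall>g\<in>G. \<exists>k. g \<in> limit_cone k"
    using irredundant_generator_in_limit_cone Q by blast
  then obtain kf where "\<forall>g\<in>G. g \<in> limit_cone (kf g)" by (rule bchoice[THEN exE])
  then have kf: "g \<in> limit_cone (kf g)" if "g \<in> G" for g using that by blast
  define k where "k = Max (insert 0 (kf ` G))"
  have "g \<in> limit_cone k" if "g \<in> G" for g
  proof -
    have "kf g \<le> k" unfolding k_def using Q that by (intro Max_ge) auto
    then have "limit_cone (kf g) \<subseteq> limit_cone k" by (intro cone_mono) auto
    then show ?thesis using kf[OF that] by blast
  qed
  then have "cone n G \<subseteq> limit_cone k" by (intro cone_least[OF convex_cone_limit_cone]) auto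
  then show ?thesis using orbit_in_Conset_inf[of k] Q by blast
qed

text \<open>Only second components matter. The vectors whose second component is p(A2)
  \<open>b2\<close> with p nonnegative of order below k, the first component being arbitrary, form a
  convex cone that contains lower iterates (p a monomial) and limit vectors (p = 0). Comparing
  second components of orbit k gives x^k - p as the recursion.\<close>

lemma orbit_in_limit_cone_imp_recursion:
  assumes "orbit k \<in> limit_cone k"
  shows "\<exists>F. recursion_poly F \<and> char_poly A2 dvd F"
proof -
  \<comment> \<open>Vanishing coefficients from k on, rather than degree below k, so that the zero
    polynomial belongs to P also for k = 0.\<close>
  define P where "P = {p :: real poly. (\<forall>i. 0 \<le> coeff p i) \<and> (\<forall>i\<ge>k. coeff p i = 0)}"
  define D where "D = {S *\<^sub>v (x @\<^sub>v pact A2 p b2) | x p. x \<in> carrier_vec h \<and> p \<in> P}"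
  have pc: "pact A2 p b2 \<in> carrier_vec (n - h)" for p using A2 by simp
  have inD: "z \<in> D" if "z = S *\<^sub>v (x @\<^sub>v pact A2 p b2)" "x \<in> carrier_vec h" "p \<in> P" for z x p
    unfolding D_def that(1) using that(2,3) by (intro CollectI exI conjI) (rule refl)
  have "convex_cone n D"
    unfolding convex_cone_def
  proof (intro conjI ballI allI impI)
    show "D \<subseteq> carrier_vec n" using S pc by (auto simp: D_def intro!: mult_mat_vec_carrier[of _ n n])
    have "0\<^sub>v h @\<^sub>v pact A2 0 b2 = (0\<^sub>v n :: real vec)" using A2 h_le by (intro eq_vecI) auto
    then have "S *\<^sub>v (0\<^sub>v h @\<^sub>v pact A2 0 b2) = 0\<^sub>v n" using S by simp
    moreover have "0 \<in> P" by (simp add: P_def)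
    ultimately show "0\<^sub>v n \<in> D" using inD[OF _ zero_carrier_vec] by metis
    fix x assume "x \<in> D"
    then obtain x1 p where x: "x = S *\<^sub>v (x1 @\<^sub>v pact A2 p b2)" "x1 \<in> carrier_vec h" "p \<in> P" by (auto simp: D_def)
    show "c \<cdot>\<^sub>v x \<in> D" if c: "0 \<le> c" for c
    proof -
      have "c \<cdot>\<^sub>v x = S *\<^sub>v (c \<cdot>\<^sub>v (x1 @\<^sub>v pact A2 p b2))"
        unfolding x(1) by (rule mult_mat_vec[OF S append_carrier[OF x(2) pc], symmetric])
      also have "c \<cdot>\<^sub>v (x1 @\<^sub>v pact A2 p b2) = (c \<cdot>\<^sub>v x1) @\<^sub>v pact A2 (smult c p) b2"
        unfolding pact_smult[OF A2] using x(2) A2 by (intro eq_vecI) auto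
      finally have "c \<cdot>\<^sub>v x = S *\<^sub>v ((c \<cdot>\<^sub>v x1) @\<^sub>v pact A2 (smult c p) b2)" .
      moreover have "smult c p \<in> P" using x(3) c by (simp add: P_def)
      moreover have "c \<cdot>\<^sub>v x1 \<in> carrier_vec h" using x(2) by simp
      ultimately show ?thesis by (intro inD)
    qed
    fix y assume "y \<in> D"
    then obtain y1 q where y: "y = S *\<^sub>v (y1 @\<^sub>v pact A2 q b2)" "y1 \<in> carrier_vec h" "q \<in> P" by (auto simp: D_def)
    have "x + y = S *\<^sub>v ((x1 @\<^sub>v pact A2 p b2) + (y1 @\<^sub>v pact A2 q b2))"
      unfolding x(1) y(1)
      by (rule mult_add_distrib_mat_vec[OF S append_carrier[OF x(2) pc] append_carrier[OF y(2) pc], symmetric])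
    also have "(x1 @\<^sub>v pact A2 p b2) + (y1 @\<^sub>v pact A2 q b2) = (x1 + y1) @\<^sub>v pact A2 (p + q) b2"
      unfolding pact_add[OF A2] using x(2) y(2) A2 by (intro eq_vecI) auto
    finally have "x + y = S *\<^sub>v ((x1 + y1) @\<^sub>v pact A2 (p + q) b2)" .
    moreover have "p + q \<in> P" using x(3) y(3) by (simp add: P_def)
    moreover have "x1 + y1 \<in> carrier_vec h" using x(2) y(2) by simp
    ultimately show "x + y \<in> D" by (intro inD)
  qed
  moreover have "orbit i \<in> D" if "i < k" for i
  proof -
    have "pact A2 (monom 1 i) b2 = (A2 ^\<^sub>m i) *\<^sub>v b2" by (simp add: pact_monom[OF A2 b2_carrier])
    then have "orbit i = S *\<^sub>v (((A1 ^\<^sub>m i) *\<^sub>v b1) @\<^sub>v pact A2 (monom 1 i) b2)" by (simp add: orbit_split)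
    moreover have "monom 1 i \<in> P" using that by (simp add: P_def)
    moreover have "(A1 ^\<^sub>m i) *\<^sub>v b1 \<in> carrier_vec h" using A1 by simp
    ultimately show ?thesis by (intro inD)
  qed
  moreover have "limit_orbit j \<in> D" for j
  proof -
    have "limit_orbit j = S *\<^sub>v (((A1 ^\<^sub>m j) *\<^sub>v b1) @\<^sub>v pact A2 0 b2)" using A2 by (simp add: limit_orbit_def)
    moreover have "0 \<in> P" by (simp add: P_def)
    moreover have "(A1 ^\<^sub>m j) *\<^sub>v b1 \<in> carrier_vec h" using A1 by simp
    ultimately show ?thesis by (intro inD)
  qed
  ultimately have "limit_cone k \<subseteq> D" by (intro cone_least) auto
  then obtain x p where xp: "orbit k = S *\<^sub>v (x @\<^sub>v pact A2 p b2)" "x \<in> carrier_vec h" "p \<in> P"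
    using assms by (auto simp: D_def)
  have c1: "(A1 ^\<^sub>m k) *\<^sub>v b1 \<in> carrier_vec h" and c2: "(A2 ^\<^sub>m k) *\<^sub>v b2 \<in> carrier_vec (n - h)" using A1 A2 by simp_all
  have inj: "y = z" if "S *\<^sub>v y = S *\<^sub>v z" "y \<in> carrier_vec n" "z \<in> carrier_vec n" for y z
  proof -
    have "S' *\<^sub>v (S *\<^sub>v x) = x" if "x \<in> carrier_vec n" for x
      using assoc_mult_mat_vec[OF S' S that] that by (simp add: S'S_one)
    then show ?thesis using that by metis
  qed
  have "((A1 ^\<^sub>m k) *\<^sub>v b1) @\<^sub>v ((A2 ^\<^sub>m k) *\<^sub>v b2) = x @\<^sub>v pact A2 p b2"
    using xp(1) unfolding orbit_split by (rule inj[OF _ append_carrier[OF c1 c2] append_carrier[OF xp(2) pc]])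
  then have eq: "(A2 ^\<^sub>m k) *\<^sub>v b2 = pact A2 p b2" using append_vec_eq[OF c1 xp(2)] by blast
  define F where "F = monom 1 k - p"
  have p0: "\<And>i. 0 \<le> coeff p i" "\<And>i. i \<ge> k \<Longrightarrow> coeff p i = 0" using xp(3) by (auto simp: P_def)
  have coF: "coeff F i = (if i = k then 1 else 0) - coeff p i" for i by (simp add: F_def)
  have "degree F \<le> k" using p0(2) by (intro degree_le) (auto simp: coF)
  moreover have "k \<le> degree F" using p0(2) by (intro le_degree) (auto simp: coF)
  ultimately have degF: "degree F = k" by simp
  have "recursion_poly F" using p0 by (auto simp: recursion_poly_def degF coF)
  moreover have "pact A2 F b2 = 0\<^sub>v (n - h)"
  proof -
    have sum: "pact A2 F b2 + pact A2 p b2 = pact A2 p b2"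
      using pact_add[OF A2, of F p b2] eq by (simp add: F_def pact_monom[OF A2 b2_carrier])
    show ?thesis
    proof (rule eq_vecI)
      fix i assume "i < dim_vec (0\<^sub>v (n - h) :: real vec)"
      then show "pact A2 F b2 $ i = 0\<^sub>v (n - h) $ i"
        using arg_cong[OF sum, of "\<lambda>x. x $ i"] A2 by simp
    qed (use A2 in simp)
  qed
  ultimately show ?thesis using pact_A2_zero_iff by blast
qed

lemma polyhedral_imp_nonneg_recursion: "polyhedral n (Conset_inf A b) \<Longrightarrow> nonneg_recursion A2"
  unfolding nonneg_recursion_iff
  using polyhedral_imp_orbit_in_limit_cone orbit_in_limit_cone_imp_recursion by blast

text \<open>The detour through (c) replaces the given recursion by one in x^d whose value at
  \<open>rho A ^ d\<close> is nonnegative.\<close>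

lemma nonneg_recursion_imp_limit_cone:
  assumes "nonneg_recursion A2"
  shows "\<exists>k\<ge>1. Conset_inf A b = limit_cone k"
proof -
  have dominant_root_condition using assms by (simp only: nonneg_recursion_iff_dominant_root_condition)
  from dominant_root_condition_imp_recursion[OF this] show ?thesis
    by (elim exE conjE) (rule recursion_imp_cone)
qed

lemma limit_cone_polyhedral: "polyhedral n (limit_cone k)"
  unfolding polyhedral_def using limit_cone_generators_carrier[of k]
  by (intro exI[of _ "{orbit i | i. i < k} \<union> {limit_orbit j | j. j < h}"]) auto

theorem polyhedral_iff_nonneg_recursion: "polyhedral n (Conset_inf A b) \<longleftrightarrow> nonneg_recursion A2"
proof
  assume "nonneg_recursion A2"
  then obtain k where "Conset_inf A b = limit_cone k" using nonneg_recursion_imp_limit_cone by blast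
  then show "polyhedral n (Conset_inf A b)" using limit_cone_polyhedral by simp
qed (rule polyhedral_imp_nonneg_recursion)

end

theorem theorem2:
  fixes A S S' A1 A2 :: "real mat" and b :: "real vec" and n h :: nat
  assumes "A \<in> carrier_mat n n" and "nonneg_mat A"
    and "irreducible_mat A" and "degree_of_cyclicity A h"
    and "b \<in> carrier_vec n" and "\<forall>i < n. 0 \<le> b $ i"
    and "vec_space.rank n (conmat n A b) = n"
    and "S \<in> carrier_mat n n" and "S' \<in> carrier_mat n n"
    and "inverts_mat S S'" and "inverts_mat S' S"
    and "A1 \<in> carrier_mat h h" and "A2 \<in> carrier_mat (n - h) (n - h)"
    and "S' * A * S = four_block_mat A1 (0\<^sub>m h (n - h)) (0\<^sub>m (n - h) h) A2"
    and "spec A1 = sigma_rho A" and "spec A2 = sigma_minus A"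
  shows
    "(polyhedral n (Conset_inf A b) \<longleftrightarrow> nonneg_recursion A2) \<and>
     (nonneg_recursion A2 \<longleftrightarrow>
        (\<forall>lr :: real. 0 < lr \<and> complex_of_real lr \<in> spec A2 \<longrightarrow>
           lr = rho A2 \<and>
           (\<forall>z \<in> sigma_rho A2. \<exists>\<phi> \<in> \<rat>.
              z = complex_of_real (rho A2) * exp (complex_of_real \<phi> * 2 * of_real pi * \<i>)) \<and>
           (\<forall>z \<in> sigma_rho A2. simple_eigenvalue A2 z) \<and>
           \<not> (\<exists>z \<in> sigma_minus A2. z \<noteq> 0 \<and>
                (\<exists>k :: int. Arg z = of_int k * (2 * pi / real (min_period h A2 * h)))))) \<and>
     (polyhedral n (Conset_inf A b) \<longrightarrow>
        (\<exists>k\<ge>1. Conset_inf A b =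
           cone n ({(A ^\<^sub>m i) *\<^sub>v b | i. i < k} \<union> {Af A h i *\<^sub>v b | i. i < h})))"
proof -
  interpret controllable_system A S S' A1 A2 b n h
    using assms by unfold_locales
  have "polyhedral n (Conset_inf A b) \<longrightarrow> (\<exists>k\<ge>1. Conset_inf A b = limit_cone k)"
    using polyhedral_iff_nonneg_recursion nonneg_recursion_imp_limit_cone by simp
  then show ?thesis
    unfolding Af_mult_b
    by (intro conjI polyhedral_iff_nonneg_recursion
        nonneg_recursion_iff_dominant_root_condition[unfolded dominant_root_condition_def])
      (simp only: orbit_def)
qed

end
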